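(* Let $R\in\mathfrak P$ and let $f$ be a meromorphic function on $\mathfrak a_{\mathbb C}$ such that, for every $x\in\mathfrak M_{sing}$, there is an open ball $B_x$ around $x$ such that $f$ is holomorphic on $B_x\setminus\bigcup_{g\in\mathfrak A_x}\{u:g(u-x)=0\}$. Then $$\mathrm{JK}(f,\zeta)=\sum_{T\in N^\theta(\bar Q)}\mathrm{IR}_0(\phi_{x_T}(f)),$$ where $N^\theta(\bar Q)$ is the set of $\theta$-stable spanning trees of the reduced quiver $\bar Q$.
   Context: **Setting.** $Q$ is a finite connected quiver without loops or oriented cycles, with the full abelian dimension vector $\mathbb I=\sum_{v\in Q_0}v$, and $\theta\in\mathbb{R}Q_0$ satisfies $\sum_v\theta_v=0$. The reduced quiver $\bar Q$ is obtained from $Q$ by identifying arrows with the same tail and the same head. Fix $v_0\in Q_0$; $\mathfrak a=\mathbb{R}^{Q_0\setminus\{v_0\}}$ with coordinates $u_v$, $u_{v_0}:=0$; $V=\mathfrak a^*$, $n=|Q_0|-1$. $\mathcal W\subset V$ is the set of weights $\rho_\alpha=u_{h(\alpha)}-u_{t(\alpha)}$, $\alpha\in\bar Q_1$. $\tilde\theta=\sum_{v\ne v_0}\theta_vu_v\in V$. For finite $S\subset V$, a vector of $V$ is $S$-regular if it lies in no subspace spanned by $n-1$ elements of $S$; the connected components of the set of $S$-regular vectors are the $S$-chambers; $\Sigma S$ is the set of all sums of distinct elements of $S$. Assume $\tilde\theta$ is $\mathcal W$-regular, and let $\zeta\in V$ be a $\Sigma\mathcal W$-regular vector in the same $\mathcal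 W$-chamber as $-\tilde\theta$. **Stable spanning trees.** A spanning tree $T$ of $\bar Q$ is a connected subquiver with $T_0=\bar Q_0$ and $|T_1|=|T_0|-1$. It is $\theta$-stable if the moduli space of $\theta$-stable representations of $T$ of dimension vector $\mathbb I$ is nonempty, where a representation is $\theta$-stable if $\sum_v\theta_v\dim S_v<0$ for all proper nonzero subrepresentations $S$. **$R$-charges and singular points.** For $R\in\mathbb{R}^{\mathcal W}$ let $H_\rho=\{\rho+R_\rho=0\}\subset\mathfrak a_{\mathbb C}$. $\mathfrak M_{sing}\subset\mathfrak a_{\mathbb C}$ is the set of points where at least $|Q_0|-1$ linearly independent hyperplanes $H_\rho$ meet; $\mathfrak A_x=\{\rho\in\mathcal W:x\in H_\rho\}$. $\mathfrak P\subset\mathbb{R}^{\mathcal W}$ is a dense open cone such that for $R\in\mathfrak P$ no $|Q_0|$ of the hyperplanes $H_\rho$ contain a common point of $\mathfrak M_{sing}$. For a spanning tree $T$ of $\bar Q$ the set $\{\rho_\alpha:\alpha\in T_1\}$ is a basis of $V$, and $x_T\in\mathfrak M_{sing}$ is the intersection point of the hyperplanes $H_{\rho_\alpha}$, $\alpha\in T_1$. $\phi_{x_T}$ is the isomorphism from germs of meromorphic functions at $x_T$ to germs at $0\in\mathbb{C}^{|Q_0|-1}$ given by translating $x_T$ to $0$ and using $\{\rho_\alpha\}_{\alpha\in T_1}$, in an arbitrary chosen ordering, as coordinates. **Iterated residue.** For a germ $f$ at $0\in\mathbb{C}^n$ of meromorphic function, $\mathrm{Res}_{z_1=0}f$ is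 the coefficient of $z_1^{-1}$ in the Laurent expansion of $f$ in $z_1$ with coefficients germs of meromorphic functions of $z_2,\dots,z_n$; $\mathrm{IR}_0(f)=\mathrm{Res}_{z_n=0}\cdots\mathrm{Res}_{z_1=0}f$. **JK residue.** For $A\subset V$ finite, spanning, contained in an open half-space, fix $d\mu=f_1\wedge\dots\wedge f_n$ with $f_i\in A$ a basis of $V$. $\mathcal{FL}(A)$ is the set of complete flags $\mathfrak F=[0=F_0\subset\dots\subset F_n=V]$, $\dim F_j=j$, with each $F_j$ spanned by elements of $A$; $\kappa_j^{\mathfrak F}=\sum_{\alpha\in A\cap F_j}\alpha$; $\nu(\mathfrak F)=0,1,-1$ if $(\kappa_j^{\mathfrak F})_j$ is not a basis, a positively, a negatively oriented basis for $d\mu$; $\mathrm{Res}_{\mathfrak F}(f)=\mathrm{IR}_0$ of $f$ written in coordinates $z_i=\gamma_i$, with $\gamma$ a basis of $V$ such that $\gamma_1,\dots,\gamma_m$ span $F_m$ for all $m$ and $\gamma_1\wedge\dots\wedge\gamma_n=d\mu$. For $\zeta$ $\Sigma A$-regular, $\mathrm{JK}_\zeta^A(f)=\sum_{\mathfrak F:\ \zeta\in\sum_j\mathbb{R}_{>0}\kappa_j^{\mathfrak F}}\nu(\mathfrak F)\mathrm{Res}_{\mathfrak F}(f)$. For $f$ meromorphic on $\mathfrak a_{\mathbb C}$, $\mathrm{JK}(f,\zeta)=\sum_{x\in\mathfrak M_{sing}}\mathrm{JK}_\zeta^{\mathfrak A_x}(f(\cdot+x))$. *)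

theory Defs
  imports
    "HOL-Complex_Analysis.Complex_Analysis"
    "Graph_Theory.Digraph_Component"
begin

text \<open>
  A quiver is a \<open>pre_digraph\<close> whose vertex set is all of a finite type \<open>'v\<close>, so
  \<open>|Q\<^sub>0| = CARD('v)\<close> and \<open>n = CARD('v) - 1\<close>. Both \<open>\<aa>\<close> and its dual \<open>V\<close> are realised as
  coordinate subspaces indexed by all vertices, with the \<open>v0\<close> coordinate equal to zero
  (the convention \<open>u\<^bsub>v0\<^esub> = 0\<close>). In particular \<open>n = 0\<close> is allowed.
\<close>


subsection \<open>The reduced quiver and its spanning trees\<close>

definition reduced_quiver :: "('v, 'a) pre_digraph \<Rightarrow> ('v, 'v \<times> 'v) pre_digraph" where
  "reduced_quiver Q =
     \<lparr>verts = verts Q, arcs = arc_to_ends Q ` arcs Q, tail = fst, head = snd\<rparr>"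

text \<open>
  Here \<open>Digraph_Component.connected\<close> is connectedness of the underlying undirected graph.
  The library's \<open>spanning_tree\<close> is not used, because it only forbids directed cycles.
\<close>

definition spanning_trees :: "('v, 'b) pre_digraph \<Rightarrow> ('v, 'b) pre_digraph set" where
  "spanning_trees G =
     {T. spanning T G \<and> Digraph_Component.connected T \<and> card (arcs T) + 1 = card (verts T)}"


subsection \<open>Stable representations with all dimensions equal to one\<close>

text \<open>
  A representation with dimension vector \<open>\<I>\<close> places the complex line \<open>\<complex>\<close> at each vertex, so
  the linear map of an arrow \<open>\<alpha>\<close> is multiplication by a number \<open>\<phi> \<alpha>\<close>. Representations are
  extensional functions, so that each is counted once.
\<close>

definition reps :: "('v, 'b) pre_digraph \<Rightarrow> ('b \<Rightarrow> complex) set" where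
  "reps G = (arcs G \<rightarrow>\<^sub>E UNIV)"

definition is_subrep ::
    "('v, 'b) pre_digraph \<Rightarrow> ('b \<Rightarrow> complex) \<Rightarrow> ('v \<Rightarrow> complex set) \<Rightarrow> bool" where
  "is_subrep G \<phi> S \<longleftrightarrow>
     (\<forall>v\<in>verts G. module.subspace ((*) :: complex \<Rightarrow> complex \<Rightarrow> complex) (S v)) \<and>
     (\<forall>\<alpha>\<in>arcs G. (\<lambda>z. \<phi> \<alpha> * z) ` S (tail G \<alpha>) \<subseteq> S (head G \<alpha>))"

definition stable_reps ::
    "real ^ 'v::finite \<Rightarrow> ('v, 'b) pre_digraph \<Rightarrow> ('b \<Rightarrow> complex) set" where
  "stable_reps \<theta> G =
     {\<phi> \<in> reps G. \<forall>S. is_subrep G \<phi> S \<and> (\<exists>v\<in>verts G. S v \<noteq> {0}) \<and> (\<exists>v\<in>verts G. S v \<noteq> UNIV)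
        \<longrightarrow> (\<Sum>v\<in>verts G. \<theta> $ v *
               real (vector_space.dim ((*) :: complex \<Rightarrow> complex \<Rightarrow> complex) (S v))) < 0}"

definition rep_iso ::
    "('v, 'b) pre_digraph \<Rightarrow> ('b \<Rightarrow> complex) set \<Rightarrow> (('b \<Rightarrow> complex) \<times> ('b \<Rightarrow> complex)) set" where
  "rep_iso G X =
     {(\<phi>, \<psi>) \<in> X \<times> X. \<exists>g. (\<forall>v\<in>verts G. g v \<noteq> 0) \<and>
        (\<forall>\<alpha>\<in>arcs G. \<psi> \<alpha> * g (tail G \<alpha>) = g (head G \<alpha>) * \<phi> \<alpha>)}"

text \<open>The points of the moduli space are the isomorphism classes of stable representations.\<close>

definition stable_moduli ::
    "real ^ 'v::finite \<Rightarrow> ('v, 'b) pre_digraph \<Rightarrow> ('b \<Rightarrow> complex) set set" where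
  "stable_moduli \<theta> G = stable_reps \<theta> G // rep_iso G (stable_reps \<theta> G)"

definition stable_spanning_trees ::
    "real ^ 'v::finite \<Rightarrow> ('v, 'b) pre_digraph \<Rightarrow> ('v, 'b) pre_digraph set" where
  "stable_spanning_trees \<theta> G = {T \<in> spanning_trees G. stable_moduli \<theta> T \<noteq> {}}"


subsection \<open>Weights, regular vectors and chambers\<close>

definition dual_space :: "'v::finite \<Rightarrow> (real ^ 'v) set" where
  "dual_space v0 = {\<xi>. \<xi> $ v0 = 0}"

definition cspace :: "'v::finite \<Rightarrow> (complex ^ 'v) set" where
  "cspace v0 = {u. u $ v0 = 0}"

definition pairing :: "real ^ 'v::finite \<Rightarrow> complex ^ 'v \<Rightarrow> complex" where
  "pairing \<xi> u = (\<Sum>v\<in>UNIV. complex_of_real (\<xi> $ v) * u $ v)"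

definition weight :: "'v::finite \<Rightarrow> ('v, 'b) pre_digraph \<Rightarrow> 'b \<Rightarrow> real ^ 'v" where
  "weight v0 G \<alpha> =
     (\<chi> v. if v = v0 then 0 else of_bool (v = head G \<alpha>) - of_bool (v = tail G \<alpha>))"

definition weights :: "'v::finite \<Rightarrow> ('v, 'a) pre_digraph \<Rightarrow> (real ^ 'v) set" where
  "weights v0 Q = weight v0 (reduced_quiver Q) ` arcs (reduced_quiver Q)"

definition theta_tilde :: "'v::finite \<Rightarrow> real ^ 'v \<Rightarrow> real ^ 'v" where
  "theta_tilde v0 \<theta> = (\<chi> v. if v = v0 then 0 else \<theta> $ v)"

text \<open>The condition \<open>card B + 1 = n\<close> says \<open>card B = n - 1\<close>, without truncated subtraction.\<close>

definition S_regular :: "'v::finite \<Rightarrow> (real ^ 'v) set \<Rightarrow> (real ^ 'v) set" where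
  "S_regular v0 S =
     {\<xi> \<in> dual_space v0. \<forall>B\<subseteq>S. finite B \<and> card B + 1 = CARD('v) - 1 \<longrightarrow> \<xi> \<notin> span B}"

definition chambers :: "'v::finite \<Rightarrow> (real ^ 'v) set \<Rightarrow> (real ^ 'v) set set" where
  "chambers v0 S = components (S_regular v0 S)"

definition subset_sums :: "(real ^ 'v::finite) set \<Rightarrow> (real ^ 'v) set" where
  "subset_sums S = {\<Sum>B | B. B \<subseteq> S \<and> finite B \<and> B \<noteq> {}}"


subsection \<open>Singular points\<close>

definition hyperplane ::
    "'v::finite \<Rightarrow> (real ^ 'v \<Rightarrow> real) \<Rightarrow> real ^ 'v \<Rightarrow> (complex ^ 'v) set" where
  "hyperplane v0 R \<rho> = {u \<in> cspace v0. pairing \<rho> u + complex_of_real (R \<rho>) = 0}"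

definition M_sing ::
    "'v::finite \<Rightarrow> (real ^ 'v) set \<Rightarrow> (real ^ 'v \<Rightarrow> real) \<Rightarrow> (complex ^ 'v) set" where
  "M_sing v0 W R =
     {x \<in> cspace v0. \<exists>B\<subseteq>W. independent B \<and> card B \<ge> CARD('v) - 1 \<and>
        (\<forall>\<rho>\<in>B. x \<in> hyperplane v0 R \<rho>)}"

definition active_weights ::
    "'v::finite \<Rightarrow> (real ^ 'v) set \<Rightarrow> (real ^ 'v \<Rightarrow> real) \<Rightarrow> complex ^ 'v \<Rightarrow> (real ^ 'v) set" where
  "active_weights v0 W R x = {\<rho> \<in> W. x \<in> hyperplane v0 R \<rho>}"

text \<open>
  The space of \<open>R\<close>-charges is realised as the extensional functions on \<open>W\<close>, with the product
  topology.
\<close>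

definition charge_topology :: "(real ^ 'v::finite) set \<Rightarrow> (real ^ 'v \<Rightarrow> real) topology" where
  "charge_topology W = product_topology (\<lambda>_. euclideanreal) W"

definition generic_cone ::
    "'v::finite \<Rightarrow> (real ^ 'v) set \<Rightarrow> (real ^ 'v \<Rightarrow> real) set \<Rightarrow> bool" where
  "generic_cone v0 W P \<longleftrightarrow>
     openin (charge_topology W) P \<and>
     (charge_topology W) closure_of P = topspace (charge_topology W) \<and>
     (\<forall>R\<in>P. \<forall>c>0. (\<lambda>\<rho>\<in>W. c * R \<rho>) \<in> P) \<and>
     (\<forall>R\<in>P. \<not> (\<exists>B\<subseteq>W. card B = CARD('v) \<and>
        (\<exists>x\<in>M_sing v0 W R. \<forall>\<rho>\<in>B. x \<in> hyperplane v0 R \<rho>)))"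


subsection \<open>Holomorphic and meromorphic functions of several variables\<close>

text \<open>\<open>U\<close> is meant to be a relatively open subset of \<open>cspace v0\<close>.\<close>

definition holomorphic_several ::
    "'v::finite \<Rightarrow> (complex ^ 'v \<Rightarrow> complex) \<Rightarrow> (complex ^ 'v) set \<Rightarrow> bool" where
  "holomorphic_several v0 f U \<longleftrightarrow>
     (\<forall>x\<in>U. \<exists>D. (f has_derivative D) (at x within cspace v0) \<and>
        (\<forall>c. \<forall>h\<in>cspace v0. D (c *s h) = c * D h))"

text \<open>
  A meromorphic function is locally a quotient of holomorphic functions, the denominator
  vanishing identically on no nonempty open set. It is represented by a total function; its
  values where the denominator vanishes are irrelevant.
\<close>

definition meromorphic_several :: "'v::finite \<Rightarrow> (complex ^ 'v \<Rightarrow> complex) \<Rightarrow> bool" where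
  "meromorphic_several v0 f \<longleftrightarrow>
     (\<forall>x\<in>cspace v0. \<exists>U g h. open U \<and> x \<in> U \<and>
        holomorphic_several v0 g (U \<inter> cspace v0) \<and>
        holomorphic_several v0 h (U \<inter> cspace v0) \<and>
        (\<forall>X. open X \<and> X \<subseteq> U \<and> X \<inter> cspace v0 \<noteq> {} \<longrightarrow> (\<exists>y\<in>X \<inter> cspace v0. h y \<noteq> 0)) \<and>
        (\<forall>y\<in>U \<inter> cspace v0. h y \<noteq> 0 \<longrightarrow> f y = g y / h y))"


subsection \<open>Iterated residues\<close>

text \<open>
  A point \<open>(z\<^sub>1, \<dots>, z\<^sub>n)\<close> of \<open>\<complex>\<^sup>n\<close> is a list, and a germ at \<open>0\<close> is represented by a function
  on such lists. Taking the coefficient of \<open>z\<^sub>1\<^sup>-\<^sup>1\<close> separately for each fixed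
  \<open>(z\<^sub>2, \<dots>, z\<^sub>n)\<close> represents the coefficient germ: write the germ as \<open>g / (z\<^sub>1\<^sup>k h)\<close> with
  \<open>h(0, z\<^sub>2, \<dots>, z\<^sub>n)\<close> not identically zero; then the two agree off the zero set of
  \<open>h(0, z\<^sub>2, \<dots>, z\<^sub>n)\<close>. Values on such thin sets do not affect the later coefficients, since
  a Laurent expansion at \<open>0\<close> depends only on the values in a small punctured disc.
\<close>

fun iterated_residue :: "nat \<Rightarrow> (complex list \<Rightarrow> complex) \<Rightarrow> complex" where
  "iterated_residue 0 f = f []"
| "iterated_residue (Suc n) f =
     iterated_residue n (\<lambda>zs. fls_residue (laurent_expansion (\<lambda>z. f (z # zs)) 0))"

definition is_basis :: "'v::finite \<Rightarrow> (real ^ 'v) list \<Rightarrow> bool" where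
  "is_basis v0 bs \<longleftrightarrow> distinct bs \<and> independent (set bs) \<and> span (set bs) = dual_space v0"

text \<open>\<open>f\<close> written in the coordinates \<open>z\<^sub>i = \<gamma>\<^sub>i\<close>, for a basis \<open>\<gamma>\<close> of the dual space.\<close>

definition in_coords ::
    "'v::finite \<Rightarrow> (real ^ 'v) list \<Rightarrow> (complex ^ 'v \<Rightarrow> complex) \<Rightarrow> complex list \<Rightarrow> complex" where
  "in_coords v0 \<gamma> f zs =
     f (THE u. u \<in> cspace v0 \<and> (\<forall>i<length \<gamma>. pairing (\<gamma> ! i) u = zs ! i))"


subsection \<open>The Jeffrey--Kirwan residue\<close>

text \<open>
  The scalar \<open>c\<close> with \<open>g\<^sub>1 \<and> \<dots> \<and> g\<^sub>n = c (d\<^sub>1 \<and> \<dots> \<and> d\<^sub>n)\<close>, for a basis \<open>d\<close>: the determinant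
  of the matrix of coordinates of the \<open>g\<^sub>i\<close> with respect to \<open>d\<close>.
\<close>

definition wedge_ratio :: "(real ^ 'v::finite) list \<Rightarrow> (real ^ 'v) list \<Rightarrow> real" where
  "wedge_ratio d g =
     (\<Sum>p | p permutes {..<length d}. of_int (sign p) *
        (\<Prod>i<length d. representation (set d) (g ! i) (d ! p i)))"

definition flags :: "'v::finite \<Rightarrow> (real ^ 'v) set \<Rightarrow> (real ^ 'v) set list set" where
  "flags v0 A =
     {F. length F = CARD('v) \<and> F ! 0 = {0} \<and> F ! (CARD('v) - 1) = dual_space v0 \<and>
        (\<forall>j\<le>CARD('v) - 1. subspace (F ! j) \<and> dim (F ! j) = j \<and> (\<exists>B\<subseteq>A. F ! j = span B)) \<and>
        (\<forall>j<CARD('v) - 1. F ! j \<subseteq> F ! Suc j)}"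

definition kappa :: "(real ^ 'v::finite) set \<Rightarrow> (real ^ 'v) set list \<Rightarrow> nat \<Rightarrow> real ^ 'v" where
  "kappa A F j = \<Sum>(A \<inter> F ! j)"

definition flag_sign ::
    "'v::finite \<Rightarrow> (real ^ 'v) list \<Rightarrow> (real ^ 'v) set \<Rightarrow> (real ^ 'v) set list \<Rightarrow> real" where
  "flag_sign v0 d A F =
     (let \<kappa> = map (kappa A F) [1..<CARD('v)]
      in if is_basis v0 \<kappa> then sgn (wedge_ratio d \<kappa>) else 0)"

text \<open>The flag residue of a meromorphic germ does not depend on which adapted basis \<open>\<gamma>\<close> is chosen.\<close>

definition adapted_basis ::
    "'v::finite \<Rightarrow> (real ^ 'v) list \<Rightarrow> (real ^ 'v) set list \<Rightarrow> (real ^ 'v) list \<Rightarrow> bool" where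
  "adapted_basis v0 d F \<gamma> \<longleftrightarrow>
     is_basis v0 \<gamma> \<and> (\<forall>m\<le>CARD('v) - 1. span (set (take m \<gamma>)) = F ! m) \<and> wedge_ratio d \<gamma> = 1"

definition flag_residue ::
    "'v::finite \<Rightarrow> (real ^ 'v) list \<Rightarrow> (real ^ 'v) set list \<Rightarrow> (complex ^ 'v \<Rightarrow> complex) \<Rightarrow> complex"
  where
  "flag_residue v0 d F f =
     iterated_residue (CARD('v) - 1) (in_coords v0 (SOME \<gamma>. adapted_basis v0 d F \<gamma>) f)"

definition flag_cone ::
    "(real ^ 'v::finite) set \<Rightarrow> (real ^ 'v) set list \<Rightarrow> (real ^ 'v) set" where
  "flag_cone A F =
     {\<Sum>j = 1..CARD('v) - 1. c j *\<^sub>R kappa A F j | c. \<forall>j\<in>{1..CARD('v) - 1}. c j > 0}"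

text \<open>The basis \<open>d\<close>, consisting of elements of \<open>A\<close>, fixes \<open>d\<mu> = d\<^sub>1 \<and> \<dots> \<and> d\<^sub>n\<close>.\<close>

definition JK_residue ::
    "'v::finite \<Rightarrow> (real ^ 'v) list \<Rightarrow> (real ^ 'v) set \<Rightarrow> real ^ 'v \<Rightarrow>
      (complex ^ 'v \<Rightarrow> complex) \<Rightarrow> complex" where
  "JK_residue v0 d A \<zeta> f =
     (\<Sum>F | F \<in> flags v0 A \<and> \<zeta> \<in> flag_cone A F.
        complex_of_real (flag_sign v0 d A F) * flag_residue v0 d F f)"

definition JK ::
    "'v::finite \<Rightarrow> (real ^ 'v) set \<Rightarrow> (real ^ 'v \<Rightarrow> real) \<Rightarrow> (complex ^ 'v \<Rightarrow> (real ^ 'v) list) \<Rightarrow>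
      (complex ^ 'v \<Rightarrow> complex) \<Rightarrow> real ^ 'v \<Rightarrow> complex" where
  "JK v0 W R d f \<zeta> =
     (\<Sum>x\<in>M_sing v0 W R. JK_residue v0 (d x) (active_weights v0 W R x) \<zeta> (\<lambda>u. f (u + x)))"


subsection \<open>The singular point of a spanning tree\<close>

definition tree_point ::
    "'v::finite \<Rightarrow> (real ^ 'v \<Rightarrow> real) \<Rightarrow> ('v, 'b) pre_digraph \<Rightarrow> complex ^ 'v" where
  "tree_point v0 R T =
     (THE x. x \<in> cspace v0 \<and> (\<forall>\<alpha>\<in>arcs T. x \<in> hyperplane v0 R (weight v0 T \<alpha>)))"

text \<open>
  Translation of \<open>x\<^sub>T\<close> to \<open>0\<close>, followed by passing to the coordinates \<open>\<rho>\<^sub>\<alpha>\<close>, where the list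
  \<open>as\<close> enumerates the arrows \<open>\<alpha>\<close> of \<open>T\<close>.
\<close>

definition tree_germ ::
    "'v::finite \<Rightarrow> (real ^ 'v \<Rightarrow> real) \<Rightarrow> ('v, 'b) pre_digraph \<Rightarrow> 'b list \<Rightarrow>
      (complex ^ 'v \<Rightarrow> complex) \<Rightarrow> complex list \<Rightarrow> complex" where
  "tree_germ v0 R T as f =
     in_coords v0 (map (weight v0 T) as) (\<lambda>u. f (u + tree_point v0 R T))"

end

theory Submission
  imports Defs
begin

text \<open>
  Why the formula holds. Put \<open>n = |Q\<^sub>0| - 1\<close>, the dimension of \<open>V\<close>. The function \<open>f\<close> enters
  both sides only through its germs at singular points, and genericity of \<open>R\<close> makes these points as
  simple as possible: at least \<open>n\<close> independent weights are active at a singular point, and never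
  \<open>n + 1\<close> weights, so the active weights form a basis of \<open>V\<close>. Conversely every basis of \<open>V\<close> made of
  weights determines one singular point. A set of \<open>n\<close> arrows has independent weights exactly when
  only constant functions on the vertices are constant along all these arrows, that is, when the
  arrows form a spanning tree (\<open>weights_of_tree_basis\<close>, \<open>tree_of_basis\<close>). Hence both sides are sums
  over spanning trees \<open>T\<close>, and they agree term by term.

  \<^emph>\<open>Flags.\<close> For a basis \<open>A\<close> of weights, complete flags are the same as orderings of \<open>A\<close>, and the vectors
  \<open>\<kappa>\<^sub>j\<close> are the partial sums of the ordering. So \<open>\<zeta>\<close> is a positive combination of the \<open>\<kappa>\<^sub>j\<close> iff its
  coordinates with respect to \<open>A\<close> are positive and strictly decrease along the ordering. As \<open>\<zeta>\<close> is
  regular for the sums of weights, no coordinate vanishes and no two coincide. Exactly one flag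
  contributes if all coordinates are positive, and none otherwise (\<open>JK_residue_simplicial\<close>). The
  factor \<open>\<nu>\<close> and the normalisation of the adapted basis both contribute the sign of the ordering,
  and these signs cancel.

  \<^emph>\<open>Iterated residues.\<close> What remains is the iterated residue in the coordinates \<open>A\<close>, taken in some
  order and after a triangular change of coordinates. Neither of these matters
  (\<open>iterated_residue_same_flag\<close>), because the iterated residue is an integral over a torus. A
  meromorphic germ with poles on the coordinate hyperplanes only is bounded by a negative power of
  the product of the coordinates (\<open>moderate_growth\<close>), and this bound survives taking residues. So
  each residue is an integral over a small circle, and the iterated residue is an integral over a
  torus whose radii grow fast from the first coordinate to the last
  (\<open>vec_residue_eq_torus_mean\<close>). On such a torus each coordinate dominates all earlier ones, so a
  triangular change of coordinates amounts to moving the centres of the circles without crossing a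
  pole (\<open>torus_mean_change_basis\<close>). The result is the integral over a torus with equal radii,
  which by Fubini does not depend on the order of the coordinates.

  \<^emph>\<open>Stability.\<close> The coordinates of \<open>\<zeta>\<close> have the same signs as those of \<open>-\<theta>\<close>, because on a chamber no
  coordinate vanishes (\<open>chamber_coordinate_sign\<close>). All coordinates of \<open>-\<theta>\<close> with respect to the
  weights of \<open>T\<close> are positive iff \<open>T\<close> is stable: a subrepresentation is a set \<open>Z\<close> of vertices closed
  under arrows, and pairing \<open>-\<theta>\<close> with the indicator function of \<open>Z\<close> writes \<open>-\<theta>(Z)\<close> as the sum of the
  coordinates of the arrows that enter \<open>Z\<close> (\<open>stable_tree_iff\<close>).
\<close>

section \<open>Residues and circle integrals in one variable\<close>

lemma laurent_residue_eq:
  assumes "open S" "z \<in> S" "f holomorphic_on S - {z}" "not_essential f z"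
  shows "fls_residue (laurent_expansion f z) = residue f z"
proof -
  have "isolated_singularity_at f z"
    using assms by (intro isolated_singularity_at_holomorphic)
  from not_essential_has_laurent_expansion[OF this assms(4)]
  show ?thesis by (simp add: has_laurent_expansion_residue)
qed

text \<open>
  By Riemann's theorem the bounded function \<open>z\<^sup>k f(z)\<close> extends over \<open>0\<close>; dividing by \<open>z\<^sup>k\<close> leaves at
  most a pole.
\<close>

lemma not_essential_of_power_bound:
  assumes "r > 0" and hol: "f holomorphic_on ball 0 r - {0}"
    and bd: "\<And>z. z \<in> ball 0 r - {0} \<Longrightarrow> norm (z ^ k * f z) \<le> B"
  shows "not_essential f (0::complex)"
proof -
  have "(\<lambda>z. z ^ k * f z) holomorphic_on ball 0 r - {0}"
    by (intro holomorphic_intros hol)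
  moreover have "\<exists>B. \<forall>\<^sub>F z in at 0. norm (z ^ k * f z) \<le> B"
    using assms by (intro exI[of _ B]) (auto simp: eventually_at dist_commute intro!: exI[of _ r])
  ultimately obtain g where g: "g holomorphic_on ball 0 r"
      and geq: "\<And>z. z \<in> ball 0 r - {0} \<Longrightarrow> g z = z ^ k * f z"
    using holomorphic_on_extend_bounded[of "\<lambda>z. z ^ k * f z" "ball 0 r" 0] \<open>r > 0\<close>
    by auto
  have p: "(\<lambda>z::complex. z ^ k) holomorphic_on ball 0 r" by (intro holomorphic_intros)
  have "not_essential (\<lambda>z. g z / z ^ k) 0"
    using g p \<open>r > 0\<close>
    by (intro not_essential_divide not_essential_holomorphic[of _ "ball 0 r"]
        isolated_singularity_at_holomorphic[of _ "ball 0 r"])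
      (auto intro: holomorphic_on_subset)
  moreover have "\<forall>\<^sub>F z in at 0. g z / z ^ k = f z"
    using geq \<open>r > 0\<close> by (auto simp: eventually_at dist_commute intro!: exI[of _ r])
  ultimately show ?thesis
    using not_essential_cong[OF _ refl, of "\<lambda>z. g z / z ^ k" f 0] by simp
qed

text \<open>
  The mean of \<open>z f(z)\<close> over the circle. For a function with an isolated singularity at \<open>0\<close> and a
  small radius this is its residue.
\<close>

definition circle_mean :: "real \<Rightarrow> (complex \<Rightarrow> complex) \<Rightarrow> complex" where
  "circle_mean r f = contour_integral (circlepath 0 r) f / (2 * of_real pi * \<i>)"

text \<open>
  The image of the circle under \<open>z \<mapsto> a + k z\<close> still winds once around \<open>0\<close>, since \<open>|a| < |k| r\<close>, and
  stays in the disc. This is the only place where contours are deformed: it covers both the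
  independence of the radius and a change of the centre, and it gives the factor by which a
  residue changes when the coordinate is rescaled.
\<close>

lemma circle_mean_affine:
  assumes hol: "f holomorphic_on ball 0 s - {0}"
    and a: "norm a < norm k * r" and s: "norm a + norm k * r < s" and "r > 0"
  shows "circle_mean r (\<lambda>z. f (a + k * z)) = residue f 0 / k"
proof -
  define h where "h = (\<lambda>z. a + k * z)"
  define \<gamma> where "\<gamma> = h \<circ> circlepath 0 r"
  have k: "k \<noteq> 0" using a \<open>r > 0\<close> by auto
  have hA: "h analytic_on UNIV" unfolding h_def by (intro analytic_intros)
  have dh: "deriv h = (\<lambda>w. k)" 
    by (rule ext) (auto simp: h_def intro!: DERIV_imp_deriv derivative_eq_intros)
  have vp: "valid_path \<gamma>" unfolding \<gamma>_def
    by (rule valid_path_compose_analytic[OF _ hA]) auto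
  have img: "path_image \<gamma> \<subseteq> ball 0 s - {0}"
  proof -
    have "h z \<noteq> 0 \<and> norm (h z) < s" if "norm z = r" for z
    proof -
      have "norm (h z) \<ge> norm (k * z) - norm a" unfolding h_def
        by (metis add.commute norm_diff_ineq)
      moreover have "norm (h z) \<le> norm a + norm (k * z)" unfolding h_def by (rule norm_triangle_ineq)
      ultimately show ?thesis using that a s by (auto simp: norm_mult)
    qed
    thus ?thesis using \<open>r > 0\<close> by (auto simp: \<gamma>_def path_image_compose)
  qed
  have ci: "contour_integral \<gamma> g = k * contour_integral (circlepath 0 r) (\<lambda>z. g (h z))"
    for g
  proof -
    have "contour_integral \<gamma> g = contour_integral (circlepath 0 r) (\<lambda>w. deriv h w * g (h w))"
      unfolding \<gamma>_def by (rule contour_integral_comp_analyticW[OF hA]) auto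
    also have "\<dots> = k * contour_integral (circlepath 0 r) (\<lambda>z. g (h z))"
      unfolding dh using k
      by (cases "(\<lambda>z. g (h z)) contour_integrable_on circlepath 0 r")
         (auto simp: contour_integral_lmul not_integrable_contour_integral
           contour_integrable_lmul_iff)
    finally show ?thesis .
  qed
  have w: "winding_number \<gamma> 0 = 1"
  proof -
    have "winding_number \<gamma> 0 = 1 / (2 * of_real pi * \<i>) * contour_integral \<gamma> (\<lambda>w. 1 / (w - 0))"
      using winding_number_valid_path[OF vp, of 0] img by auto
    also have "contour_integral \<gamma> (\<lambda>w. 1 / (w - 0)) =
        k * contour_integral (circlepath 0 r) (\<lambda>z. 1 / (h z - 0))" by (rule ci)
    also have "(\<lambda>z. 1 / (h z - 0)) = (\<lambda>z. (1/k) / (z - (- a / k)))"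
      using k by (auto simp: h_def field_simps)
    also have "contour_integral (circlepath 0 r) (\<lambda>z. (1/k) / (z - (- a / k))) =
        2 * of_real pi * \<i> * (1/k)"
    proof (rule contour_integral_unique)
      have "cmod (- a / k - 0) < r" using a k by (simp add: norm_divide field_simps)
      from Cauchy_integral_circlepath_simple[OF holomorphic_on_const this, of "1 / k"]
      show "((\<lambda>z. (1/k) / (z - (- a / k))) has_contour_integral 2 * of_real pi * \<i> * (1/k))
          (circlepath 0 r)" .
    qed
    finally show ?thesis using k by simp
  qed
  have "contour_integral \<gamma> f = of_real (2 * pi) * \<i> * (\<Sum>p\<in>{0}. winding_number \<gamma> p * residue f p)"
  proof (rule Residue_theorem[where S = "ball 0 s"])
    show "pathfinish \<gamma> = pathstart \<gamma>" by (auto simp: \<gamma>_def pathfinish_compose pathstart_compose)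
    show "\<forall>z. z \<notin> ball 0 s \<longrightarrow> winding_number \<gamma> z = 0"
      using img vp by (intro allI impI winding_number_zero_outside[of _ "ball 0 s"])
        (auto simp: valid_path_imp_path \<gamma>_def pathfinish_compose pathstart_compose)
  qed (use img vp hol in auto)
  thus ?thesis using ci[of f] k w by (simp add: circle_mean_def h_def field_simps)
qed

lemma circle_mean_residue:
  assumes "f holomorphic_on ball 0 s - {0}" "0 < r" "r < s"
  shows "circle_mean r f = residue f 0"
  using circle_mean_affine[of f s 0 1 r] assms by simp

lemma circle_mean_cong:
  assumes "\<And>z. norm z = \<bar>r\<bar> \<Longrightarrow> f z = g z"
  shows "circle_mean r f = circle_mean r g"
  unfolding circle_mean_def
  by (subst contour_integral_cong[of _ "circlepath 0 r" f g]) (use assms in auto)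

lemma continuous_on_circle_mean:
  fixes F :: "'a::topological_space \<Rightarrow> complex \<Rightarrow> complex"
  assumes cont: "continuous_on (X \<times> sphere 0 \<bar>r\<bar>) (\<lambda>(u, z). F u z)"
  shows "continuous_on X (\<lambda>u. circle_mean r (F u))"
proof -
  let ?p = "\<lambda>t::real. of_real r * exp (2 * of_real pi * \<i> * of_real t) :: complex"
  have "continuous_on (X \<times> cbox 0 1) (\<lambda>(u, t). F u (?p t) * (2 * of_real pi * \<i> * ?p t))"
  proof -
    have "continuous_on (X \<times> cbox (0::real) 1) (\<lambda>x. (fst x, ?p (snd x)))"
      by (intro continuous_intros)
    hence "continuous_on (X \<times> cbox (0::real) 1) (\<lambda>x. (\<lambda>(u, z). F u z) (fst x, ?p (snd x)))"
      by (rule continuous_on_compose2[OF cont]) (auto simp: norm_mult)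
    thus ?thesis unfolding case_prod_unfold by (intro continuous_intros) auto
  qed
  hence "continuous_on X (\<lambda>u. integral (cbox 0 1) (\<lambda>t. F u (?p t) * (2 * of_real pi * \<i> * ?p t)))"
    by (rule integral_continuous_on_param)
  moreover have "contour_integral (circlepath 0 r) (F u) =
      integral (cbox 0 1) (\<lambda>t. F u (?p t) * (2 * of_real pi * \<i> * ?p t))" for u
    unfolding contour_integral_integral vector_derivative_circlepath
    by (simp add: circlepath mult_ac)
  ultimately show ?thesis unfolding circle_mean_def by (auto intro!: continuous_intros)
qed

lemma circle_mean_swap:
  assumes "continuous_on (sphere 0 \<bar>r\<bar> \<times> sphere 0 \<bar>s\<bar>) (\<lambda>(y, z). F y z)"
  shows "circle_mean r (\<lambda>y. circle_mean s (F y)) = circle_mean s (\<lambda>z. circle_mean r (\<lambda>y. F y z))"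
proof -
  have "contour_integral (circlepath 0 r) (\<lambda>w. contour_integral (circlepath 0 s) (F w)) =
    contour_integral (circlepath 0 s) (\<lambda>z. contour_integral (circlepath 0 r) (\<lambda>w. F w z))"
    by (rule contour_integral_swap)
      (use assms in \<open>auto simp: vector_derivative_circlepath intro!: continuous_intros\<close>)
  moreover have "contour_integral (circlepath 0 r) (\<lambda>w. g w / (2 * of_real pi * \<i>)) =
     contour_integral (circlepath 0 r) g / (2 * of_real pi * \<i>)" for r g
    unfolding contour_integral_integral by (simp add: field_simps)
  ultimately show ?thesis unfolding circle_mean_def by simp
qed

text \<open>
  Morera's theorem: integrals over triangles can be taken under the integral over the circle.
\<close>

lemma holomorphic_circle_mean:
  assumes "open U"
    and cont: "continuous_on (U \<times> sphere 0 \<bar>r\<bar>) (\<lambda>(x, z). F x z)"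
    and hol: "\<And>z. norm z = \<bar>r\<bar> \<Longrightarrow> (\<lambda>x. F x z) holomorphic_on U"
  shows "(\<lambda>x. circle_mean r (F x)) holomorphic_on U"
proof -
  let ?G = "\<lambda>x. contour_integral (circlepath 0 r) (F x)"
  have "continuous_on U (\<lambda>x. circle_mean r (F x))"
    by (rule continuous_on_circle_mean[OF cont])
  hence cG: "continuous_on U ?G"
  proof -
    assume "continuous_on U (\<lambda>x. circle_mean r (F x))"
    hence "continuous_on U (\<lambda>x. circle_mean r (F x) * (2 * of_real pi * \<i>))"
      by (intro continuous_intros)
    thus ?thesis by (simp add: circle_mean_def)
  qed
  have "?G analytic_on U"
  proof (rule Morera_triangle[OF cG \<open>open U\<close>], intro allI impI)
    fix a b c assume tri: "convex hull {a, b, c} \<subseteq> U"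
    have seg: "closed_segment p q \<subseteq> U" if "p \<in> {a,b,c}" "q \<in> {a,b,c}" for p q
      using that tri by (metis closed_segment_subset_convex_hull hull_inc order_trans)
    have sw: "contour_integral (linepath p q) ?G =
        contour_integral (circlepath 0 r) (\<lambda>z. contour_integral (linepath p q) (\<lambda>x. F x z))"
      if "p \<in> {a,b,c}" "q \<in> {a,b,c}" for p q
    proof (rule contour_integral_swap)
      have "path_image (linepath p q) \<subseteq> U" using seg[OF that] by simp
      thus "continuous_on (path_image (linepath p q) \<times> path_image (circlepath 0 r)) (\<lambda>(x, z). F x z)"
        by (intro continuous_on_subset[OF cont] Sigma_mono) (simp_all only: path_image_circlepath order_refl)
      show "continuous_on {0..1} (\<lambda>t. vector_derivative (circlepath 0 r) (at t))"
        unfolding vector_derivative_circlepath by (intro continuous_intros)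
      show "continuous_on {0..1} (\<lambda>t. vector_derivative (linepath p q) (at t))"
        unfolding vector_derivative_linepath_at by (intro continuous_intros)
    qed simp_all
    have "continuous_on (sphere 0 \<bar>r\<bar>) (\<lambda>z. contour_integral (linepath p q) (\<lambda>x. F x z))"
      if "p \<in> {a,b,c}" "q \<in> {a,b,c}" for p q
    proof -
      have im: "linepath p q t \<in> U" if t: "t \<in> {0..1}" for t
        using seg[OF \<open>p \<in> _\<close> \<open>q \<in> _\<close>] linepath_in_path[OF t, of p q] by (rule subsetD)
      have "continuous_on (sphere 0 \<bar>r\<bar> \<times> cbox 0 1) (\<lambda>x. (linepath p q (snd x), fst x))"
        unfolding linepath_def by (intro continuous_intros)
      hence "continuous_on (sphere 0 \<bar>r\<bar> \<times> cbox 0 1) (\<lambda>x. (\<lambda>(x, z). F x z) (linepath p q (snd x), fst x))"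
        by (rule continuous_on_compose2[OF cont]) (use im in auto)
      hence "continuous_on (sphere 0 \<bar>r\<bar> \<times> cbox 0 1) (\<lambda>(z, t). F (linepath p q t) z * (q - p))"
        unfolding case_prod_unfold by (auto intro!: continuous_intros)
      hence "continuous_on (sphere 0 \<bar>r\<bar>) (\<lambda>z. integral (cbox 0 1) (\<lambda>t. F (linepath p q t) z * (q - p)))"
        by (rule integral_continuous_on_param)
      thus ?thesis unfolding contour_integral_integral vector_derivative_linepath_at
        by simp
    qed
    hence ci: "(\<lambda>z. contour_integral (linepath p q) (\<lambda>x. F x z)) contour_integrable_on circlepath 0 r"
      if "p \<in> {a,b,c}" "q \<in> {a,b,c}" for p q
      using that by (intro contour_integrable_continuous_circlepath) auto
    have "contour_integral (linepath a b) ?G + contour_integral (linepath b c) ?G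
        + contour_integral (linepath c a) ?G =
      contour_integral (circlepath 0 r) (\<lambda>z. contour_integral (linepath a b) (\<lambda>x. F x z)
        + contour_integral (linepath b c) (\<lambda>x. F x z) + contour_integral (linepath c a) (\<lambda>x. F x z))"
      by (simp add: sw ci contour_integral_add contour_integrable_add)
    also have "\<dots> = contour_integral (circlepath 0 r) (\<lambda>z. 0)"
    proof (rule contour_integral_cong[OF refl])
      fix z assume "z \<in> path_image (circlepath 0 r)"
      hence "(\<lambda>x. F x z) holomorphic_on convex hull {a,b,c}"
        using hol tri by (auto intro: holomorphic_on_subset)
      from Cauchy_theorem_triangle[OF this]
      have "((\<lambda>x. F x z) has_contour_integral 0) (linepath a b +++ linepath b c +++ linepath c a)" .
      thus "contour_integral (linepath a b) (\<lambda>x. F x z)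
        + contour_integral (linepath b c) (\<lambda>x. F x z) + contour_integral (linepath c a) (\<lambda>x. F x z) = 0"
        by (rule has_chain_integral_chain_integral3)
    qed
    finally show "contour_integral (linepath a b) ?G + contour_integral (linepath b c) ?G
        + contour_integral (linepath c a) ?G = 0" by simp
  qed
  hence "?G holomorphic_on U" by (rule analytic_imp_holomorphic)
  thus ?thesis unfolding circle_mean_def by (intro holomorphic_intros) auto
qed

section \<open>Means over tori\<close>

lemma continuous_on_smult_vec [continuous_intros]:
  fixes b :: "'a::topological_space \<Rightarrow> complex ^ 'v"
  assumes "continuous_on X f" "continuous_on X b"
  shows "continuous_on X (\<lambda>x. f x *s b x)"
  unfolding vector_scalar_mult_def
  by (intro continuous_on_vec_lambda continuous_intros assms continuous_on_component)

text \<open>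
  The integral over a circle in the direction \<open>b\<close>, as an operator on functions on the whole space.
  Operators are easier to commute than integrals over lists of coordinates.
\<close>

definition dir_mean ::
    "complex ^ 'v \<Rightarrow> real \<Rightarrow> (complex ^ 'v \<Rightarrow> complex) \<Rightarrow> complex ^ 'v \<Rightarrow> complex" where
  "dir_mean b r f u = circle_mean r (\<lambda>z. f (u + z *s b))"

text \<open>
  The head of the list is the innermost integral, as in \<open>iterated_residue\<close>.
\<close>

fun torus_mean ::
    "((complex ^ 'v) \<times> real) list \<Rightarrow> (complex ^ 'v \<Rightarrow> complex) \<Rightarrow> complex ^ 'v \<Rightarrow> complex" where
  "torus_mean [] f = f"
| "torus_mean ((b, r) # ps) f = torus_mean ps (dir_mean b r f)"

fun torus :: "((complex ^ 'v) \<times> real) list \<Rightarrow> complex ^ 'v \<Rightarrow> (complex ^ 'v) set" where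
  "torus [] u = {u}"
| "torus ((b, r) # ps) u = {w + z *s b | w z. w \<in> torus ps u \<and> norm z = \<bar>r\<bar>}"

lemma dir_mean_cong:
  assumes "\<And>z. norm z = \<bar>r\<bar> \<Longrightarrow> f (u + z *s b) = g (u + z *s b)"
  shows "dir_mean b r f u = dir_mean b r g u"
  unfolding dir_mean_def using assms by (intro circle_mean_cong)

lemma torus_mean_cong:
  assumes "\<And>w. w \<in> torus ps u \<Longrightarrow> f w = g w"
  shows "torus_mean ps f u = torus_mean ps g u"
  using assms
proof (induction ps arbitrary: f g)
  case (Cons p ps)
  obtain b r where p: "p = (b, r)" by force
  have "dir_mean b r f w = dir_mean b r g w" if "w \<in> torus ps u" for w
    using that by (intro dir_mean_cong Cons.prems) (auto simp: p)
  thus ?case by (auto simp: p intro!: Cons.IH)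
qed auto

lemma continuous_on_dir_mean:
  assumes "continuous_on Y f"
    and "\<And>u z. u \<in> X \<Longrightarrow> norm z = \<bar>r\<bar> \<Longrightarrow> u + z *s b \<in> Y"
  shows "continuous_on X (dir_mean b r f)"
  unfolding dir_mean_def
proof (rule continuous_on_circle_mean)
  have "continuous_on (X \<times> sphere 0 \<bar>r\<bar>) (\<lambda>x. f (fst x + snd x *s b))"
    by (rule continuous_on_compose2[OF assms(1)]) (use assms(2) in \<open>auto intro!: continuous_intros\<close>)
  thus "continuous_on (X \<times> sphere 0 \<bar>r\<bar>) (\<lambda>(u, z). f (u + z *s b))"
    by (simp add: case_prod_unfold)
qed

lemma dir_mean_commute:
  assumes "continuous_on Y f"
    and "\<And>z w. norm z = \<bar>r\<bar> \<Longrightarrow> norm w = \<bar>s\<bar> \<Longrightarrow> u + z *s b + w *s c \<in> Y"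
  shows "dir_mean b r (dir_mean c s f) u = dir_mean c s (dir_mean b r f) u"
proof -
  have "continuous_on (sphere 0 \<bar>r\<bar> \<times> sphere 0 \<bar>s\<bar>) (\<lambda>x. f (u + fst x *s b + snd x *s c))"
    by (rule continuous_on_compose2[OF assms(1)]) (use assms(2) in \<open>auto intro!: continuous_intros\<close>)
  hence "circle_mean r (\<lambda>y. circle_mean s (\<lambda>z. f (u + y *s b + z *s c))) =
      circle_mean s (\<lambda>z. circle_mean r (\<lambda>y. f (u + y *s b + z *s c)))"
    by (intro circle_mean_swap) (simp add: case_prod_unfold)
  thus ?thesis unfolding dir_mean_def by (simp add: algebra_simps)
qed

lemma torus_swap: "torus (p # q # ps) u = torus (q # p # ps) u"
proof -
  have "torus ((b, r) # (c, s) # ps) u \<subseteq> torus ((c, s) # (b, r) # ps) u" for b r c s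
  proof
    fix x assume "x \<in> torus ((b, r) # (c, s) # ps) u"
    then obtain w z y where w: "x = w + y *s c + z *s b" "w \<in> torus ps u"
      "norm y = \<bar>s\<bar>" "norm z = \<bar>r\<bar>" by auto
    hence "x = (w + z *s b) + y *s c" by simp
    thus "x \<in> torus ((c, s) # (b, r) # ps) u" using w by fastforce
  qed
  thus ?thesis by (cases p; cases q) blast
qed

lemma torus_Cons_cong: "torus ps u = torus qs u \<Longrightarrow> torus (p # ps) u = torus (p # qs) u"
  by (cases p) auto

lemma torus_move: "torus (qs1 @ p # qs2) u = torus (p # qs1 @ qs2) u"
proof (induction qs1)
  case (Cons q qs1)
  have "torus ((q # qs1) @ p # qs2) u = torus (q # p # qs1 @ qs2) u"
    using Cons.IH by (simp only: append_Cons) (rule torus_Cons_cong)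
  thus ?case using torus_swap[of q p] by (simp del: torus.simps)
qed simp

lemma torus_mean_swap:
  assumes "continuous_on (torus (p # q # ps) u) f"
  shows "torus_mean (p # q # ps) f u = torus_mean (q # p # ps) f u"
proof -
  obtain b r c s where pq: "p = (b, r)" "q = (c, s)" by force
  have "dir_mean c s (dir_mean b r f) w = dir_mean b r (dir_mean c s f) w" if "w \<in> torus ps u" for w
    using that by (intro dir_mean_commute[OF assms]) (force simp: pq)
  thus ?thesis by (auto simp: pq intro!: torus_mean_cong)
qed

lemma torus_mean_move:
  assumes "continuous_on (torus (p # qs1 @ qs2) u) f"
  shows "torus_mean (qs1 @ p # qs2) f u = torus_mean (p # qs1 @ qs2) f u"
  using assms
proof (induction qs1 arbitrary: f)
  case (Cons q qs1)
  obtain c s where q: "q = (c, s)" by force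
  have c: "continuous_on (torus (q # p # qs1 @ qs2) u) f"
    using Cons.prems torus_swap[of q p "qs1 @ qs2" u] by (simp del: torus.simps)
  hence "continuous_on (torus (p # qs1 @ qs2) u) (dir_mean c s f)"
    by (rule continuous_on_dir_mean) (auto simp: q)
  hence "torus_mean (qs1 @ p # qs2) (dir_mean c s f) u = torus_mean (p # qs1 @ qs2) (dir_mean c s f) u"
    by (rule Cons.IH)
  thus ?case using torus_mean_swap[OF c] by (simp add: q)
qed simp

text \<open>
  Fubini's theorem for tori, obtained by repeatedly swapping neighbouring circles. The equality of
  the tori is proved along with it because it carries the continuity assumption through the
  induction.
\<close>

lemma torus_mean_perm:
  assumes "mset ps = mset qs" and "continuous_on (torus ps u) f"
  shows "torus_mean ps f u = torus_mean qs f u \<and> torus ps u = torus qs u"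
  using assms
proof (induction ps arbitrary: qs f)
  case (Cons p ps)
  obtain b r where p: "p = (b, r)" by force
  have "p \<in> set qs" using Cons.prems(1) by (metis list.set_intros(1) mset_eq_setD)
  then obtain qs1 qs2 where qs: "qs = qs1 @ p # qs2" by (meson split_list)
  have ms: "mset ps = mset (qs1 @ qs2)" using Cons.prems(1) by (simp add: qs)
  have "continuous_on (torus ps u) (dir_mean b r f)"
    by (rule continuous_on_dir_mean[OF Cons.prems(2)]) (auto simp: p)
  from Cons.IH[OF ms this] have
    *: "torus_mean ps (dir_mean b r f) u = torus_mean (qs1 @ qs2) (dir_mean b r f) u"
    and t: "torus ps u = torus (qs1 @ qs2) u" by auto
  have t': "torus (p # ps) u = torus (p # qs1 @ qs2) u" using t by (rule torus_Cons_cong)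
  have "continuous_on (torus (p # qs1 @ qs2) u) f" using Cons.prems(2) t' by simp
  from torus_mean_move[OF this] show ?case
    using * t' torus_move[of qs1 p qs2 u] by (simp add: qs p del: torus.simps)
qed simp

text \<open>
  The iterated residue as an operator on functions on the whole space: \<open>b\<close> is the direction in which
  the current coordinate varies while the other coordinates are fixed.
\<close>

fun vec_residue :: "(complex ^ 'v) list \<Rightarrow> (complex ^ 'v \<Rightarrow> complex) \<Rightarrow> complex ^ 'v \<Rightarrow> complex" where
  "vec_residue [] f u = f u"
| "vec_residue (b # bs) f u =
     vec_residue bs (\<lambda>w. fls_residue (laurent_expansion (\<lambda>z. f (w + z *s b)) 0)) u"

definition combine :: "complex list \<Rightarrow> (complex ^ 'v) list \<Rightarrow> complex ^ 'v" where
  "combine zs bs = (\<Sum>i<length bs. (zs ! i) *s (bs ! i))"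

lemma combine_Cons: "combine (z # zs) (b # bs) = z *s b + combine zs bs"
  by (simp add: combine_def sum.lessThan_Suc_shift del: sum.lessThan_Suc)

lemma iterated_residue_cong:
  assumes "\<And>zs. length zs = n \<Longrightarrow> f zs = g zs"
  shows "iterated_residue n f = iterated_residue n g"
  using assms
proof (induction n arbitrary: f g)
  case (Suc n)
  have "f (z # zs) = g (z # zs)" if "length zs = n" for z zs using Suc.prems that by simp
  thus ?case by (auto intro!: Suc.IH)
qed simp

lemma iterated_residue_combine:
  "iterated_residue (length bs) (\<lambda>zs. f (u + combine zs bs)) = vec_residue bs f u"
proof (induction bs arbitrary: f)
  case (Cons b bs)
  have "iterated_residue (length (b # bs)) (\<lambda>zs. f (u + combine zs (b # bs))) =
    iterated_residue (length bs) (\<lambda>zs.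
      (\<lambda>w. fls_residue (laurent_expansion (\<lambda>z. f (w + z *s b)) 0)) (u + combine zs bs))"
    by (simp add: combine_Cons add_ac)
  also have "\<dots> = vec_residue (b # bs) f u" by (subst Cons.IH) simp
  finally show ?case .
qed (simp add: combine_def)

section \<open>Iterated residues as torus integrals\<close>

definition functional :: "(complex ^ 'v \<Rightarrow> complex) \<Rightarrow> bool" where
  "functional c \<longleftrightarrow> (\<forall>u w. c (u + w) = c u + c w) \<and> (\<forall>a u. c (a *s u) = a * c u) \<and>
     continuous_on UNIV c"

lemma functional_add: "functional c \<Longrightarrow> c (u + w) = c u + c w"
  and functional_smult: "functional c \<Longrightarrow> c (a *s u) = a * c u"
  and functional_cont: "functional c \<Longrightarrow> continuous_on X c"
  by (auto simp: functional_def intro: continuous_on_subset)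

lemma functional_zero: "functional c \<Longrightarrow> c 0 = 0"
  using functional_smult[of c 0 0] by simp

lemma functional_diff: "functional c \<Longrightarrow> c (u - w) = c u - c w"
  using functional_add[of c "u - w" w] by simp

lemmas functional_simps = functional_add functional_smult functional_zero functional_diff

lemma functional_cont_comp:
  "functional c \<Longrightarrow> continuous_on X g \<Longrightarrow> continuous_on X (\<lambda>x. c (g x))"
  by (rule continuous_on_compose2[OF functional_cont[of c UNIV]]) auto

text \<open>
  Recursive form of the duality \<open>c\<^sub>i(b\<^sub>j) = \<delta>\<^sub>i\<^sub>j\<close>, suited to inductions that remove one coordinate at a
  time.
\<close>

fun dual_lists :: "(complex ^ 'v) list \<Rightarrow> (complex ^ 'v \<Rightarrow> complex) list \<Rightarrow> bool" where
  "dual_lists [] [] = True"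
| "dual_lists (b # bs) (c # cs) \<longleftrightarrow> functional c \<and> c b = 1 \<and>
     (\<forall>b'\<in>set bs. c b' = 0) \<and> (\<forall>c'\<in>set cs. c' b = 0) \<and> dual_lists bs cs"
| "dual_lists _ _ = False"

lemma dual_lists_functional: "dual_lists bs cs \<Longrightarrow> c \<in> set cs \<Longrightarrow> functional c"
  by (induction bs cs rule: dual_lists.induct) auto

lemma dual_lists_length: "dual_lists bs cs \<Longrightarrow> length bs = length cs"
  by (induction bs cs rule: dual_lists.induct) auto

text \<open>
  Holomorphy along lines. Together with continuity it is preserved by circle integrals, so that it
  can be carried through inductions on the number of coordinates.
\<close>

definition separately_holomorphic ::
    "(complex ^ 'v) set \<Rightarrow> (complex ^ 'v) set \<Rightarrow> (complex ^ 'v \<Rightarrow> complex) \<Rightarrow> bool" where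
  "separately_holomorphic B X f \<longleftrightarrow>
     (\<forall>b\<in>B. \<forall>u. (\<lambda>z. f (u + z *s b)) holomorphic_on {z. u + z *s b \<in> X})"

lemma holomorphic_dir_mean:
  assumes cont: "continuous_on Y f" and sep: "separately_holomorphic B Y f"
    and "b' \<in> B" "open V"
    and Y: "\<And>z w. z \<in> V \<Longrightarrow> norm w = \<bar>r\<bar> \<Longrightarrow> u + z *s b' + w *s b \<in> Y"
  shows "(\<lambda>z. dir_mean b r f (u + z *s b')) holomorphic_on V"
  unfolding dir_mean_def
proof (rule holomorphic_circle_mean[OF \<open>open V\<close>])
  have "continuous_on (V \<times> sphere 0 \<bar>r\<bar>) (\<lambda>x. f (u + fst x *s b' + snd x *s b))"
    by (rule continuous_on_compose2[OF cont]) (use Y in \<open>auto intro!: continuous_intros\<close>)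
  thus "continuous_on (V \<times> sphere 0 \<bar>r\<bar>) (\<lambda>(x, z). f (u + x *s b' + z *s b))"
    by (simp add: case_prod_unfold)
next
  fix w :: complex assume w: "norm w = \<bar>r\<bar>"
  have "(\<lambda>z. f (u + w *s b + z *s b')) holomorphic_on {z. u + w *s b + z *s b' \<in> Y}"
    using sep \<open>b' \<in> B\<close> by (auto simp: separately_holomorphic_def)
  hence "(\<lambda>z. f (u + w *s b + z *s b')) holomorphic_on V"
    by (rule holomorphic_on_subset) (use Y w in \<open>auto simp: algebra_simps\<close>)
  thus "(\<lambda>x. f (u + x *s b' + w *s b)) holomorphic_on V"
    by (simp add: algebra_simps)
qed

lemma circle_mean_bound:
  assumes "r > 0" "continuous_on (sphere 0 r) f" "\<And>z. norm z = r \<Longrightarrow> norm (f z) \<le> B"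
  shows "norm (circle_mean r f) \<le> r * B"
proof -
  have "f contour_integrable_on circlepath 0 r"
    using assms by (intro contour_integrable_continuous_circlepath) auto
  moreover have "B \<ge> 0" using order_trans[OF norm_ge_zero assms(3)[of "of_real r"]] assms(1) by simp
  ultimately have "norm (contour_integral (circlepath 0 r) f) \<le> B * (2 * pi * r)"
    using assms by (intro has_contour_integral_bound_circlepath[of f _ 0 r B])
      (auto simp: has_contour_integral_integral)
  thus ?thesis by (simp add: circle_mean_def norm_divide norm_mult field_simps)
qed

text \<open>
  The last coordinate is compared with \<open>1\<close>.
\<close>

definition lead :: "real list \<Rightarrow> real" where
  "lead xs = (case xs of [] \<Rightarrow> 1 | x # _ \<Rightarrow> x)"

text \<open>
  A list of absolute values of coordinates in which each entry is smaller than the next one by a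
  factor \<open>M\<close>. An iterated residue sees only points of this kind: when the residue in the first
  coordinate is taken, all later ones are fixed and hence incomparably larger.
\<close>

fun wedge :: "real \<Rightarrow> real list \<Rightarrow> bool" where
  "wedge M [] = True"
| "wedge M (x # xs) \<longleftrightarrow> 0 < x \<and> M * x < lead xs \<and> wedge M xs"

lemma lead_pos: "wedge M xs \<Longrightarrow> lead xs > 0"
  by (cases xs) (auto simp: lead_def)

lemma wedge_le_1:
  assumes "wedge M xs" "M \<ge> 1" 
  shows "lead xs \<le> 1" "\<forall>x\<in>set xs. 0 < x \<and> x < 1"
proof -
  have "lead xs \<le> 1 \<and> (\<forall>x\<in>set xs. 0 < x \<and> x < 1)"
    using assms
  proof (induction xs)
    case (Cons x xs)
    have x: "0 < x" "M * x < lead xs" using Cons.prems by auto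
    have "1 * x \<le> M * x" using Cons.prems by (intro mult_right_mono) auto
    moreover have "lead xs \<le> 1" using Cons by simp
    ultimately have "x < 1" using x by linarith
    thus ?case using Cons by (auto simp: lead_def)
  qed (auto simp: lead_def)
  thus "lead xs \<le> 1" "\<forall>x\<in>set xs. 0 < x \<and> x < 1" by auto
qed

lemma prod_list_le_1:
  assumes "\<forall>x\<in>set xs. 0 < x \<and> x < (1::real)"
  shows "0 < prod_list xs \<and> prod_list xs \<le> 1"
  using assms by (induction xs) (auto simp: mult_le_one)

text \<open>
  Used to absorb a power of the next coordinate, which appears as the radius of a circle, into the
  product of all coordinates.
\<close>

lemma prod_list_le_lead:
  assumes "wedge M xs" "M \<ge> 1"
  shows "prod_list xs \<le> lead xs"
proof (cases xs)
  case (Cons y ys)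
  have "0 < y" "0 < prod_list ys \<and> prod_list ys \<le> 1"
    using wedge_le_1(2)[OF assms] prod_list_le_1[of ys] by (auto simp: Cons)
  thus ?thesis by (simp add: Cons lead_def mult_le_cancel_left1)
qed (simp add: lead_def)

definition norms :: "(complex ^ 'v \<Rightarrow> complex) list \<Rightarrow> complex ^ 'v \<Rightarrow> real list" where
  "norms cs u = map (\<lambda>c. norm (c u)) cs"

lemma norms_Nil: "norms [] u = []" and norms_Cons: "norms (c # cs) u = norm (c u) # norms cs u"
  by (simp_all add: norms_def)

lemma continuous_on_lead_norms:
  assumes "\<forall>c\<in>set cs. functional c"
  shows "continuous_on X (\<lambda>u. lead (norms cs u))"
  using assms by (cases cs) (auto simp: norms_def lead_def intro!: continuous_intros functional_cont)

lemma continuous_on_lead_norms_comp: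
  assumes "\<forall>c\<in>set cs. functional c" "continuous_on X g"
  shows "continuous_on X (\<lambda>z. lead (norms cs (g z)))"
  by (rule continuous_on_compose2[OF continuous_on_lead_norms[OF assms(1)] assms(2)]) auto

lemma open_wedge:
  assumes "\<forall>c\<in>set cs. functional c"
  shows "open {u. wedge M (norms cs u)}"
  using assms
proof (induction cs)
  case (Cons c cs)
  have "{u. wedge M (norms (c # cs) u)} =
      {u. c u \<noteq> 0} \<inter> {u. M * norm (c u) < lead (norms cs u)} \<inter> {u. wedge M (norms cs u)}"
    by (auto simp: norms_def)
  thus ?case using Cons
    by (auto intro!: open_Int open_Collect_less open_Collect_neq continuous_intros functional_cont
        continuous_on_lead_norms simp: functional_zero)
qed (simp add: norms_def)

text \<open>
  The set \<open>L\<close> will be the subspace on which the coordinates that were already eliminated vanish.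
\<close>

definition wedge_domain ::
  "(complex ^ 'v) set \<Rightarrow> (complex ^ 'v \<Rightarrow> complex) list \<Rightarrow> real \<Rightarrow> (complex ^ 'v) set" where
  "wedge_domain L cs M = {u \<in> L. wedge M (norms cs u)}"

definition stable_under :: "(complex ^ 'v) set \<Rightarrow> (complex ^ 'v) set \<Rightarrow> bool" where
  "stable_under B L \<longleftrightarrow> 0 \<in> L \<and> (\<forall>u\<in>L. \<forall>b\<in>B. \<forall>z. u + z *s b \<in> L)"

lemma stable_under_iff: "stable_under B L \<Longrightarrow> b \<in> B \<Longrightarrow> u + z *s b \<in> L \<longleftrightarrow> u \<in> L"
proof -
  assume *: "stable_under B L" "b \<in> B"
  have "u = u + z *s b + (- z) *s b" by (simp add: vector_sadd_rdistrib[symmetric] add.assoc)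
  thus ?thesis using * unfolding stable_under_def by metis
qed

lemma open_line_wedge_domain:
  assumes "\<forall>c\<in>set cs. functional c" "stable_under B L" "b \<in> B"
  shows "open {z. u + z *s b \<in> wedge_domain L cs M}"
proof (cases "u \<in> L")
  case True
  have "open ((\<lambda>z. u + z *s b) -` {u. wedge M (norms cs u)})"
    by (intro open_vimage open_wedge assms continuous_intros)
  thus ?thesis using True stable_under_iff[OF assms(2,3)]
    by (simp add: wedge_domain_def vimage_def)
qed (use stable_under_iff[OF assms(2,3)] in \<open>simp add: wedge_domain_def\<close>)

text \<open>
  On a torus the coordinates have the prescribed absolute values; functionals that vanish on all its
  directions vanish on it.
\<close>

lemma torus_norms:
  assumes "dual_lists bs cs" "length rs = length bs" "u \<in> torus (zip bs rs) 0"
    "stable_under (set bs) L"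
  shows "norms cs u = map abs rs \<and> u \<in> L \<and> (\<forall>c. functional c \<and> (\<forall>b\<in>set bs. c b = 0) \<longrightarrow> c u = 0)"
  using assms
proof (induction bs cs arbitrary: rs u rule: dual_lists.induct)
  case (2 b bs c cs)
  from "2.prems" obtain r rs' where rs: "rs = r # rs'" by (cases rs) auto
  from "2.prems"(3) obtain w z where u: "u = w + z *s b" "w \<in> torus (zip bs rs') 0" "norm z = \<bar>r\<bar>"
    by (auto simp: rs)
  have st: "stable_under (set bs) L" using "2.prems"(4) by (auto simp: stable_under_def)
  have IH: "norms cs w = map abs rs' \<and> w \<in> L \<and> (\<forall>c. functional c \<and> (\<forall>b\<in>set bs. c b = 0) \<longrightarrow> c w = 0)"
    using "2.prems" u rs st by (intro "2.IH") auto
  have fc: "functional c'" if "c' \<in> set cs" for c'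
    using dual_lists_functional[of bs cs c'] "2.prems" that by auto
  have "norms cs u = norms cs w"
    unfolding norms_def
  proof (rule map_cong[OF refl])
    fix c' assume "c' \<in> set cs"
    hence "functional c'" "c' b = 0" using "2.prems"(1) fc by auto
    thus "norm (c' u) = norm (c' w)"
      by (simp add: u functional_add functional_smult)
  qed
  moreover have "c w = 0" "functional c" using IH "2.prems" by auto
  hence "c u = z" using "2.prems"(1) by (simp add: u functional_simps)
  moreover have "u \<in> L" using stable_under_iff[OF "2.prems"(4), of b] IH by (simp add: u)
  ultimately have "norms (c # cs) u = map abs rs"
    using IH u(3) by (simp add: rs norms_Cons)
  moreover have "c' u = 0" if "functional c'" "\<forall>b'\<in>set (b # bs). c' b' = 0" for c'
    using that IH by (simp add: u functional_simps)
  ultimately show ?case using \<open>u \<in> L\<close> by blast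
qed (auto simp: norms_def functional_zero stable_under_def)

text \<open>
  Induction on the number of coordinates. By the growth bound the first coordinate has at most a
  pole at \<open>0\<close>, so its residue is an integral over a circle; the radius must be smaller than the next
  coordinate divided by \<open>M\<close>, and can therefore be chosen constant only locally. The residue as a
  function of the other coordinates satisfies the same hypotheses again, with a larger exponent:
  locally it is an integral with fixed radius, which gives continuity and holomorphy, and the
  choice of half the maximal radius gives the growth bound. On a fixed torus in the wedge the first
  radius is admissible at every point.
\<close>

lemma vec_residue_eq_torus_mean:
  assumes "dual_lists bs cs" "stable_under (set bs) L" "M \<ge> 1"
    and "continuous_on (wedge_domain L cs M) f"
    and "separately_holomorphic (set bs) (wedge_domain L cs M) f"
    and "\<And>u. u \<in> wedge_domain L cs M \<Longrightarrow> norm (f u) * prod_list (norms cs u) ^ K \<le> C"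
    and "length rs = length bs" "wedge M rs"
  shows "vec_residue bs f 0 = torus_mean (zip bs rs) f 0"
  using assms
proof (induction bs cs arbitrary: L f C K rs rule: dual_lists.induct)
  case (2 b bs c cs)
  note dual = "2.prems"(1) and st = "2.prems"(2) and M = "2.prems"(3) and cont = "2.prems"(4)
    and sep = "2.prems"(5) and growth = "2.prems"(6)
  define X where "X = wedge_domain L (c # cs) M"
  define L' where "L' = {u \<in> L. c u = 0}"
  define X' where "X' = wedge_domain L' cs M"
  define h where "h = (\<lambda>u. lead (norms cs u))"
  define g where "g = (\<lambda>w. fls_residue (laurent_expansion (\<lambda>z. f (w + z *s b)) 0))"
  from dual have fc: "functional c" and cb: "c b = 1" and cbs: "\<And>b'. b' \<in> set bs \<Longrightarrow> c b' = 0"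
    and csb: "\<And>c'. c' \<in> set cs \<Longrightarrow> c' b = 0" and dual': "dual_lists bs cs"
    and fcs: "\<forall>c\<in>set cs. functional c"
    using dual_lists_functional[of bs cs] by auto
  have st': "stable_under (set bs) L'"
    using st fc cbs by (auto simp: stable_under_def L'_def functional_simps)
  have hpos: "h u > 0" "h u \<le> 1" if "u \<in> X'" for u
    using that M lead_pos[of M "norms cs u"] wedge_le_1(1)[of M "norms cs u"]
    by (auto simp: X'_def wedge_domain_def h_def)
  have norms_b: "norms cs (u + z *s b) = norms cs u" for u z
    unfolding norms_def
  proof (rule map_cong[OF refl])
    fix c' assume "c' \<in> set cs"
    thus "norm (c' (u + z *s b)) = norm (c' u)"
      using csb[of c'] fcs by (simp add: functional_simps)
  qed
  have inX: "u + z *s b \<in> X \<longleftrightarrow> z \<noteq> 0 \<and> norm z < h u / M" if "u \<in> X'" for u z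
  proof -
    have "c (u + z *s b) = z" using that fc cb by (auto simp: X'_def wedge_domain_def L'_def functional_simps)
    moreover have "u + z *s b \<in> L" using that stable_under_iff[OF st, of b u z]
      by (auto simp: X'_def wedge_domain_def L'_def)
    moreover have "wedge M (norms (c # cs) (u + z *s b)) \<longleftrightarrow>
        0 < norm (c (u + z *s b)) \<and> M * norm (c (u + z *s b)) < h u \<and> wedge M (norms cs u)"
      by (simp add: norms_Cons norms_b h_def)
    moreover have "M * norm z < h u \<longleftrightarrow> norm z < h u / M"
      using M by (simp add: pos_less_divide_eq mult.commute)
    moreover have "wedge M (norms cs u)" using that by (simp add: X'_def wedge_domain_def)
    ultimately show ?thesis by (simp add: X_def wedge_domain_def)
  qed
  have hol: "(\<lambda>z. f (u + z *s b)) holomorphic_on ball 0 (h u / M) - {0}" if "u \<in> X'" for u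
  proof (rule holomorphic_on_subset)
    show "(\<lambda>z. f (u + z *s b)) holomorphic_on {z. u + z *s b \<in> X}"
      using sep by (simp add: separately_holomorphic_def X_def)
    show "ball 0 (h u / M) - {0} \<subseteq> {z. u + z *s b \<in> X}"
    proof
      fix z :: complex assume "z \<in> ball 0 (h u / M) - {0}"
      hence "z \<noteq> 0 \<and> norm z < h u / M" by simp
      thus "z \<in> {z. u + z *s b \<in> X}" using inX[OF that, of z] by blast
    qed
  qed
  have prod_pos: "prod_list (norms cs u) > 0" if "u \<in> X'" for u
  proof -
    have "wedge M (norms cs u)" using that by (simp add: X'_def wedge_domain_def)
    from prod_list_le_1[OF wedge_le_1(2)[OF this M]] show ?thesis by simp
  qed
  have growth': "norm (f (u + z *s b)) * (norm z * prod_list (norms cs u)) ^ K \<le> C"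
    if "u \<in> X'" "z \<noteq> 0" "norm z < h u / M" for u z
  proof -
    have "c (u + z *s b) = z"
      using that(1) fc cb by (auto simp: X'_def wedge_domain_def L'_def functional_simps)
    moreover have "u + z *s b \<in> X" using inX[OF that(1), of z] that(2,3) by blast
    note growth[OF this[unfolded X_def]]
    ultimately show ?thesis by (simp only: norms_Cons norms_b prod_list.Cons)
  qed
  have g_eq: "g u = dir_mean b \<rho> f u" if u: "u \<in> X'" and \<rho>: "0 < \<rho>" "M * \<rho> < h u" for u \<rho>
  proof -
    have pos: "h u / M > 0" using hpos[OF u] M by simp
    have ne: "not_essential (\<lambda>z. f (u + z *s b)) 0"
    proof (rule not_essential_of_power_bound[OF pos hol[OF u], where k = K
        and B = "C / prod_list (norms cs u) ^ K"])
      fix z assume "z \<in> ball 0 (h u / M) - {0::complex}"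
      hence "norm (f (u + z *s b)) * (norm z * prod_list (norms cs u)) ^ K \<le> C"
        using growth'[OF u, of z] by simp
      moreover have "prod_list (norms cs u) ^ K > 0" using prod_pos[OF u] by simp
      moreover have "norm (z ^ K * f (u + z *s b)) * prod_list (norms cs u) ^ K =
          norm (f (u + z *s b)) * (norm z * prod_list (norms cs u)) ^ K"
        by (simp add: norm_mult norm_power power_mult_distrib)
      ultimately show "norm (z ^ K * f (u + z *s b)) \<le> C / prod_list (norms cs u) ^ K"
        by (simp only: pos_le_divide_eq)
    qed
    have "g u = residue (\<lambda>z. f (u + z *s b)) 0" unfolding g_def
      by (rule laurent_residue_eq[OF _ _ hol[OF u] ne]) (use pos in auto)
    also have "\<dots> = dir_mean b \<rho> f u" unfolding dir_mean_def
      by (rule circle_mean_residue[symmetric, OF hol[OF u]]) (use \<rho> M in \<open>simp_all add: pos_less_divide_eq mult.commute\<close>)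
    finally show ?thesis .
  qed
  have onX: "u + z *s b \<in> X" if "u \<in> X'" "norm z = \<bar>\<rho>\<bar>" "0 < \<rho>" "M * \<rho> < h u" for u z \<rho>
    using inX[OF that(1), of z] that M by (auto simp: pos_less_divide_eq mult.commute)
  have cont': "continuous_on X' g"
    unfolding continuous_on_eq_continuous_within
  proof
    \<comment> \<open>near \<open>u0\<close> one radius serves all points\<close>
    fix u0 assume u0: "u0 \<in> X'"
    define \<rho> where "\<rho> = h u0 / (2 * M)"
    define V where "V = {u. M * \<rho> < h u}"
    have "open V" unfolding V_def h_def
      by (intro open_Collect_less continuous_intros continuous_on_lead_norms fcs)
    have \<rho>: "\<rho> > 0" "M * \<rho> < h u0" using hpos[OF u0] M by (auto simp: \<rho>_def)
    have "continuous_on (X' \<inter> V) (dir_mean b \<rho> f)"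
      by (rule continuous_on_dir_mean[OF cont, folded X_def])
        (use onX \<rho> in \<open>auto simp: V_def\<close>)
    hence "continuous_on (X' \<inter> V) g"
      by (rule continuous_on_cong[THEN iffD1, rotated -1]) (use g_eq \<rho> in \<open>auto simp: V_def\<close>)
    hence "continuous (at u0 within X' \<inter> V) g"
      using u0 \<rho> by (auto simp: continuous_on_eq_continuous_within V_def)
    moreover have "at u0 within X' \<inter> V = at u0 within X'"
      by (rule at_within_nhd[of _ V]) (use \<open>open V\<close> \<rho> in \<open>auto simp: V_def\<close>)
    ultimately show "continuous (at u0 within X') g" by simp
  qed
  have sep': "separately_holomorphic (set bs) X' g"
    unfolding separately_holomorphic_def
  proof (intro ballI allI)
    fix b' u assume b': "b' \<in> set bs"
    let ?S = "{z. u + z *s b' \<in> X'}"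
    have "open ?S" unfolding X'_def by (rule open_line_wedge_domain[OF fcs st' b'])
    show "(\<lambda>z. g (u + z *s b')) holomorphic_on ?S"
      unfolding holomorphic_on_def
    proof
      fix z0 assume z0: "z0 \<in> ?S"
      define \<rho> where "\<rho> = h (u + z0 *s b') / (2 * M)"
      define V where "V = ?S \<inter> {z. M * \<rho> < h (u + z *s b')}"
      have "open V" unfolding V_def h_def
        by (intro open_Int \<open>open ?S\<close> open_Collect_less continuous_intros continuous_on_lead_norms_comp fcs)
      have \<rho>: "\<rho> > 0" "M * \<rho> < h (u + z0 *s b')" using hpos[of "u + z0 *s b'"] z0 M by (auto simp: \<rho>_def)
      have "(\<lambda>z. dir_mean b \<rho> f (u + z *s b')) holomorphic_on V"
        by (rule holomorphic_dir_mean[OF cont sep _ \<open>open V\<close>, folded X_def])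
          (use b' onX \<rho> in \<open>auto simp: V_def\<close>)
      hence "(\<lambda>z. g (u + z *s b')) holomorphic_on V"
        by (rule holomorphic_transform) (use g_eq \<rho> in \<open>auto simp: V_def\<close>)
      hence "(\<lambda>z. g (u + z *s b')) field_differentiable at z0"
        by (rule holomorphic_on_imp_differentiable_at[OF _ \<open>open V\<close>]) (use z0 \<rho> in \<open>auto simp: V_def\<close>)
      thus "(\<lambda>z. g (u + z *s b')) field_differentiable at z0 within ?S"
        by (rule field_differentiable_at_within)
    qed
  qed
  have growth_g: "norm (g u) * prod_list (norms cs u) ^ (2 * K) \<le> C * (2 * M) ^ K" if u: "u \<in> X'" for u
  proof -
    define \<rho> where "\<rho> = h u / (2 * M)"
    define P where "P = prod_list (norms cs u)"
    have \<rho>: "\<rho> > 0" "M * \<rho> < h u" "\<rho> < h u / M" using hpos[OF u] M by (auto simp: \<rho>_def field_simps)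
    have "P > 0" using prod_pos[OF u] by (simp add: P_def)
    have "P \<le> h u" using u prod_list_le_lead[of M "norms cs u"] M
      by (auto simp: P_def h_def X'_def wedge_domain_def)
    hence PM: "P / \<rho> \<le> 2 * M" using hpos[OF u] M by (simp add: \<rho>_def field_simps)
    have "\<rho> \<le> 1" using hpos[OF u] M by (simp add: \<rho>_def field_simps)
    have bd: "norm (f (u + z *s b)) \<le> C / (\<rho> * P) ^ K" if "norm z = \<rho>" for z
      using growth'[OF u, of z] that \<rho> \<open>P > 0\<close> by (auto simp: field_simps P_def)
    have "0 \<le> C / (\<rho> * P) ^ K"
      using order_trans[OF norm_ge_zero bd[of "of_real \<rho>"]] \<rho> by simp
    moreover have "(\<rho> * P) ^ K > 0" using \<rho> \<open>P > 0\<close> by simp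
    ultimately have "C \<ge> 0" by (simp add: zero_le_divide_iff)
    have "norm (g u) = norm (circle_mean \<rho> (\<lambda>z. f (u + z *s b)))"
      using g_eq[OF u \<rho>(1,2)] by (simp add: dir_mean_def)
    also have "\<dots> \<le> \<rho> * (C / (\<rho> * P) ^ K)"
    proof (rule circle_mean_bound[OF \<rho>(1) _ bd])
      have "continuous_on (ball 0 (h u / M) - {0}) (\<lambda>z. f (u + z *s b))"
        using hol[OF u] by (rule holomorphic_on_imp_continuous_on)
      thus "continuous_on (sphere 0 \<rho>) (\<lambda>z. f (u + z *s b))"
      proof (rule continuous_on_subset)
        show "sphere 0 \<rho> \<subseteq> ball 0 (h u / M) - {0}"
          using \<rho>(1,3) by (auto simp del: divide_const_simps)
      qed
    qed
    finally have "norm (g u) * P ^ (2 * K) \<le> \<rho> * (C / (\<rho> * P) ^ K) * P ^ (2 * K)"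
      using \<open>P > 0\<close> by (intro mult_right_mono) auto
    also have "\<dots> = \<rho> * (C * (P / \<rho>) ^ K)"
    proof -
      have "P ^ (2 * K) = P ^ K * P ^ K" by (simp add: mult_2 power_add)
      thus ?thesis using \<open>P > 0\<close> \<rho>(1) by (simp add: power_mult_distrib power_divide)
    qed
    also have "\<dots> \<le> 1 * (C * (2 * M) ^ K)"
      using \<open>\<rho> \<le> 1\<close> \<rho>(1) \<open>C \<ge> 0\<close> PM \<open>P > 0\<close> M
      by (intro mult_mono mult_left_mono power_mono) auto
    finally show ?thesis by (simp add: P_def)
  qed
  from "2.prems"(7) obtain r rs' where rs: "rs = r # rs'" by (cases rs) auto
  have "vec_residue (b # bs) f 0 = vec_residue bs g 0" by (simp add: g_def)
  also have "\<dots> = torus_mean (zip bs rs') g 0"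
    using "2.IH"[OF dual' st' M cont'[unfolded X'_def] sep'[unfolded X'_def] growth_g[unfolded X'_def], of rs']
      "2.prems"(7,8) rs by auto
  also have "\<dots> = torus_mean (zip bs rs') (dir_mean b r f) 0"
  proof (rule torus_mean_cong)
    fix w assume w: "w \<in> torus (zip bs rs') 0"
    have "length rs' = length bs" using "2.prems"(7) rs by simp
    from torus_norms[OF dual' this w st'] have n: "norms cs w = map abs rs'" and "w \<in> L'" by auto
    have wr: "wedge M rs'" "0 < r" "M * r < lead rs'" using "2.prems"(8) rs by auto
    have "map abs rs' = rs'" using wedge_le_1(2)[OF wr(1) M] by (auto intro!: map_idI)
    hence "w \<in> X'" "h w = lead rs'" using n wr \<open>w \<in> L'\<close> by (auto simp: X'_def wedge_domain_def h_def)
    thus "g w = dir_mean b r f w" using g_eq[of w r] wr by simp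
  qed
  finally show ?case by (simp add: rs)
next
  case 1
  show ?case by simp
next
  case ("3_1" b bs)
  from "3_1"(1) show ?case by simp
next
  case ("3_2" c cs)
  from "3_2"(1) show ?case by simp
qed

section \<open>Triangular changes of coordinates\<close>

lemma circle_mean_cmult: "circle_mean r (\<lambda>z. k * f z) = k * circle_mean r f"
  unfolding circle_mean_def contour_integral_integral by (simp add: mult.assoc)

lemma torus_mean_cmult: "torus_mean ps (\<lambda>u. k * f u) u = k * torus_mean ps f u"
proof (induction ps arbitrary: f)
  case (Cons p ps)
  obtain b r where p: "p = (b, r)" by force
  have "dir_mean b r (\<lambda>u. k * f u) = (\<lambda>u. k * dir_mean b r f u)"
    by (rule ext) (simp add: dir_mean_def circle_mean_cmult)
  thus ?case by (simp add: p Cons.IH)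
qed simp

definition punctured_polydisc ::
  "(complex ^ 'v) set \<Rightarrow> (complex ^ 'v \<Rightarrow> complex) list \<Rightarrow> real \<Rightarrow> (complex ^ 'v) set" where
  "punctured_polydisc L cs r = {u \<in> L. \<forall>c\<in>set cs. c u \<in> ball 0 r - {0}}"

text \<open>
  Invariance under all directions that are invisible to the given coordinates.
\<close>

definition depends_on ::
  "(complex ^ 'v) set \<Rightarrow> (complex ^ 'v \<Rightarrow> complex) list \<Rightarrow> (complex ^ 'v \<Rightarrow> complex) \<Rightarrow> bool" where
  "depends_on L cs f \<longleftrightarrow> (\<forall>u\<in>L. \<forall>u'\<in>L. (\<forall>c\<in>set cs. c u = c u') \<longrightarrow> f u = f u')"

text \<open>
  The integral over the circle on which the coordinate \<open>c\<close> has absolute value \<open>\<rho>\<close>, whatever its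
  value at \<open>u\<close> was. Unlike \<open>dir_mean\<close> the result no longer depends on the coordinate \<open>c\<close> of \<open>u\<close>.
\<close>

definition coord_mean ::
    "complex ^ 'v \<Rightarrow> (complex ^ 'v \<Rightarrow> complex) \<Rightarrow> real \<Rightarrow> (complex ^ 'v \<Rightarrow> complex) \<Rightarrow>
      complex ^ 'v \<Rightarrow> complex" where
  "coord_mean e c \<rho> f u = dir_mean e \<rho> f (u - c u *s e)"

fun coord_torus_mean ::
    "real \<Rightarrow> (complex ^ 'v) list \<Rightarrow> (complex ^ 'v \<Rightarrow> complex) list \<Rightarrow> (complex ^ 'v \<Rightarrow> complex) \<Rightarrow> complex" where
  "coord_torus_mean \<rho> (e # es) (c # cs) f = coord_torus_mean \<rho> es cs (coord_mean e c \<rho> f)"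
| "coord_torus_mean \<rho> _ _ f = f 0"

text \<open>
  The lists run from the largest to the smallest coordinate, so that each coordinate vanishes on
  all directions that come before its own.
\<close>

fun triangular :: "(complex ^ 'v) list \<Rightarrow> (complex ^ 'v \<Rightarrow> complex) list \<Rightarrow> bool" where
  "triangular (b # bs) (c # cs) \<longleftrightarrow> c b \<noteq> 0 \<and> (\<forall>c'\<in>set cs. c' b = 0) \<and> triangular bs cs"
| "triangular [] [] = True"
| "triangular _ _ = False"

text \<open>
  For every point of the remaining torus, the circle in the direction \<open>b\<close>, seen in the coordinate
  \<open>c\<close>, winds around \<open>0\<close> and stays inside the disc of radius \<open>s\<close>.
\<close>

fun dominated ::
  "real \<Rightarrow> (complex ^ 'v) list \<Rightarrow> real list \<Rightarrow> (complex ^ 'v \<Rightarrow> complex) list \<Rightarrow> bool" where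
  "dominated s (b # bs) (r # rs) (c # cs) \<longleftrightarrow> r > 0 \<and>
     (\<forall>u\<in>torus (zip bs rs) 0. norm (c u) < norm (c b) * r \<and> norm (c u) + norm (c b) * r < s) \<and>
     dominated s bs rs cs"
| "dominated s [] [] [] = True"
| "dominated s _ _ _ = False"

lemma torus_in_punctured_polydisc:
  assumes "triangular bs cs" "dominated s bs rs cs" "stable_under (set bs) L"
    "\<forall>c\<in>set cs. functional c" "u \<in> torus (zip bs rs) 0"
  shows "u \<in> punctured_polydisc L cs s"
  using assms
proof (induction s bs rs cs arbitrary: u rule: dominated.induct)
  case (1 s b bs r rs c cs)
  from "1.prems"(5) obtain w z where u: "u = w + z *s b" and w: "w \<in> torus (zip bs rs) 0"
    and z: "norm z = \<bar>r\<bar>" by auto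
  have r: "r > 0" and dom: "norm (c w) < norm (c b) * r" "norm (c w) + norm (c b) * r < s"
    using "1.prems"(2) w by auto
  have "stable_under (set bs) L" using "1.prems"(3) by (auto simp: stable_under_def)
  hence IH: "w \<in> punctured_polydisc L cs s" using "1.prems" w by (intro "1.IH") auto
  have cu: "c u = c w + z * c b" using "1.prems"(4) by (simp add: u functional_simps)
  have zb: "norm (z * c b) = norm (c b) * r" using z r by (simp add: norm_mult)
  have "u \<in> L" using stable_under_iff[OF "1.prems"(3), of b w z] IH
    by (simp add: u punctured_polydisc_def)
  have "c u \<noteq> 0"
  proof
    assume "c u = 0"
    hence "c w = - (z * c b)" using cu by (simp add: eq_neg_iff_add_eq_0)
    thus False using dom(1) zb by simp
  qed
  moreover have "norm (c u) < s"
    using norm_triangle_ineq[of "c w" "z * c b"] dom zb cu by simp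
  moreover have "c' u \<in> ball 0 s - {0}" if "c' \<in> set cs" for c'
  proof -
    have "functional c'" "c' b = 0" using that "1.prems"(1,4) by auto
    hence "c' u = c' w" by (simp add: u functional_add functional_smult)
    moreover have "c' w \<in> ball 0 s - {0}" using IH that unfolding punctured_polydisc_def by blast
    ultimately show ?thesis by simp
  qed
  ultimately have "c' u \<in> ball 0 s - {0}" if "c' \<in> set (c # cs)" for c'
    using that by auto
  thus ?case using \<open>u \<in> L\<close> by (simp add: punctured_polydisc_def)
qed (auto simp: punctured_polydisc_def stable_under_def)

lemma open_line_punctured_polydisc:
  assumes "\<forall>c\<in>set cs. functional c" "stable_under B L" "b \<in> B"
  shows "open {z. u + z *s b \<in> punctured_polydisc L cs s}"
proof (cases "u \<in> L")
  case True
  have "open (\<Inter>c\<in>set cs. (\<lambda>z. c (u + z *s b)) -` (ball 0 s - {0}))"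
  proof (intro open_INT ballI open_vimage)
    show "continuous_on UNIV (\<lambda>z. c (u + z *s b))" if "c \<in> set cs" for c
      using assms that by (intro continuous_intros functional_cont_comp) auto
  qed auto
  moreover have "{z. u + z *s b \<in> punctured_polydisc L cs s} =
      (\<Inter>c\<in>set cs. (\<lambda>z. c (u + z *s b)) -` (ball 0 s - {0}))"
    using True stable_under_iff[OF assms(2,3), of u]
    by (simp add: punctured_polydisc_def set_eq_iff)
  ultimately show ?thesis by simp
qed (use stable_under_iff[OF assms(2,3)] in \<open>simp add: punctured_polydisc_def\<close>)

text \<open>
  The directions are straightened one after the other, beginning with the last coordinate. Once a
  coordinate \<open>c\<close> has been integrated out, the function no longer depends on it, and so the component of
  later directions along it is irrelevant. For the current direction only its component along \<open>e\<close>
  matters, which is \<open>c b\<close>; the integral in question is then over a circle with centre \<open>c u\<close>,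
  which domination allows to be moved to \<open>0\<close>.
\<close>

lemma torus_mean_triangular:
  assumes "dual_lists es cs" "triangular bs cs" "dominated s bs rs cs"
    and "stable_under (set es) L" "stable_under (set bs) L"
    and "continuous_on (punctured_polydisc L cs s) f"
    and "separately_holomorphic (set es) (punctured_polydisc L cs s) f"
    and "depends_on L cs f" and "0 < \<rho>" "\<rho> < s"
  shows "torus_mean (zip bs rs) f 0 * prod_list (map2 (\<lambda>c b. c b) cs bs) = coord_torus_mean \<rho> es cs f"
  using assms
proof (induction es cs arbitrary: bs rs f rule: dual_lists.induct)
  case 1
  from "1"(2) have "bs = []" by (cases bs) auto
  thus ?case by simp
next
  case (2 e es c cs)
  note prems = "2.prems"
  from prems(2) obtain b bs' where bs: "bs = b # bs'" by (cases bs) auto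
  from prems(3) obtain r rs' where rs: "rs = r # rs'" by (cases rs) (auto simp: bs)
  from prems(1) have fc: "functional c" and ce: "c e = 1" and ces: "\<And>e'. e' \<in> set es \<Longrightarrow> c e' = 0"
    and cse: "\<forall>c'\<in>set cs. c' e = 0" and dual': "dual_lists es cs"
    and fcs: "\<forall>c\<in>set cs. functional c"
    using dual_lists_functional[of es cs] by auto
  from prems(2) have cb: "c b \<noteq> 0" and csb: "\<forall>c'\<in>set cs. c' b = 0" and tri': "triangular bs' cs"
    by (auto simp: bs)
  from prems(3) have r: "r > 0" and dom: "\<And>u. u \<in> torus (zip bs' rs') 0 \<Longrightarrow>
      norm (c u) < norm (c b) * r \<and> norm (c u) + norm (c b) * r < s" and dom': "dominated s bs' rs' cs"
    by (auto simp: bs rs)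
  have st': "stable_under (set es) L" "stable_under (set bs') L"
    using prems(4,5) by (auto simp: stable_under_def bs)
  have eL: "u + z *s e \<in> L \<longleftrightarrow> u \<in> L" for u z
    by (rule stable_under_iff[OF prems(4)]) simp
  have bL: "u + z *s b \<in> L \<longleftrightarrow> u \<in> L" for u z
    by (rule stable_under_iff[OF prems(5)]) (simp add: bs)
  define Y where "Y = punctured_polydisc L (c # cs) s"
  define Y' where "Y' = punctured_polydisc L cs s"
  define g where "g = coord_mean e c \<rho> f"
  have onY: "u - c u *s e + z *s e \<in> Y" if "u \<in> Y'" "z \<noteq> 0" "norm z < s" for u z
  proof -
    define v where "v = u + (z - c u) *s e"
    have v: "u - c u *s e + z *s e = v"
      by (simp add: v_def algebra_simps vector_sub_rdistrib)
    have "v \<in> L"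
      unfolding v_def eL using that by (simp add: Y'_def punctured_polydisc_def)
    moreover have "c v = z" using fc ce by (simp add: v_def functional_simps)
    moreover have "c' v \<in> ball 0 s - {0}" if "c' \<in> set cs" for c'
    proof -
      have "functional c'" "c' e = 0" using that fcs cse by auto
      hence "c' v = c' u" by (simp add: v_def functional_simps)
      moreover have "c' u \<in> ball 0 s - {0}"
        using \<open>u \<in> Y'\<close> that unfolding Y'_def punctured_polydisc_def by blast
      ultimately show ?thesis by simp
    qed
    ultimately show ?thesis using that unfolding v Y_def punctured_polydisc_def by simp
  qed
  have on_circle: "u - c u *s e + z *s e \<in> Y" if "u \<in> Y'" "norm z = \<bar>\<rho>\<bar>" for u z
    using that prems(9,10) by (intro onY) auto
  have cont_g: "continuous_on Y' g"
  proof -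
    have "continuous_on ((\<lambda>u. u - c u *s e) ` Y') (dir_mean e \<rho> f)"
      by (rule continuous_on_dir_mean[OF prems(6), folded Y_def]) (use on_circle in blast)
    moreover have "continuous_on Y' (\<lambda>u. u - c u *s e)" using fc by (intro continuous_intros functional_cont)
    ultimately show ?thesis unfolding g_def coord_mean_def
      by (rule continuous_on_compose2) auto
  qed
  have sep_g: "separately_holomorphic (set es) Y' g"
    unfolding separately_holomorphic_def
  proof (intro ballI allI)
    fix e' u assume e': "e' \<in> set es"
    let ?V = "{z. u + z *s e' \<in> Y'}"
    have eq: "u + z *s e' - c (u + z *s e') *s e = u - c u *s e + z *s e'" for z
      using fc ces[OF e'] by (simp add: functional_add functional_smult)
    have "(\<lambda>z. dir_mean e \<rho> f (u - c u *s e + z *s e')) holomorphic_on ?V"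
    proof (rule holomorphic_dir_mean[OF prems(6,7), folded Y_def])
      show "open ?V" unfolding Y'_def by (rule open_line_punctured_polydisc[OF fcs st'(1) e'])
      show "u - c u *s e + z *s e' + w *s e \<in> Y" if "z \<in> ?V" "norm w = \<bar>\<rho>\<bar>" for z w
        using on_circle[of "u + z *s e'" w] that unfolding eq by simp
    qed (use e' in simp)
    thus "(\<lambda>z. g (u + z *s e')) holomorphic_on ?V"
      unfolding g_def coord_mean_def eq .
  qed
  have dep_g: "depends_on L cs g"
    unfolding depends_on_def
  proof (intro ballI impI)
    fix u u' assume u: "u \<in> L" "u' \<in> L" "\<forall>c\<in>set cs. c u = c u'"
    have "f (u - c u *s e + z *s e) = f (u' - c u' *s e + z *s e)" for z
    proof -
      have eq: "v - c v *s e + z *s e = v + (z - c v) *s e" for v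
        by (simp add: algebra_simps vector_sub_rdistrib)
      have "c' (u - c u *s e + z *s e) = c' (u' - c u' *s e + z *s e)" if "c' \<in> set (c # cs)" for c'
      proof (cases "c' = c")
        case True
        thus ?thesis using fc ce by (simp add: functional_simps)
      next
        case False
        hence "c' \<in> set cs" using that by simp
        hence "functional c'" "c' e = 0" "c' u = c' u'" using fcs cse u by auto
        thus ?thesis by (simp add: functional_simps)
      qed
      moreover have "u - c u *s e + z *s e \<in> L" "u' - c u' *s e + z *s e \<in> L"
        unfolding eq eL using u by auto
      ultimately show ?thesis using prems(8) unfolding depends_on_def by blast
    qed
    thus "g u = g u'" by (simp add: g_def coord_mean_def dir_mean_def)
  qed
  have step: "dir_mean b r f w = inverse (c b) * g w" if w: "w \<in> torus (zip bs' rs') 0" for w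
  proof -
    have wY: "w \<in> Y'" unfolding Y'_def
      by (rule torus_in_punctured_polydisc[OF tri' dom' st'(2) fcs w])
    hence wL: "w \<in> L" by (simp add: Y'_def punctured_polydisc_def)
    define \<phi> where "\<phi> = (\<lambda>z. f (w - c w *s e + z *s e))"
    have hol: "\<phi> holomorphic_on ball 0 s - {0}"
    proof (rule holomorphic_on_subset)
      show "\<phi> holomorphic_on {z. w - c w *s e + z *s e \<in> Y}"
        using prems(7) by (simp add: \<phi>_def separately_holomorphic_def Y_def)
      show "ball 0 s - {0} \<subseteq> {z. w - c w *s e + z *s e \<in> Y}"
      proof
        fix z :: complex assume "z \<in> ball 0 s - {0}"
        thus "z \<in> {z. w - c w *s e + z *s e \<in> Y}" using onY[OF wY, of z] by simp
      qed
    qed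
    have "f (w + z *s b) = \<phi> (c w + c b * z)" for z
    proof -
      have eq: "w - c w *s e + (c w + c b * z) *s e = w + (c b * z) *s e"
        by (simp add: algebra_simps)
      have "c' (w + z *s b) = c' (w + (c b * z) *s e)" if "c' \<in> set (c # cs)" for c'
      proof (cases "c' = c")
        case True
        thus ?thesis using fc ce by (simp add: functional_simps)
      next
        case False
        hence "c' \<in> set cs" using that by simp
        hence "functional c'" "c' e = 0" "c' b = 0" using fcs cse csb by auto
        thus ?thesis by (simp add: functional_simps)
      qed
      moreover have "w + z *s b \<in> L" "w + (c b * z) *s e \<in> L" unfolding eL bL using wL by auto
      ultimately have "f (w + z *s b) = f (w + (c b * z) *s e)"
        using prems(8) unfolding depends_on_def by blast
      thus ?thesis unfolding \<phi>_def eq .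
    qed
    hence "dir_mean b r f w = circle_mean r (\<lambda>z. \<phi> (c w + c b * z))" by (simp add: dir_mean_def)
    also have "\<dots> = residue \<phi> 0 / c b"
      using dom[OF w] r by (intro circle_mean_affine[OF hol]) auto
    also have "residue \<phi> 0 = circle_mean \<rho> \<phi>"
      by (rule circle_mean_residue[OF hol prems(9,10), symmetric])
    also have "\<dots> = g w" by (simp add: g_def coord_mean_def dir_mean_def \<phi>_def)
    finally show ?thesis by (simp add: field_simps)
  qed
  have "torus_mean (zip bs rs) f 0 = torus_mean (zip bs' rs') (dir_mean b r f) 0" by (simp add: bs rs)
  also have "\<dots> = torus_mean (zip bs' rs') (\<lambda>w. inverse (c b) * g w) 0"
    by (rule torus_mean_cong) (rule step)
  also have "\<dots> = inverse (c b) * torus_mean (zip bs' rs') g 0" by (rule torus_mean_cmult)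
  finally have "torus_mean (zip bs rs) f 0 * prod_list (map2 (\<lambda>c b. c b) (c # cs) bs) =
      torus_mean (zip bs' rs') g 0 * prod_list (map2 (\<lambda>c b. c b) cs bs')"
    using cb by (simp add: bs)
  also have "\<dots> = coord_torus_mean \<rho> es cs g"
    by (rule "2.IH"[OF dual' tri' dom' st' cont_g[unfolded Y'_def] sep_g[unfolded Y'_def] dep_g prems(9,10)])
  finally show ?case by (simp add: g_def)
next
  case ("3_1" b bs)
  from "3_1"(1) show ?case by simp
next
  case ("3_2" c cs)
  from "3_2"(1) show ?case by simp
qed

lemma dual_triangular: "dual_lists es cs \<Longrightarrow> triangular es cs"
  by (induction es cs rule: dual_lists.induct) auto

lemma prod_dual: "dual_lists es cs \<Longrightarrow> prod_list (map2 (\<lambda>c b. c b) cs es) = 1"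
  by (induction es cs rule: dual_lists.induct) auto

lemma dual_dominated:
  assumes "dual_lists es cs" "0 < \<rho>" "\<rho> < s"
  shows "dominated s es (replicate (length es) \<rho>) cs"
  using assms
proof (induction es cs rule: dual_lists.induct)
  case (2 e es c cs)
  have "c u = 0" if "u \<in> torus (zip es (replicate (length es) \<rho>)) 0" for u
    using torus_norms[of es cs "replicate (length es) \<rho>" u UNIV] that 2
    by (auto simp: stable_under_def)
  thus ?case using 2 by auto
qed auto

text \<open>
  Both tori give the same \<open>coord_torus_mean\<close>: the second one is the case of dual directions.
\<close>

lemma torus_mean_change_basis:
  assumes "dual_lists es cs" "triangular bs cs" "dominated s bs rs cs"
    and "stable_under (set es) L" "stable_under (set bs) L"
    and "continuous_on (punctured_polydisc L cs s) f"
    and "separately_holomorphic (set es) (punctured_polydisc L cs s) f"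
    and "depends_on L cs f" and "0 < \<rho>" "\<rho> < s"
  shows "torus_mean (zip bs rs) f 0 * prod_list (map2 (\<lambda>c b. c b) cs bs) =
    torus_mean (zip es (replicate (length es) \<rho>)) f 0"
  using torus_mean_triangular[OF assms]
    torus_mean_triangular[OF assms(1) dual_triangular[OF assms(1)] dual_dominated[OF assms(1,9,10)]
      assms(4,4) assms(6-10)] prod_dual[OF assms(1)]
  by simp

section \<open>An identity theorem on punctured polydiscs\<close>

text \<open>
  A nonvanishing derivative of order \<open>k\<close> bounds the order of the zero of the denominator by \<open>k\<close>.
  This criterion is used because the derivative of order \<open>k\<close> varies continuously with parameters,
  in contrast to the order of vanishing.
\<close>

lemma quotient_times_power_bounded:
  assumes g: "g holomorphic_on ball 0 s" and h: "h holomorphic_on ball 0 s" and "s > 0"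
    and k: "(deriv ^^ k) h 0 \<noteq> 0" "k \<le> K"
    and f: "\<And>z. z \<in> ball 0 s - {0} \<Longrightarrow> h z \<noteq> 0 \<Longrightarrow> f z = g z / h z"
  shows "\<exists>B. \<forall>\<^sub>F z in at 0. norm (z ^ K * f z) \<le> (B::real)"
proof -
  define m where "m = (LEAST n. (deriv ^^ n) h 0 \<noteq> 0)"
  have m: "(deriv ^^ m) h 0 \<noteq> 0" unfolding m_def by (rule LeastI[of _ k]) (rule k(1))
  have mk: "m \<le> k" unfolding m_def by (rule Least_le) (rule k(1))
  have least: "(deriv ^^ i) h 0 = 0" if "i < m" for i
    using that not_less_Least unfolding m_def by blast
  obtain r h1 where r: "r > 0" "h1 holomorphic_on ball 0 r"
    "\<And>z. z \<in> ball 0 r \<Longrightarrow> h z = z ^ m * h1 z" "\<And>z. z \<in> ball 0 r \<Longrightarrow> h1 z \<noteq> 0"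
  proof (cases "m = 0")
    case True
    hence "h 0 \<noteq> 0" using m by simp
    then obtain e where e: "e > 0" "\<And>y. y \<in> ball 0 s \<Longrightarrow> dist 0 y < e \<Longrightarrow> h y \<noteq> 0"
      using continuous_on_avoid[OF holomorphic_on_imp_continuous_on[OF h], of 0 0] \<open>s > 0\<close> by auto
    show ?thesis
      by (rule that[of "min s e" h]) (use e True \<open>s > 0\<close> h in \<open>auto intro: holomorphic_on_subset\<close>)
  next
    case False
    hence "h 0 = 0" using least[of 0] by simp
    show ?thesis
    proof (rule holomorphic_factor_order_of_zero[OF h open_ball, of 0 m])
      fix g' r assume "0 < r" "g' holomorphic_on ball 0 r"
        "\<And>w. w \<in> ball 0 r \<Longrightarrow> h w - h 0 = (w - 0) ^ m * g' w" "\<And>w. w \<in> ball 0 r \<Longrightarrow> g' w \<noteq> 0"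
      thus thesis using \<open>h 0 = 0\<close> by (intro that[of r g']) auto
    qed (use False m least \<open>s > 0\<close> in auto)
  qed
  define q where "q = (\<lambda>z. z ^ (K - m) * g z / h1 z)"
  have "q holomorphic_on ball 0 (min r s)" unfolding q_def
    using r g by (intro holomorphic_intros) (auto intro: holomorphic_on_subset)
  hence "isCont q 0"
    using r(1) \<open>s > 0\<close> by (auto dest!: holomorphic_on_imp_continuous_on simp: continuous_on_eq_continuous_at)
  hence "\<forall>\<^sub>F z in at 0. dist (q z) (q 0) < 1"
    by (auto simp: isCont_def dest: tendstoD[where e = 1])
  moreover have "\<forall>\<^sub>F z in at 0. z \<in> ball 0 (min r s) - {0}"
    using r(1) \<open>s > 0\<close> by (intro eventually_at_in_open) auto
  ultimately have "\<forall>\<^sub>F z in at 0. norm (z ^ K * f z) \<le> norm (q 0) + 1"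
  proof eventually_elim
    case (elim z)
    hence "h z = z ^ m * h1 z" "h1 z \<noteq> 0" "z \<noteq> 0" using r by auto
    moreover have "z ^ K = z ^ (K - m) * z ^ m" using mk k(2) by (simp flip: power_add)
    ultimately have "z ^ K * f z = q z" using f[of z] elim by (simp add: q_def)
    moreover have "norm (q z) \<le> norm (q 0) + 1"
      using elim(1) norm_triangle_ineq2[of "q z" "q 0"] by (simp add: dist_norm)
    ultimately show ?case by simp
  qed
  thus ?thesis by blast
qed

lemma Cauchy_formula_removable:
  assumes f: "f holomorphic_on ball 0 s - {0}" and bd: "\<exists>B. \<forall>\<^sub>F z in at 0. norm (f z) \<le> (B::real)"
    and z: "z \<noteq> 0" "norm z < \<rho>" and "\<rho> < s"
  shows "f z = circle_mean \<rho> (\<lambda>w. f w / (w - z))"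
proof -
  have "0 < \<rho>" using z norm_ge_zero[of z] by linarith
  obtain F where F: "F holomorphic_on ball 0 s" "\<And>w. w \<in> ball 0 s - {0} \<Longrightarrow> F w = f w"
    using holomorphic_on_extend_bounded[OF f] bd \<open>0 < \<rho>\<close> \<open>\<rho> < s\<close> by auto
  have "F holomorphic_on cball 0 \<rho>"
    by (rule holomorphic_on_subset[OF F(1)]) (use \<open>\<rho> < s\<close> in auto)
  hence "((\<lambda>w. F w / (w - z)) has_contour_integral 2 * of_real pi * \<i> * F z) (circlepath 0 \<rho>)"
    using z by (intro Cauchy_integral_circlepath_simple) auto
  hence "F z = circle_mean \<rho> (\<lambda>w. F w / (w - z))"
    by (simp add: circle_mean_def contour_integral_unique)
  also have "\<dots> = circle_mean \<rho> (\<lambda>w. f w / (w - z))"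
    using F(2) \<open>0 < \<rho>\<close> \<open>\<rho> < s\<close> by (intro circle_mean_cong) auto
  finally show ?thesis using F(2)[of z] z \<open>\<rho> < s\<close> by simp
qed

lemma norm_smult_vec: "norm (z *s (e :: complex ^ 'v)) = norm z * norm e"
  by (simp add: norm_vec_def vector_scalar_mult_def norm_mult L2_set_right_distrib)

text \<open>
  Dual lists that identify \<open>L\<close> with a coordinate space.
\<close>

definition coordinates ::
  "(complex ^ 'v) set \<Rightarrow> (complex ^ 'v) list \<Rightarrow> (complex ^ 'v \<Rightarrow> complex) list \<Rightarrow> bool" where
  "coordinates L es cs \<longleftrightarrow> dual_lists es cs \<and> stable_under (set es) L \<and>
     (\<forall>u\<in>L. u = combine (map (\<lambda>c. c u) cs) es)"

lemma norm_combine_le: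
  assumes "length zs = length es" "\<forall>z\<in>set zs. norm z \<le> \<epsilon>"
  shows "norm (combine zs es) \<le> \<epsilon> * (\<Sum>e\<leftarrow>es. norm e)"
  using assms
proof (induction zs es rule: list_induct2)
  case (Cons z zs e es)
  have "norm (combine (z # zs) (e # es)) \<le> norm (z *s e) + norm (combine zs es)"
    unfolding combine_Cons by (rule norm_triangle_ineq)
  also have "\<dots> \<le> \<epsilon> * norm e + \<epsilon> * (\<Sum>e\<leftarrow>es. norm e)"
    using Cons by (intro add_mono) (auto simp: norm_smult_vec intro: mult_right_mono)
  finally show ?case by (simp add: algebra_simps)
qed (simp add: combine_def)

lemma combine_diff:
  assumes "length zs = length es" "length ws = length es"
  shows "combine zs es - combine ws es = combine (map2 (-) zs ws) es"
  using assms
  by (auto simp: combine_def vector_sub_rdistrib sum_subtractf[symmetric] intro!: sum.cong)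

lemma dual_lists_zip_eq: "dual_lists es cs \<Longrightarrow> (e, c) \<in> set (zip es cs) \<Longrightarrow> c e = 1"
  by (induction es cs rule: dual_lists.induct) auto

lemma dual_lists_zip_neq:
  "dual_lists es cs \<Longrightarrow> (e, c) \<in> set (zip es cs) \<Longrightarrow> (e', c') \<in> set (zip es cs) \<Longrightarrow>
     (e, c) \<noteq> (e', c') \<Longrightarrow> c' e = 0"
  by (induction es cs rule: dual_lists.induct) (auto dest: set_zip_leftD set_zip_rightD)

lemma set_zip_snd: "length es = length cs \<Longrightarrow> c \<in> set cs \<Longrightarrow> \<exists>e. (e, c) \<in> set (zip es cs)"
  by (metis in_set_impl_in_set_zip2)

lemma punctured_polydisc_line:
  assumes co: "coordinates L es cs" and ec: "(e, c) \<in> set (zip es cs)"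
    and u: "u \<in> punctured_polydisc L cs s" and z: "z \<in> ball 0 s - {0}"
  shows "u + (z - c u) *s e \<in> punctured_polydisc L cs s"
    and "c (u + (z - c u) *s e) = z"
    and "\<And>e' c'. (e', c') \<in> set (zip es cs) \<Longrightarrow> (e', c') \<noteq> (e, c) \<Longrightarrow> c' (u + (z - c u) *s e) = c' u"
proof -
  have dual: "dual_lists es cs" and st: "stable_under (set es) L" using co by (auto simp: coordinates_def)
  have fc: "functional c'" if "c' \<in> set cs" for c' using dual_lists_functional[OF dual that] .
  have c: "c \<in> set cs" "e \<in> set es" using ec by (auto dest: set_zip_leftD set_zip_rightD)
  show 1: "c (u + (z - c u) *s e) = z"
    using fc[OF c(1)] dual_lists_zip_eq[OF dual ec] by (simp add: functional_simps)
  show 2: "c' (u + (z - c u) *s e) = c' u"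
    if "(e', c') \<in> set (zip es cs)" "(e', c') \<noteq> (e, c)" for e' c'
  proof -
    have "functional c'" using that(1) fc by (auto dest: set_zip_rightD)
    thus ?thesis using dual_lists_zip_neq[OF dual ec that(1)] that(2) by (auto simp: functional_simps)
  qed
  have "c' (u + (z - c u) *s e) \<in> ball 0 s - {0}" if c': "c' \<in> set cs" for c'
  proof -
    obtain e' where e': "(e', c') \<in> set (zip es cs)"
      using set_zip_snd[OF dual_lists_length[OF dual] c'] by blast
    have "c' u \<in> ball 0 s - {0}" using u c' unfolding punctured_polydisc_def by blast
    thus ?thesis using 1 2[OF e'] z by (cases "(e', c') = (e, c)") auto
  qed
  moreover have "u + (z - c u) *s e \<in> L"
    using stable_under_iff[OF st c(2)] u unfolding punctured_polydisc_def by blast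
  ultimately show "u + (z - c u) *s e \<in> punctured_polydisc L cs s"
    unfolding punctured_polydisc_def by blast
qed

text \<open>
  Zeros spread from a small box around \<open>u\<^sub>0\<close> in one coordinate after the other: along a line in the
  direction of a coordinate, the identity theorem in one variable applies on the punctured disc,
  which is connected. The list \<open>ps\<close> in the induction collects the coordinates that are already
  unrestricted.
\<close>

lemma identity_punctured_polydisc:
  assumes co: "coordinates L es cs"
    and sep: "separately_holomorphic (set es) (punctured_polydisc L cs s) \<psi>"
    and u0: "u0 \<in> punctured_polydisc L cs s" and "\<delta> > 0"
    and zero: "\<And>u. u \<in> punctured_polydisc L cs s \<Longrightarrow> dist u0 u < \<delta> \<Longrightarrow> \<psi> u = 0"
    and u: "u \<in> punctured_polydisc L cs s"
  shows "\<psi> u = 0"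
proof -
  define Y where "Y = punctured_polydisc L cs s"
  have dual: "dual_lists es cs" and span: "\<And>u. u \<in> L \<Longrightarrow> u = combine (map (\<lambda>c. c u) cs) es"
    using co by (auto simp: coordinates_def)
  have len: "length es = length cs" using dual_lists_length[OF dual] .
  \<comment> \<open>the box of size \<open>\<epsilon>\<close> is contained in the ball of radius \<open>\<delta>\<close>\<close>
  define \<epsilon> where "\<epsilon> = \<delta> / (1 + (\<Sum>e\<leftarrow>es. norm e))"
  have nn: "(\<Sum>e\<leftarrow>es. norm e) \<ge> 0" by (induction es) auto
  have \<epsilon>: "\<epsilon> > 0" "\<epsilon> * (\<Sum>e\<leftarrow>es. norm e) < \<delta>"
    using \<open>\<delta> > 0\<close> nn by (auto simp: \<epsilon>_def field_simps)
  have "\<psi> u = 0" if "u \<in> Y" "\<forall>(e, c)\<in>set (zip es cs) - set ps. norm (c u - c u0) < \<epsilon>" for ps u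
    using that
  proof (induction ps arbitrary: u)
    case Nil
    have "norm (c u - c u0) < \<epsilon>" if "c \<in> set cs" for c
      using set_zip_snd[OF len that] Nil.prems(2) by auto
    moreover have "u \<in> L" "u0 \<in> L" using Nil.prems(1) u0 by (auto simp: Y_def punctured_polydisc_def)
    hence "u - u0 = combine (map (\<lambda>c. c u) cs) es - combine (map (\<lambda>c. c u0) cs) es"
      using span by metis
    hence "u - u0 = combine (map (\<lambda>c. c u - c u0) cs) es"
      using combine_diff[of "map (\<lambda>c. c u) cs" es "map (\<lambda>c. c u0) cs"] len
      by (simp add: map2_map_map)
    ultimately have "norm (u - u0) \<le> \<epsilon> * (\<Sum>e\<leftarrow>es. norm e)"
      using norm_combine_le[of "map (\<lambda>c. c u - c u0) cs" es \<epsilon>] len by (auto simp: less_imp_le)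
    thus ?case using \<epsilon> zero[of u] Nil.prems(1) by (simp add: dist_norm norm_minus_commute Y_def)
  next
    case (Cons p ps)
    obtain e c where p: "p = (e, c)" by force
    show ?case
    proof (cases "p \<in> set (zip es cs)")
      case False
      thus ?thesis using Cons by auto
    next
      case True
      hence ec: "(e, c) \<in> set (zip es cs)" by (simp add: p)
      have c: "c \<in> set cs" "e \<in> set es" using ec by (auto dest: set_zip_leftD set_zip_rightD)
      have cu: "c u \<in> ball 0 s - {0}" "c u0 \<in> ball 0 s - {0}"
        using Cons.prems(1) u0 c(1) unfolding Y_def punctured_polydisc_def by blast+
      define \<gamma> where "\<gamma> = (\<lambda>z. \<psi> (u + (z - c u) *s e))"
      note line = punctured_polydisc_line[OF co ec Cons.prems(1)[unfolded Y_def]]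
      have "(\<lambda>z. \<psi> (u - c u *s e + z *s e)) holomorphic_on {z. u - c u *s e + z *s e \<in> Y}"
        using sep c(2) unfolding separately_holomorphic_def Y_def by blast
      moreover have "u - c u *s e + z *s e = u + (z - c u) *s e" for z
        by (simp add: algebra_simps vector_sub_rdistrib)
      ultimately have "\<gamma> holomorphic_on {z. u + (z - c u) *s e \<in> Y}" by (simp only: \<gamma>_def)
      hence hol: "\<gamma> holomorphic_on ball 0 s - {0}"
        by (rule holomorphic_on_subset) (use line(1) in \<open>auto simp: Y_def\<close>)
      have "\<gamma> (c u) = 0"
      proof (rule analytic_continuation_open[where g = "\<lambda>_. 0" and f = \<gamma> and z = "c u"
            and s = "(ball 0 s - {0}) \<inter> ball (c u0) \<epsilon>" and s' = "ball 0 s - {0}"])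
        show "open ((ball 0 s - {0}) \<inter> ball (c u0) \<epsilon>)" by (intro open_Int open_ball open_Diff closed_singleton)
        show "(ball 0 s - {0}) \<inter> ball (c u0) \<epsilon> \<noteq> {}" using cu(2) \<epsilon>(1) centre_in_ball by blast
        show "Topological_Spaces.connected (ball (0::complex) s - {0})"
          by (rule connected_punctured_ball) simp
        fix z assume z: "z \<in> (ball 0 s - {0}) \<inter> ball (c u0) \<epsilon>"
        show "\<gamma> z = 0" unfolding \<gamma>_def
        proof (rule Cons.IH)
          show "u + (z - c u) *s e \<in> Y" using line(1) z by (simp add: Y_def)
          show "\<forall>(e', c')\<in>set (zip es cs) - set ps. norm (c' (u + (z - c u) *s e) - c' u0) < \<epsilon>"
          proof (clarify)
            fix e' c' assume e': "(e', c') \<in> set (zip es cs)" "(e', c') \<notin> set ps"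
            show "norm (c' (u + (z - c u) *s e) - c' u0) < \<epsilon>"
            proof (cases "(e', c') = (e, c)")
              case True
              thus ?thesis using line(2)[of z] z by (auto simp: dist_norm norm_minus_commute)
            next
              case False
              thus ?thesis using line(3)[of z e' c'] z e' Cons.prems(2) by (auto simp: p)
            qed
          qed
        qed
      qed (use hol cu in auto)
      thus ?thesis by (simp add: \<gamma>_def)
    qed
  qed
  from this[of u "zip es cs"] show ?thesis using u by (simp add: Y_def)
qed

section \<open>Moderate growth of meromorphic germs\<close>

lemma combine_zip:
  "length es = length cs \<Longrightarrow>
     combine (map (\<lambda>c. c u) cs) es = (\<Sum>p\<leftarrow>zip es cs. snd p u *s fst p)"
  by (induction es cs rule: list_induct2) (simp_all add: combine_Cons, simp add: combine_def)

lemma dual_lists_filter: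
  "dual_lists es cs \<Longrightarrow>
     dual_lists (map fst (filter P (zip es cs))) (map snd (filter P (zip es cs)))"
  by (induction es cs rule: dual_lists.induct) (auto dest: set_zip_leftD set_zip_rightD)

lemma zip_map_fst_snd: "zip (map fst ps) (map snd ps) = ps"
  by (induction ps) auto

text \<open>
  A coordinate hyperplane inherits the remaining coordinates.
\<close>

lemma coordinates_slice:
  fixes e :: "complex ^ 'v"
  assumes co: "coordinates L es cs" and ec: "(e, c) \<in> set (zip es cs)"
  defines "qs \<equiv> filter (\<lambda>p. p \<noteq> (e, c)) (zip es cs)"
  shows "coordinates {u \<in> L. c u = 0} (map fst qs) (map snd qs)"
  unfolding coordinates_def
proof (intro conjI)
  have dual: "dual_lists es cs" and st: "stable_under (set es) L"
    and span: "\<And>u. u \<in> L \<Longrightarrow> u = combine (map (\<lambda>c. c u) cs) es"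
    using co by (auto simp: coordinates_def)
  have fc: "functional c" using dual_lists_functional[OF dual] ec by (auto dest: set_zip_rightD)
  show "dual_lists (map fst qs) (map snd qs)" unfolding qs_def by (rule dual_lists_filter[OF dual])
  have sub: "set (map fst qs) \<subseteq> set es" by (auto simp: qs_def dest: set_zip_leftD)
  have c0: "c e' = 0" if e': "e' \<in> set (map fst qs)" for e'
  proof -
    obtain p where "p \<in> set qs" "e' = fst p" using e' by auto
    hence "(e', snd p) \<in> set (zip es cs)" "(e', snd p) \<noteq> (e, c)"
      by (auto simp: qs_def prod_eq_iff)
    thus ?thesis by (rule dual_lists_zip_neq[OF dual _ ec])
  qed
  show "stable_under (set (map fst qs)) {u \<in> L. c u = 0}"
    using st sub c0 fc unfolding stable_under_def
    by (auto simp: functional_zero functional_add functional_smult)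
  show "\<forall>u\<in>{u \<in> L. c u = 0}. u = combine (map (\<lambda>c. c u) (map snd qs)) (map fst qs)"
  proof
    fix u assume u: "u \<in> {u \<in> L. c u = 0}"
    have "u = (\<Sum>p\<leftarrow>zip es cs. snd p u *s fst p)"
      using span[of u] u combine_zip[OF dual_lists_length[OF dual]] by simp
    also have "\<dots> = (\<Sum>p\<leftarrow>qs. snd p u *s fst p)"
      unfolding qs_def
      by (rule sum_list_map_filter[symmetric]) (use u in auto)
    also have "\<dots> = combine (map (\<lambda>c. c u) (map snd qs)) (map fst qs)"
      by (subst combine_zip) (simp_all only: length_map zip_map_fst_snd)
    finally show "u = combine (map (\<lambda>c. c u) (map snd qs)) (map fst qs)" .
  qed
qed

definition polydisc ::
  "(complex ^ 'v) set \<Rightarrow> (complex ^ 'v \<Rightarrow> complex) list \<Rightarrow> real \<Rightarrow> (complex ^ 'v) set" where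
  "polydisc L cs r = {u \<in> L. \<forall>c\<in>set cs. c u \<in> ball 0 r}"

lemma punctured_subset_polydisc: "punctured_polydisc L cs s \<subseteq> polydisc L cs s"
  by (auto simp: punctured_polydisc_def polydisc_def)

text \<open>
  The pole along one coordinate hyperplane has bounded order, expressed by the Cauchy formula for
  \<open>z\<^sup>K f\<close>, which holds iff the singularity at \<open>z = 0\<close> is removable. At points of the hyperplane
  where the \<open>k\<close>-th Taylor coefficient \<open>H\<^sub>k\<close> of the denominator in the direction \<open>e\<close> does not vanish,
  the pole has order at most \<open>k\<close>. Some \<open>H\<^sub>k\<close> is nonzero at some point, hence on an open set. For
  fixed \<open>z\<close> the two sides of the Cauchy formula depend holomorphically on the point of the hyperplane,
  so by the identity theorem the formula holds everywhere.
\<close>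

lemma finite_pole_order_in_direction:
  fixes e :: "complex ^ 'v"
  assumes co: "coordinates L es cs" and ec: "(e, c) \<in> set (zip es cs)"
    and \<rho>: "0 < \<rho>" "\<rho> < s"
    and sepf: "separately_holomorphic (set es) (punctured_polydisc L cs s) f"
    and contf: "continuous_on (punctured_polydisc L cs s) f"
    and sepg: "separately_holomorphic (set es) (polydisc L cs s) g"
    and seph: "separately_holomorphic (set es) (polydisc L cs s) h"
    and conth: "continuous_on (polydisc L cs s) h"
    and y: "y \<in> punctured_polydisc L cs s" "h y \<noteq> 0"
    and quot: "\<And>y. y \<in> punctured_polydisc L cs s \<Longrightarrow> h y \<noteq> 0 \<Longrightarrow> f y = g y / h y"
  shows "\<exists>k. \<forall>K\<ge>k. \<forall>u\<in>punctured_polydisc L cs s. \<forall>z. z \<noteq> 0 \<and> norm z < \<rho> \<longrightarrow>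
     z ^ K * f (u - c u *s e + z *s e) =
       circle_mean \<rho> (\<lambda>w. w ^ K * f (u - c u *s e + w *s e) / (w - z))"
proof -
  define qs where "qs = filter (\<lambda>p. p \<noteq> (e, c)) (zip es cs)"
  define L' where "L' = {u \<in> L. c u = 0}"
  define Y where "Y = punctured_polydisc L cs s"
  define P where "P = polydisc L cs s"
  define D where "D = punctured_polydisc L' (map snd qs) s"
  have co': "coordinates L' (map fst qs) (map snd qs)"
    unfolding L'_def qs_def by (rule coordinates_slice[OF co ec])
  have dual: "dual_lists es cs" and st: "stable_under (set es) L" using co by (auto simp: coordinates_def)
  have fcs: "\<forall>c\<in>set cs. functional c" using dual_lists_functional[OF dual] by blast
  have c: "c \<in> set cs" "e \<in> set es" using ec by (auto dest: set_zip_leftD set_zip_rightD)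
  have fc: "functional c" using fcs c by blast
  have ce: "c e = 1" by (rule dual_lists_zip_eq[OF dual ec])
  have sub: "set (map fst qs) \<subseteq> set es" by (auto simp: qs_def dest: set_zip_leftD)
  have q_ce: "c' \<in> set cs \<and> c' e = 0" if c': "c' \<in> set (map snd qs)" for c'
  proof -
    obtain p where "p \<in> set qs" "c' = snd p" using c' by auto
    hence e': "(fst p, c') \<in> set (zip es cs)" "(e, c) \<noteq> (fst p, c')"
      by (auto simp: qs_def prod_eq_iff)
    thus ?thesis using dual_lists_zip_neq[OF dual ec e'(1)] set_zip_rightD[OF e'(1)] by blast
  qed
  have cs_split: "c' = c \<or> c' \<in> set (map snd qs)" if c': "c' \<in> set cs" for c'
  proof -
    obtain e' where "(e', c') \<in> set (zip es cs)"
      using set_zip_snd[OF dual_lists_length[OF dual] c'] by blast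
    thus ?thesis by (force simp: qs_def)
  qed
  have eL: "u + z *s e \<in> L \<longleftrightarrow> u \<in> L" for u z by (rule stable_under_iff[OF st c(2)])
  have lineval: "c (a + z *s e) = z" "\<And>c'. c' \<in> set (map snd qs) \<Longrightarrow> c' (a + z *s e) = c' a"
    "a \<in> L" if a: "a \<in> D" for a z
  proof -
    have a': "a \<in> L" "c a = 0" using a by (auto simp: D_def L'_def punctured_polydisc_def)
    show "a \<in> L" by (rule a')
    show "c (a + z *s e) = z" using fc ce a' by (simp add: functional_simps)
    fix c' assume c': "c' \<in> set (map snd qs)"
    hence "functional c'" "c' e = 0" using q_ce[OF c'] fcs by auto
    thus "c' (a + z *s e) = c' a" by (simp add: functional_simps)
  qed
  have D_ball: "c' a \<in> ball 0 s - {0}" if "a \<in> D" "c' \<in> set (map snd qs)" for a c'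
    using that unfolding D_def punctured_polydisc_def by blast
  have onY: "a + z *s e \<in> Y" if a: "a \<in> D" and z: "z \<in> ball 0 s - {0}" for a z
  proof -
    have "c' (a + z *s e) \<in> ball 0 s - {0}" if "c' \<in> set cs" for c'
      using cs_split[OF that] lineval(1,2)[OF a] D_ball[OF a] z by metis
    thus ?thesis using lineval(3)[OF a] eL unfolding Y_def punctured_polydisc_def by blast
  qed
  have onP: "a + z *s e \<in> P" if a: "a \<in> D" and z: "z \<in> ball 0 s" for a z
  proof -
    have "c' (a + z *s e) \<in> ball 0 s" if "c' \<in> set cs" for c'
      using cs_split[OF that] lineval(1,2)[OF a] D_ball[OF a] z by (metis Diff_iff)
    thus ?thesis using lineval(3)[OF a] eL unfolding P_def polydisc_def by blast
  qed
  have toD: "u - c u *s e \<in> D" if u: "u \<in> Y" for u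
  proof -
    have "u + (- c u) *s e \<in> L" unfolding eL using u by (simp add: Y_def punctured_polydisc_def)
    moreover have "u + (- c u) *s e = u - c u *s e" by (simp add: vec_eq_iff)
    ultimately have "u - c u *s e \<in> L'" unfolding L'_def using fc ce by (simp add: functional_simps)
    moreover have "c' (u - c u *s e) \<in> ball 0 s - {0}" if "c' \<in> set (map snd qs)" for c'
    proof -
      have "functional c'" "c' e = 0" "c' \<in> set cs" using q_ce[OF that] fcs by auto
      hence "c' (u - c u *s e) = c' u" by (simp add: functional_simps)
      moreover have "c' u \<in> ball 0 s - {0}"
        using u \<open>c' \<in> set cs\<close> unfolding Y_def punctured_polydisc_def by blast
      ultimately show ?thesis by simp
    qed
    ultimately show ?thesis unfolding D_def punctured_polydisc_def by blast
  qed
  have holf: "(\<lambda>z. f (a + z *s e)) holomorphic_on ball 0 s - {0}" if "a \<in> D" for a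
  proof (rule holomorphic_on_subset)
    show "(\<lambda>z. f (a + z *s e)) holomorphic_on {z. a + z *s e \<in> Y}"
      using sepf c(2) unfolding separately_holomorphic_def Y_def by blast
  qed (use onY[OF that] in blast)
  have holP: "(\<lambda>z. F (a + z *s e)) holomorphic_on ball 0 s"
    if "a \<in> D" "separately_holomorphic (set es) P F" for a F
  proof (rule holomorphic_on_subset)
    show "(\<lambda>z. F (a + z *s e)) holomorphic_on {z. a + z *s e \<in> P}"
      using that c(2) unfolding separately_holomorphic_def by blast
  qed (use onP[OF that(1)] in blast)
  note holg = holP[OF _ sepg[folded P_def]] and holh = holP[OF _ seph[folded P_def]]
  have circleY: "a + w *s e \<in> Y" "w \<noteq> 0" if "a \<in> D" "norm w = \<bar>\<rho>\<bar>" for a w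
    using onY[OF that(1), of w] that \<rho> by auto
  \<comment> \<open>the Taylor coefficients of the denominator in the direction \<open>e\<close>, as circle integrals that depend continuously on the point\<close>
  define H where "H = (\<lambda>k. dir_mean e \<rho> (\<lambda>u. h u / c u ^ Suc k))"
  have H: "H k a = (deriv ^^ k) (\<lambda>z. h (a + z *s e)) 0 / fact k" if a: "a \<in> D" for k a
  proof -
    have "((\<lambda>z. h (a + z *s e) / (z - 0) ^ Suc k) has_contour_integral
        of_real (2 * pi) * \<i> / fact k * (deriv ^^ k) (\<lambda>z. h (a + z *s e)) 0) (circlepath 0 \<rho>)"
    proof (rule Cauchy_has_contour_integral_higher_derivative_circlepath)
      have "cball 0 \<rho> \<subseteq> ball (0::complex) s" using \<rho> by auto
      thus "continuous_on (cball 0 \<rho>) (\<lambda>z. h (a + z *s e))"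
        "(\<lambda>z. h (a + z *s e)) holomorphic_on ball 0 \<rho>"
        using holh[OF a] \<rho> by (auto intro!: holomorphic_on_imp_continuous_on elim: holomorphic_on_subset)
    qed (use \<rho> in auto)
    thus ?thesis
      by (simp add: H_def dir_mean_def circle_mean_def lineval(1)[OF a] contour_integral_unique)
  qed
  define u0 where "u0 = y - c y *s e"
  have u0: "u0 \<in> D" unfolding u0_def by (rule toD) (use y(1) in \<open>simp add: Y_def\<close>)
  have "\<exists>k. H k u0 \<noteq> 0"
  proof (rule ccontr)
    assume "\<not> ?thesis"
    hence *: "(deriv ^^ k) (\<lambda>z. h (u0 + z *s e)) 0 = 0" for k using H[OF u0, of k] by simp
    have "c y \<in> ball 0 s" using y(1) c(1) unfolding punctured_polydisc_def by blast
    from holomorphic_fun_eq_0_on_ball[OF holh[OF u0] this *] show False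
      using y(2) by (simp add: u0_def)
  qed
  then obtain k where k: "H k u0 \<noteq> 0" by blast
  have "continuous_on D (H k)" unfolding H_def
  proof (rule continuous_on_dir_mean)
    show "continuous_on Y (\<lambda>u. h u / c u ^ Suc k)"
    proof (rule continuous_on_divide)
      show "continuous_on Y h"
        by (rule continuous_on_subset[OF conth]) (simp add: Y_def P_def punctured_subset_polydisc)
      show "continuous_on Y (\<lambda>u. c u ^ Suc k)" by (rule continuous_on_power[OF functional_cont[OF fc]])
      show "\<forall>u\<in>Y. c u ^ Suc k \<noteq> 0" using c(1) by (auto simp: Y_def punctured_polydisc_def)
    qed
  qed (use circleY in blast)
  from continuous_on_avoid[OF this u0 k] obtain \<delta> where
    \<delta>: "\<delta> > 0" "\<And>a. a \<in> D \<Longrightarrow> dist u0 a < \<delta> \<Longrightarrow> H k a \<noteq> 0" by blast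
  have "z ^ K * f (a + z *s e) = circle_mean \<rho> (\<lambda>w. w ^ K * f (a + w *s e) / (w - z))"
    if "k \<le> K" and z: "z \<noteq> 0" "norm z < \<rho>" and a: "a \<in> D" for K z a
  proof -
    define \<psi> where "\<psi> = (\<lambda>a. z ^ K * f (a + z *s e) -
        dir_mean e \<rho> (\<lambda>u. c u ^ K * f u / (c u - z)) a)"
    have \<psi>: "\<psi> a = z ^ K * f (a + z *s e) - circle_mean \<rho> (\<lambda>w. w ^ K * f (a + w *s e) / (w - z))"
      if "a \<in> D" for a
      by (simp add: \<psi>_def dir_mean_def lineval(1)[OF that])
    have zs: "z \<in> ball 0 s - {0}" using z \<rho> by auto
    have "\<psi> a = 0"
    proof (rule identity_punctured_polydisc[OF co' _ u0[unfolded D_def] \<delta>(1) _ a[unfolded D_def], folded D_def])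
      fix a assume a: "a \<in> D" "dist u0 a < \<delta>"
      have ne: "(deriv ^^ k) (\<lambda>z. h (a + z *s e)) 0 \<noteq> 0" using \<delta>(2)[OF a] H[OF a(1), of k] by auto
      have "\<exists>B. \<forall>\<^sub>F z in at 0. norm (z ^ K * f (a + z *s e)) \<le> B"
        by (rule quotient_times_power_bounded[OF holg[OF a(1)] holh[OF a(1)] _ ne \<open>k \<le> K\<close>])
          (use \<rho> onY[OF a(1)] quot in \<open>auto simp: Y_def\<close>)
      from Cauchy_formula_removable[OF _ this z \<rho>(2)] show "\<psi> a = 0"
        using holf[OF a(1)] by (simp add: \<psi>[OF a(1)] holomorphic_intros)
    next
      show "separately_holomorphic (set (map fst qs)) D \<psi>"
        unfolding separately_holomorphic_def
      proof (intro ballI allI)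
        fix e' u assume e': "e' \<in> set (map fst qs)"
        define V where "V = {w. u + w *s e' \<in> D}"
        have "open V" unfolding V_def D_def
        proof (rule open_line_punctured_polydisc)
          show "stable_under (set (map fst qs)) L'" using co' by (simp add: coordinates_def)
          show "\<forall>c\<in>set (map snd qs). functional c" using q_ce fcs by blast
        qed (rule e')
        have e'es: "e' \<in> set es" using e' sub by blast
        have "(\<lambda>w. f (u + z *s e + w *s e')) holomorphic_on {w. u + z *s e + w *s e' \<in> Y}"
          using sepf e'es unfolding separately_holomorphic_def Y_def by blast
        hence "(\<lambda>w. f (u + z *s e + w *s e')) holomorphic_on V"
        proof (rule holomorphic_on_subset)
          have "u + z *s e + w *s e' \<in> Y" if "w \<in> V" for w
          proof -
            have "u + w *s e' + z *s e \<in> Y" by (rule onY[OF _ zs]) (use that in \<open>simp add: V_def\<close>)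
            thus ?thesis by (simp only: add_ac)
          qed
          thus "V \<subseteq> {w. u + z *s e + w *s e' \<in> Y}" by blast
        qed
        hence 1: "(\<lambda>w. f (u + w *s e' + z *s e)) holomorphic_on V" by (simp add: algebra_simps)
        \<comment> \<open>the Cauchy kernel has its pole where the coordinate equals \<open>z\<close>\<close>
        define Y1 where "Y1 = {u \<in> Y. c u \<noteq> z}"
        have Y1c: "\<forall>u\<in>Y1. c u - z \<noteq> 0" by (simp add: Y1_def)
        have 2: "(\<lambda>w. dir_mean e \<rho> (\<lambda>u. c u ^ K * f u / (c u - z)) (u + w *s e')) holomorphic_on V"
        proof (rule holomorphic_dir_mean[OF _ _ _ \<open>open V\<close>])
          have "continuous_on Y1 f"
            by (rule continuous_on_subset[OF contf]) (auto simp: Y1_def Y_def)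
          thus "continuous_on Y1 (\<lambda>u. c u ^ K * f u / (c u - z))"
            using Y1c functional_cont[OF fc] by (intro continuous_intros) auto
          show "separately_holomorphic (set es) Y1 (\<lambda>u. c u ^ K * f u / (c u - z))"
            unfolding separately_holomorphic_def
          proof (intro ballI allI)
            fix b v assume b: "b \<in> set es"
            have "(\<lambda>w. f (v + w *s b)) holomorphic_on {w. v + w *s b \<in> Y}"
              using sepf b unfolding separately_holomorphic_def Y_def by blast
            hence "(\<lambda>w. f (v + w *s b)) holomorphic_on {w. v + w *s b \<in> Y1}"
              by (rule holomorphic_on_subset) (auto simp: Y1_def)
            moreover have "(\<lambda>w. c (v + w *s b)) = (\<lambda>w. c v + w * c b)"
              using fc by (simp add: functional_simps fun_eq_iff)
            hence "(\<lambda>w. c (v + w *s b)) holomorphic_on {w. v + w *s b \<in> Y1}"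
              by (simp only:) (intro holomorphic_intros)
            ultimately show "(\<lambda>w. c (v + w *s b) ^ K * f (v + w *s b) / (c (v + w *s b) - z))
                holomorphic_on {w. v + w *s b \<in> Y1}"
              using Y1c by (intro holomorphic_intros) auto
          qed
          show "e' \<in> set es" by (rule e'es)
          fix x w :: complex assume x: "x \<in> V" "norm w = \<bar>\<rho>\<bar>"
          have "u + x *s e' \<in> D" using x by (simp add: V_def)
          from circleY(1)[OF this x(2)] lineval(1)[OF this, of w] show "u + x *s e' + w *s e \<in> Y1"
            using z x(2) \<rho> by (auto simp: Y1_def)
        qed
        show "(\<lambda>w. \<psi> (u + w *s e')) holomorphic_on {w. u + w *s e' \<in> D}"
          unfolding V_def[symmetric] \<psi>_def by (intro holomorphic_intros 1 2)
      qed
    qed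
    thus ?thesis using \<psi>[OF a] by simp
  qed
  thus ?thesis using toD unfolding Y_def by blast
qed

lemma combine_in_torus:
  assumes "length zs = length es" "\<forall>z\<in>set zs. norm z = \<bar>\<rho>\<bar>"
  shows "combine zs es \<in> torus (zip es (replicate (length es) \<rho>)) 0"
  using assms
proof (induction zs es rule: list_induct2)
  case (Cons z zs e es)
  hence "combine zs es \<in> torus (zip es (replicate (length es) \<rho>)) 0" "norm z = \<bar>\<rho>\<bar>" by auto
  moreover have "combine (z # zs) (e # es) = combine zs es + z *s e" by (simp add: combine_Cons)
  ultimately show ?case by auto
qed (simp add: combine_def)

lemma compact_torus: "compact (torus ps u)"
proof (induction ps)
  case (Cons p ps)
  obtain b r where p: "p = (b, r)" by force
  have "torus (p # ps) u = (\<lambda>x. fst x + snd x *s b) ` (torus ps u \<times> sphere 0 \<bar>r\<bar>)"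
    by (force simp: p image_def)
  moreover have "compact ((\<lambda>x. fst x + snd x *s b) ` (torus ps u \<times> sphere 0 \<bar>r\<bar>))"
    by (intro compact_continuous_image compact_Times Cons.IH compact_sphere continuous_intros)
  ultimately show ?case by simp
qed simp

lemma prod_list_norms:
  "dual_lists es cs \<Longrightarrow> prod_list (norms cs u) = (\<Prod>p\<in>set (zip es cs). norm (snd p u))"
proof (induction es cs rule: dual_lists.induct)
  case (2 e es c cs)
  have "(e, c) \<notin> set (zip es cs)" using 2(2) by (auto dest: set_zip_leftD)
  thus ?case using 2 by (simp add: norms_Cons)
qed (auto simp: norms_Nil)

text \<open>
  Multiply \<open>f\<close> by a power of the product of the coordinates that is large enough in each of the
  directions. By the Cauchy formula in one coordinate, its values for small values of this coordinate
  are at most twice its maximum on the circle of radius \<open>\<rho>\<close>. Doing this for one coordinate after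
  the other bounds it by its maximum on the compact torus where all coordinates have absolute value
  \<open>\<rho>\<close>. The list \<open>ps\<close> collects the coordinates already allowed to be small.
\<close>

lemma moderate_growth:
  fixes f :: "complex ^ 'v \<Rightarrow> complex"
  assumes co: "coordinates L es cs" and "s > 0"
    and sepf: "separately_holomorphic (set es) (punctured_polydisc L cs s) f"
    and contf: "continuous_on (punctured_polydisc L cs s) f"
    and sepg: "separately_holomorphic (set es) (polydisc L cs s) g"
    and seph: "separately_holomorphic (set es) (polydisc L cs s) h"
    and conth: "continuous_on (polydisc L cs s) h"
    and y: "y \<in> punctured_polydisc L cs s" "h y \<noteq> 0"
    and quot: "\<And>y. y \<in> punctured_polydisc L cs s \<Longrightarrow> h y \<noteq> 0 \<Longrightarrow> f y = g y / h y"
  shows "\<exists>K C s'. 0 < s' \<and> s' < s \<and>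
    (\<forall>u\<in>punctured_polydisc L cs s'. norm (f u) * prod_list (norms cs u) ^ K \<le> C)"
proof -
  have dual: "dual_lists es cs" and st: "stable_under (set es) L"
    and span: "\<And>u. u \<in> L \<Longrightarrow> u = combine (map (\<lambda>c. c u) cs) es"
    using co by (auto simp: coordinates_def)
  have len: "length es = length cs" by (rule dual_lists_length[OF dual])
  define S where "S = set (zip es cs)"
  define Y where "Y = punctured_polydisc L cs s"
  define \<rho> where "\<rho> = s / 2"
  have \<rho>: "0 < \<rho>" "\<rho> < s" using \<open>s > 0\<close> by (auto simp: \<rho>_def)
  define pole where "pole = (\<lambda>K (e, c). \<forall>u\<in>Y. \<forall>z. z \<noteq> 0 \<and> norm z < \<rho> \<longrightarrow>
     z ^ K * f (u - c u *s e + z *s e) =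
       circle_mean \<rho> (\<lambda>w. w ^ K * f (u - c u *s e + w *s e) / (w - z)))"
  have "\<forall>p\<in>S. \<exists>k. \<forall>K\<ge>k. pole K p"
  proof
    fix p assume "p \<in> S"
    then obtain e c where p: "p = (e, c)" "(e, c) \<in> set (zip es cs)" by (cases p) (auto simp: S_def)
    from finite_pole_order_in_direction[OF co p(2) \<rho> sepf contf sepg seph conth y quot]
    show "\<exists>k. \<forall>K\<ge>k. pole K p" unfolding p(1) pole_def Y_def prod.case .
  qed
  then obtain k where k: "\<And>p K. p \<in> S \<Longrightarrow> K \<ge> k p \<Longrightarrow> pole K p"
    using bchoice[of S "\<lambda>p k. \<forall>K\<ge>k. pole K p"] by blast
  \<comment> \<open>one exponent for all directions\<close>
  define K where "K = sum k S"
  have pole: "pole K p" if "p \<in> S" for p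
    using that by (intro k) (auto simp: K_def S_def intro: member_le_sum)
  have snds: "c \<in> set cs \<Longrightarrow> \<exists>e. (e, c) \<in> S" for c
    unfolding S_def by (rule set_zip_snd[OF len])
  have fin: "finite S" by (simp add: S_def)
  define N where "N = (\<lambda>u. \<Prod>p\<in>S. norm (snd p u))"
  have N: "prod_list (norms cs u) = N u" for u by (simp add: N_def S_def prod_list_norms[OF dual])
  define T where "T = torus (zip es (replicate (length es) \<rho>)) 0"
  have TY: "norm (c u) = \<rho>" "u \<in> L" if "u \<in> T" "c \<in> set cs" for u c
  proof -
    have "norms cs u = map abs (replicate (length es) \<rho>) \<and> u \<in> L"
      using torus_norms[OF dual _ that(1)[unfolded T_def] st] by simp
    hence "norm (c u) \<in> set (map abs (replicate (length es) \<rho>))" "u \<in> L"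
      using that(2) unfolding norms_def by (metis image_eqI list.set_map, blast)
    thus "norm (c u) = \<rho>" "u \<in> L" using \<rho> by auto
  qed
  have TL: "T \<subseteq> L" using torus_norms[OF dual _ _ st, of "replicate (length es) \<rho>"] by (auto simp: T_def)
  have "T \<subseteq> Y"
  proof
    fix u assume u: "u \<in> T"
    have "c u \<in> ball 0 s - {0}" if "c \<in> set cs" for c using TY(1)[OF u that] \<rho> by auto
    thus "u \<in> Y" using u TL unfolding Y_def punctured_polydisc_def by blast
  qed
  hence "compact (f ` T)"
    using contf compact_torus unfolding T_def Y_def
    by (intro compact_continuous_image) (auto intro: continuous_on_subset)
  then obtain B where B: "\<And>u. u \<in> T \<Longrightarrow> norm (f u) \<le> B"
    by (meson bounded_iff compact_imp_bounded image_eqI)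
  have "\<exists>C. \<forall>u\<in>Y. (\<forall>(e, c)\<in>S. if (e, c) \<in> set ps then norm (c u) < \<rho> / 2 else norm (c u) = \<rho>) \<longrightarrow>
      norm (f u) * N u ^ K \<le> C" for ps
  proof (induction ps)
    case Nil
    show ?case
    proof (intro exI ballI impI)
      fix u assume u: "u \<in> Y" "\<forall>(e, c)\<in>S. if (e, c) \<in> set [] then norm (c u) < \<rho> / 2 else norm (c u) = \<rho>"
      hence n: "norm (c u) = \<rho>" if "(e, c) \<in> S" for e c using that by auto
      have "u \<in> L" using u(1) by (simp add: Y_def punctured_polydisc_def)
      moreover have "combine (map (\<lambda>c. c u) cs) es \<in> T"
        unfolding T_def
      proof (rule combine_in_torus)
        have "norm (c u) = \<rho>" if "c \<in> set cs" for c using snds[OF that] n by blast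
        thus "\<forall>z\<in>set (map (\<lambda>c. c u) cs). norm z = \<bar>\<rho>\<bar>" using \<rho> by simp
      qed (simp add: len)
      ultimately have "u \<in> T" using span[of u] by simp
      hence "norm (f u) \<le> B" by (rule B)
      moreover have "N u = (\<Prod>p\<in>S. \<rho>)" unfolding N_def using n by (intro prod.cong) auto
      ultimately show "norm (f u) * N u ^ K \<le> B * (\<Prod>p\<in>S. \<rho>) ^ K"
        using \<rho> by (auto intro!: mult_right_mono)
    qed
  next
    case (Cons p ps)
    then obtain C where C: "\<And>u. u \<in> Y \<Longrightarrow>
        (\<forall>(e, c)\<in>S. if (e, c) \<in> set ps then norm (c u) < \<rho> / 2 else norm (c u) = \<rho>) \<Longrightarrow>
        norm (f u) * N u ^ K \<le> C" by blast
    show ?case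
    proof (cases "p \<in> S \<and> p \<notin> set ps")
      case False
      thus ?thesis by (intro exI[of _ C] ballI impI C) (auto split: if_splits)
    next
      case True
      obtain e c where p: "p = (e, c)" by force
      have ec: "(e, c) \<in> set (zip es cs)" "(e, c) \<in> S" using True by (auto simp: p S_def)
      show ?thesis
      proof (intro exI ballI impI)
        fix u assume u: "u \<in> Y" and
          ub: "\<forall>(e, c)\<in>S. if (e, c) \<in> set (p # ps) then norm (c u) < \<rho> / 2 else norm (c u) = \<rho>"
        define R where "R = (\<Prod>p\<in>S - {(e, c)}. norm (snd p u))"
        have "norm (snd p u) > 0" if "p \<in> S" for p
        proof -
          have "snd p \<in> set cs" using that by (cases p) (auto simp: S_def dest: set_zip_rightD)
          thus ?thesis using u by (auto simp: Y_def punctured_polydisc_def)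
        qed
        hence "R > 0" unfolding R_def by (intro prod_pos) auto
        have cu: "norm (c u) < \<rho> / 2" "c u \<noteq> 0"
          using bspec[OF ub ec(2)] u set_zip_rightD[OF ec(1)]
          by (auto simp: p Y_def punctured_polydisc_def)
        have Nu: "N u = norm (c u) * R"
          unfolding N_def R_def using prod.remove[OF fin ec(2), of "\<lambda>p. norm (snd p u)"] by simp
        have bd: "norm (f (u - c u *s e + w *s e)) * (\<rho> * R) ^ K \<le> C" if w: "norm w = \<rho>" for w
        proof -
          define v where "v = u + (w - c u) *s e"
          have v: "u - c u *s e + w *s e = v" by (simp add: v_def algebra_simps vector_sub_rdistrib)
          have "w \<in> ball 0 s - {0}" using w \<rho> by auto
          note line = punctured_polydisc_line[OF co ec(1) u[unfolded Y_def] this, folded v_def Y_def]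
          have "norm (f v) * N v ^ K \<le> C"
          proof (rule C[OF line(1)], clarify)
            fix e' c' assume e': "(e', c') \<in> S"
            show "if (e', c') \<in> set ps then norm (c' v) < \<rho> / 2 else norm (c' v) = \<rho>"
            proof (cases "(e', c') = (e, c)")
              case True
              thus ?thesis using line(2) w \<open>p \<in> S \<and> p \<notin> set ps\<close> by (auto simp: p)
            next
              case False
              hence "c' v = c' u" using line(3)[of e' c'] e' by (simp add: S_def)
              thus ?thesis using bspec[OF ub e'] False by (auto simp: p split: if_splits)
            qed
          qed
          moreover have "N v = \<rho> * R"
          proof -
            have "(\<Prod>p\<in>S - {(e, c)}. norm (snd p v)) = R" unfolding R_def
            proof (rule prod.cong[OF refl])
              fix q assume "q \<in> S - {(e, c)}"
              thus "norm (snd q v) = norm (snd q u)" using line(3)[of "fst q" "snd q"]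
                by (auto simp: S_def)
            qed
            thus ?thesis unfolding N_def
              using prod.remove[OF fin ec(2), of "\<lambda>p. norm (snd p v)"] line(2) w by simp
          qed
          ultimately show ?thesis by (simp add: v)
        qed
        have cont: "continuous_on (sphere 0 \<rho>) (\<lambda>w. f (u - c u *s e + w *s e))"
        proof (rule continuous_on_compose2[OF contf])
          show "(\<lambda>w. u - c u *s e + w *s e) ` sphere 0 \<rho> \<subseteq> punctured_polydisc L cs s"
          proof clarify
            fix w :: complex assume "w \<in> sphere 0 \<rho>"
            hence "w \<in> ball 0 s - {0}" using \<rho> by auto
            from punctured_polydisc_line(1)[OF co ec(1) u[unfolded Y_def] this]
            show "u - c u *s e + w *s e \<in> punctured_polydisc L cs s"
              by (simp add: algebra_simps vector_sub_rdistrib)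
          qed
        qed (intro continuous_intros)
        have "c u ^ K * f (u - c u *s e + c u *s e) =
            circle_mean \<rho> (\<lambda>w. w ^ K * f (u - c u *s e + w *s e) / (w - c u))"
        proof -
          have "c u \<noteq> 0 \<and> norm (c u) < \<rho>" using cu \<rho> by simp
          thus ?thesis using pole[OF ec(2)] u unfolding pole_def prod.case by blast
        qed
        moreover have "norm (circle_mean \<rho> (\<lambda>w. w ^ K * f (u - c u *s e + w *s e) / (w - c u)))
            \<le> \<rho> * (C / R ^ K / (\<rho> / 2))"
        proof (rule circle_mean_bound[OF \<rho>(1)])
          show "continuous_on (sphere 0 \<rho>) (\<lambda>w. w ^ K * f (u - c u *s e + w *s e) / (w - c u))"
            using cu \<rho> by (intro continuous_intros cont) auto
          fix w :: complex assume w: "norm w = \<rho>"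
          have "\<rho> / 2 \<le> norm (w - c u)" using norm_triangle_ineq2[of w "c u"] w cu by linarith
          moreover have "norm (w ^ K * f (u - c u *s e + w *s e)) \<le> C / R ^ K"
            using bd[OF w] \<open>R > 0\<close> w
            by (simp add: norm_mult norm_power power_mult_distrib pos_le_divide_eq mult_ac)
          ultimately show "norm (w ^ K * f (u - c u *s e + w *s e) / (w - c u)) \<le> C / R ^ K / (\<rho> / 2)"
            unfolding norm_divide using \<rho> by (intro frac_le) (auto intro: order_trans[OF norm_ge_zero])
        qed
        ultimately have "norm (c u ^ K * f u) \<le> 2 * C / R ^ K" using \<rho> by (simp add: mult.commute)
        hence "norm (c u ^ K * f u) * R ^ K \<le> 2 * C" using \<open>R > 0\<close> by (simp add: pos_le_divide_eq)
        thus "norm (f u) * N u ^ K \<le> 2 * C"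
          by (simp add: Nu norm_mult norm_power power_mult_distrib mult_ac)
      qed
    qed
  qed
  from this[of "zip es cs"] obtain C where
    C0: "\<forall>u\<in>Y. (\<forall>(e, c)\<in>S. if (e, c) \<in> set (zip es cs) then norm (c u) < \<rho> / 2
      else norm (c u) = \<rho>) \<longrightarrow> norm (f u) * N u ^ K \<le> C" by blast
  have C: "norm (f u) * N u ^ K \<le> C" if "u \<in> Y" "\<forall>(e, c)\<in>S. norm (c u) < \<rho> / 2" for u
  proof (rule C0[rule_format, OF that(1)], clarify)
    fix e c assume "(e, c) \<in> S"
    thus "if (e, c) \<in> set (zip es cs) then norm (c u) < \<rho> / 2 else norm (c u) = \<rho>"
      using that(2) by (auto simp: S_def)
  qed
  have "norm (f u) * prod_list (norms cs u) ^ K \<le> C" if u: "u \<in> punctured_polydisc L cs (\<rho> / 2)" for u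
    unfolding N
  proof (rule C)
    have "c u \<in> ball 0 (\<rho> / 2) - {0}" if "c \<in> set cs" for c
      using u that unfolding punctured_polydisc_def by blast
    hence *: "norm (c u) < \<rho> / 2 \<and> c u \<noteq> 0" if "c \<in> set cs" for c
      using that by auto
    have "c u \<in> ball 0 s - {0}" if "c \<in> set cs" for c
      using *[OF that] \<rho> by auto
    thus "u \<in> Y" using u unfolding Y_def punctured_polydisc_def by blast
    show "\<forall>(e, c)\<in>S. norm (c u) < \<rho> / 2" using * by (auto simp: S_def dest: set_zip_rightD)
  qed
  moreover have "0 < \<rho> / 2" "\<rho> / 2 < s" using \<rho> by auto
  ultimately show ?thesis by blast
qed

section \<open>Iterated residues along a flag\<close>

lemma dual_lists_iff:
  "dual_lists bs cs \<longleftrightarrow> length bs = length cs \<and> (\<forall>c\<in>set cs. functional c) \<and>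
     (\<forall>i<length bs. \<forall>j<length bs. (cs ! j) (bs ! i) = of_bool (i = j))"
proof (induction bs cs rule: dual_lists.induct)
  case (2 b bs c cs)
  have *: "(\<forall>i<length (b # bs). \<forall>j<length (b # bs). ((c # cs) ! j) ((b # bs) ! i) = of_bool (i = j)) \<longleftrightarrow>
      c b = 1 \<and> (\<forall>j<length bs. (cs ! j) b = 0) \<and> (\<forall>i<length bs. c (bs ! i) = 0) \<and>
      (\<forall>i<length bs. \<forall>j<length bs. (cs ! j) (bs ! i) = of_bool (i = j))"
    by (simp add: All_less_Suc2) blast
  have "dual_lists (b # bs) (c # cs) \<longleftrightarrow> functional c \<and> c b = 1 \<and>
      (\<forall>i<length bs. c (bs ! i) = 0) \<and> (\<forall>i<length cs. (cs ! i) b = 0) \<and> dual_lists bs cs"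
    by (simp add: all_set_conv_all_nth)
  thus ?case unfolding * 2 by auto
qed auto

text \<open>
  Index form, needed because the coordinates of a flag are listed in the opposite order.
\<close>

lemma triangular_iff:
  "triangular bs cs \<longleftrightarrow> length bs = length cs \<and>
     (\<forall>i<length bs. (cs ! i) (bs ! i) \<noteq> 0 \<and> (\<forall>j. i < j \<and> j < length bs \<longrightarrow> (cs ! j) (bs ! i) = 0))"
proof (induction bs cs rule: triangular.induct)
  case (1 b bs c cs)
  have "(\<forall>j. 0 < j \<and> j < Suc (length bs) \<longrightarrow> ((c # cs) ! j) b = 0) \<longleftrightarrow> (\<forall>j<length bs. (cs ! j) b = 0)"
    by (auto simp: nth_Cons')
  moreover have "(\<forall>j. Suc i < j \<and> j < Suc (length bs) \<longrightarrow> ((c # cs) ! j) (bs ! i) = 0) \<longleftrightarrow>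
      (\<forall>j. i < j \<and> j < length bs \<longrightarrow> (cs ! j) (bs ! i) = 0)" for i
    by (auto simp: nth_Cons' less_diff_conv)
  ultimately show ?case
    using 1 by (auto simp: All_less_Suc2 all_set_conv_all_nth)
qed auto

lemma dual_lists_rev: "dual_lists bs cs \<Longrightarrow> dual_lists (rev bs) (rev cs)"
  unfolding dual_lists_iff by (auto simp: rev_nth)

text \<open>
  Reversing a wedge list puts the dominating coordinate first, where inductions on \<open>triangular\<close>
  lists need it.
\<close>

lemma wedge_snoc:
  "M \<ge> 1 \<Longrightarrow> wedge M (xs @ [r]) \<Longrightarrow> 0 < r \<and> M * r < 1 \<and> wedge M xs \<and> (\<forall>x\<in>set xs. 0 < x \<and> M * x < r)"
proof (induction xs)
  case (Cons x xs)
  have x: "0 < x" "M * x < lead (xs @ [r])" "wedge M (xs @ [r])" using Cons.prems by auto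
  have IH: "0 < r \<and> M * r < 1 \<and> wedge M xs \<and> (\<forall>x\<in>set xs. 0 < x \<and> M * x < r)"
    using Cons.IH[OF Cons.prems(1) x(3)] .
  have "1 * r \<le> M * r" using IH Cons.prems(1) by (intro mult_right_mono) auto
  hence "r < 1" using IH by linarith
  have "M * x < lead xs \<and> M * x < r"
  proof (cases xs)
    case Nil
    thus ?thesis using x \<open>r < 1\<close> by (simp add: lead_def)
  next
    case (Cons y ys)
    have "1 * y \<le> M * y" using IH \<open>M \<ge> 1\<close> Cons by (intro mult_right_mono) auto
    moreover have "M * y < r" using IH Cons by simp
    moreover have "M * x < y" using x(2) Cons by (simp add: lead_def)
    ultimately show ?thesis using Cons by (simp add: lead_def)
  qed
  thus ?case using IH x by auto
qed (simp add: lead_def)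

lemma norm_functional_torus_le:
  "functional c \<Longrightarrow> length rs = length bs \<Longrightarrow> \<forall>r\<in>set rs. \<bar>r\<bar> \<le> R \<Longrightarrow> u \<in> torus (zip bs rs) 0 \<Longrightarrow>
     norm (c u) \<le> (\<Sum>b\<leftarrow>bs. norm (c b)) * R"
proof (induction bs arbitrary: rs u)
  case (Cons b bs)
  then obtain r rs' where rs: "rs = r # rs'" by (cases rs) auto
  from Cons.prems obtain w z where u: "u = w + z *s b" "w \<in> torus (zip bs rs') 0" "norm z = \<bar>r\<bar>"
    by (auto simp: rs)
  have "norm (c u) \<le> norm (c w) + norm z * norm (c b)"
    using Cons.prems(1) norm_triangle_ineq[of "c w" "z * c b"] by (simp add: u functional_simps norm_mult)
  also have "\<dots> \<le> (\<Sum>b\<leftarrow>bs. norm (c b)) * R + R * norm (c b)"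
    using Cons.IH[of rs' w] Cons.prems u by (intro add_mono mult_right_mono) (auto simp: rs)
  finally show ?case by (simp add: algebra_simps)
qed (simp add: functional_zero)

text \<open>
  All earlier radii are at most \<open>r / M\<close>, so an earlier coordinate shifts the centre of the circle by at
  most \<open>A r / M\<close>, which is less than its radius \<open>|c(b)| r\<close>.
\<close>

lemma dominated_of_wedge:
  assumes "triangular bs cs" "length rs = length bs" "wedge M (rev rs)" "M \<ge> 1"
    and "\<forall>c\<in>set cs. functional c \<and> (\<Sum>b\<leftarrow>bs. norm (c b)) \<le> A"
    and "\<forall>(b, c)\<in>set (zip bs cs). A < M * norm (c b)" and "A < M * s"
  shows "dominated s bs rs cs"
  using assms
proof (induction bs cs arbitrary: rs rule: triangular.induct)
  case (1 b bs c cs)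
  then obtain r rs' where rs: "rs = r # rs'" by (cases rs) auto
  have w: "0 < r" "M * r < 1" "wedge M (rev rs')" "\<And>x. x \<in> set rs' \<Longrightarrow> 0 < x \<and> M * x < r"
    using wedge_snoc[OF 1(5), of "rev rs'" r] 1(4) by (auto simp: rs)
  have fc: "functional c" and A: "(\<Sum>b\<leftarrow>bs. norm (c b)) + norm (c b) \<le> A" using 1(6) by auto
  have A': "(\<Sum>b\<leftarrow>bs. norm (c b)) \<le> A" using A norm_ge_zero[of "c b"] by linarith
  have nn: "0 \<le> (\<Sum>b\<leftarrow>bs. norm (c b))" by (induction bs) auto
  have IH: "dominated s bs rs' cs"
  proof (rule "1.IH")
    show "\<forall>c\<in>set cs. functional c \<and> (\<Sum>b\<leftarrow>bs. norm (c b)) \<le> A"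
    proof
      fix c' assume "c' \<in> set cs"
      hence "functional c' \<and> norm (c' b) + (\<Sum>b\<leftarrow>bs. norm (c' b)) \<le> A" using 1(6) by simp
      thus "functional c' \<and> (\<Sum>b\<leftarrow>bs. norm (c' b)) \<le> A" using norm_ge_zero[of "c' b"] by linarith
    qed
  qed (use 1 w rs in auto)
  have "norm (c u) < norm (c b) * r \<and> norm (c u) + norm (c b) * r < s"
    if u: "u \<in> torus (zip bs rs') 0" for u
  proof -
    have "\<bar>x\<bar> \<le> r / M" if "x \<in> set rs'" for x
      using w(4)[OF that] \<open>M \<ge> 1\<close> by (simp add: pos_le_divide_eq mult.commute)
    hence "norm (c u) \<le> (\<Sum>b\<leftarrow>bs. norm (c b)) * (r / M)"
      using 1(3) u by (intro norm_functional_torus_le[OF fc]) (auto simp: rs)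
    also have "\<dots> \<le> A * (r / M)" using A' w(1) \<open>M \<ge> 1\<close> by (intro mult_right_mono) auto
    finally have le: "norm (c u) \<le> A * (r / M)" .
    have "A < M * norm (c b)" using 1(7) by simp
    hence "A * (r / M) < norm (c b) * r" using w(1) \<open>M \<ge> 1\<close> by (simp add: field_simps)
    moreover have "norm (c u) \<le> (\<Sum>b\<leftarrow>bs. norm (c b)) * r"
    proof -
      have "r / M \<le> r" using w(1) \<open>M \<ge> 1\<close> by (simp add: field_simps)
      with \<open>norm (c u) \<le> (\<Sum>b\<leftarrow>bs. norm (c b)) * (r / M)\<close> nn show ?thesis
        by (meson mult_left_mono order_trans)
    qed
    hence "norm (c u) + norm (c b) * r \<le> A * r"
      using mult_right_mono[OF A, of r] w(1) by (simp add: algebra_simps)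
    moreover have "A * r < s"
    proof -
      have "0 \<le> A" using nn A' by linarith
      hence "A * r * M \<le> A" using w(2) mult_left_mono[of "r * M" 1 A] by (simp add: mult_ac)
      hence "A * r * M < s * M" using \<open>A < M * s\<close> by (simp add: mult.commute)
      thus ?thesis using \<open>M \<ge> 1\<close> by simp
    qed
    ultimately show ?thesis using le by linarith
  qed
  thus ?case using IH w(1) by (simp add: rs)
qed auto

lemma ex_wedge: "M \<ge> 1 \<Longrightarrow> \<exists>rs. length rs = n \<and> wedge M rs"
proof (induction n)
  case (Suc n)
  then obtain rs where rs: "length rs = n" "wedge M rs" by blast
  have "wedge M (lead rs / (2 * M) # rs)"
    using rs lead_pos[OF rs(2)] Suc.prems by simp
  thus ?case using rs by (metis length_Cons)
qed simp

lemma norm_zip_sum_le: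
  assumes "length gs = length bs" "\<forall>x\<in>set (norms gs u). x \<le> R"
  shows "norm (\<Sum>(b, g)\<leftarrow>zip bs gs. g u * c b) \<le> (\<Sum>b\<leftarrow>bs. norm (c b)) * R"
  using assms
proof (induction gs bs rule: list_induct2)
  case (Cons g gs b bs)
  have "norm (\<Sum>(b, g)\<leftarrow>zip (b # bs) (g # gs). g u * c b) \<le>
      norm (g u) * norm (c b) + norm (\<Sum>(b, g)\<leftarrow>zip bs gs. g u * c b)"
    using norm_triangle_ineq[of "g u * c b"] by (simp add: norm_mult)
  also have "\<dots> \<le> R * norm (c b) + (\<Sum>b\<leftarrow>bs. norm (c b)) * R"
    using Cons by (intro add_mono mult_right_mono) (auto simp: norms_Cons)
  finally show ?case by (simp add: algebra_simps)
qed simp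

text \<open>
  On a wedge for the coordinates \<open>g\<close>, a triangular change of coordinates is dominated by its
  diagonal, so that the new coordinates are comparable with the old ones.
\<close>

lemma wedge_coordinate_bounds:
  assumes "triangular bs cs" "length gs = length bs" "wedge M (rev (norms gs u))" "M \<ge> 1"
    and "\<forall>c\<in>set cs. c u = (\<Sum>(b, g)\<leftarrow>zip bs gs. g u * c b)"
    and "\<forall>c\<in>set cs. (\<Sum>b\<leftarrow>bs. norm (c b)) \<le> A"
    and "\<forall>(b, c)\<in>set (zip bs cs). A / M + \<eta> \<le> norm (c b)" "\<eta> > 0"
  shows "(\<forall>c\<in>set cs. norm (c u) \<le> A / M \<and> c u \<noteq> 0) \<and>
    \<eta> ^ length bs * prod_list (norms gs u) \<le> prod_list (norms cs u)"
  using assms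
proof (induction bs cs arbitrary: gs rule: triangular.induct)
  case (1 b bs c cs)
  then obtain g gs' where gs: "gs = g # gs'" by (cases gs) auto
  define r where "r = norm (g u)"
  have w: "0 < r" "M * r < 1" "wedge M (rev (norms gs' u))" "\<And>x. x \<in> set (norms gs' u) \<Longrightarrow> 0 < x \<and> M * x < r"
    using wedge_snoc[OF 1(5), of "rev (norms gs' u)" r] 1(4) by (auto simp: gs norms_Cons r_def)
  have A: "(\<Sum>b\<leftarrow>bs. norm (c b)) + norm (c b) \<le> A" using 1(7) by auto
  have A': "(\<Sum>b\<leftarrow>bs. norm (c b)) \<le> A" using A norm_ge_zero[of "c b"] by linarith
  have IH: "(\<forall>c\<in>set cs. norm (c u) \<le> A / M \<and> c u \<noteq> 0) \<and>
    \<eta> ^ length bs * prod_list (norms gs' u) \<le> prod_list (norms cs u)"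
  proof (rule "1.IH")
    show "\<forall>c\<in>set cs. (\<Sum>b\<leftarrow>bs. norm (c b)) \<le> A"
    proof
      fix c' assume "c' \<in> set cs"
      hence "norm (c' b) + (\<Sum>b\<leftarrow>bs. norm (c' b)) \<le> A" using 1(7) by simp
      thus "(\<Sum>b\<leftarrow>bs. norm (c' b)) \<le> A" using norm_ge_zero[of "c' b"] by linarith
    qed
    show "\<forall>c\<in>set cs. c u = (\<Sum>(b, g)\<leftarrow>zip bs gs'. g u * c b)"
    proof
      fix c' assume c': "c' \<in> set cs"
      hence "c' b = 0" using 1(2) by simp
      moreover have "c' u = (\<Sum>(b, g)\<leftarrow>zip (b # bs) gs. g u * c' b)"
        by (rule bspec[OF 1(6)]) (use c' in simp)
      ultimately show "c' u = (\<Sum>(b, g)\<leftarrow>zip bs gs'. g u * c' b)" by (simp add: gs)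
    qed
  qed (use 1 w gs in auto)
  define t where "t = (\<Sum>(b, g)\<leftarrow>zip bs gs'. g u * c b)"
  have cu: "c u = g u * c b + t" using 1(6) by (simp add: gs t_def)
  have "norm t \<le> (\<Sum>b\<leftarrow>bs. norm (c b)) * (r / M)" unfolding t_def
  proof (rule norm_zip_sum_le)
    show "\<forall>x\<in>set (norms gs' u). x \<le> r / M"
    proof
      fix x assume "x \<in> set (norms gs' u)"
      thus "x \<le> r / M" using w(4)[of x] \<open>M \<ge> 1\<close> by (simp add: pos_le_divide_eq mult.commute)
    qed
  qed (use 1(3) gs in simp)
  also have "\<dots> \<le> A * (r / M)" using A' w(1) \<open>M \<ge> 1\<close> by (intro mult_right_mono) auto
  finally have t: "norm t \<le> A / M * r" by simp
  have "A / M + \<eta> \<le> norm (c b)" using 1(8) by simp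
  hence "(A / M + \<eta>) * r \<le> norm (c b) * r" using w(1) by (intro mult_right_mono) auto
  moreover have "norm (c b) * r \<le> norm (c u) + norm t"
    using norm_triangle_ineq2[of "g u * c b" "- t"] cu by (simp add: norm_mult r_def mult.commute)
  ultimately have ge: "\<eta> * r \<le> norm (c u)" using t by (simp add: algebra_simps)
  have "c u \<noteq> 0" using ge \<open>\<eta> > 0\<close> w(1) by (metis mult_pos_pos norm_zero not_less)
  have "norm (c u) \<le> (\<Sum>b\<leftarrow>b # bs. norm (c b)) * (1 / M)"
  proof -
    have "norm (\<Sum>(b, g)\<leftarrow>zip (b # bs) gs. g u * c b) \<le> (\<Sum>b\<leftarrow>b # bs. norm (c b)) * (1 / M)"
    proof (rule norm_zip_sum_le)
      show "\<forall>x\<in>set (norms gs u). x \<le> 1 / M"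
      proof
        fix x assume "x \<in> set (norms gs u)"
        hence "x = r \<or> x \<in> set (norms gs' u)" by (auto simp: gs norms_Cons r_def)
        moreover have "r \<le> 1 / M" using w(2) \<open>M \<ge> 1\<close> by (simp add: pos_le_divide_eq mult.commute)
        moreover have "x \<le> r" if "x \<in> set (norms gs' u)"
        proof -
          have "1 * x \<le> M * x" using w(4)[OF that] \<open>M \<ge> 1\<close> by (intro mult_right_mono) auto
          thus ?thesis using w(4)[OF that] by linarith
        qed
        ultimately show "x \<le> 1 / M" by auto
      qed
    qed (use 1(3) in simp)
    thus ?thesis using 1(6) by simp
  qed
  also have "\<dots> \<le> A * (1 / M)" using 1(7) \<open>M \<ge> 1\<close> by (intro mult_right_mono) auto
  finally have "norm (c u) \<le> A / M" by simp
  moreover have "\<eta> ^ length (b # bs) * prod_list (norms gs u) \<le> prod_list (norms (c # cs) u)"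
  proof -
    have "0 \<le> prod_list (norms gs' u)" by (induction gs') (auto simp: norms_def)
    hence "(\<eta> * r) * (\<eta> ^ length bs * prod_list (norms gs' u)) \<le> norm (c u) * prod_list (norms cs u)"
      using ge IH \<open>\<eta> > 0\<close> w(1) by (intro mult_mono) auto
    thus ?thesis by (simp add: gs norms_Cons r_def mult_ac)
  qed
  ultimately show ?case using IH \<open>c u \<noteq> 0\<close> by auto
qed (auto simp: norms_def)

lemma functional_sum_list:
  "functional c \<Longrightarrow> c (\<Sum>p\<leftarrow>ps. snd p u *s fst p) = (\<Sum>(b, g)\<leftarrow>ps. g u * c b)"
  by (induction ps) (auto simp: functional_simps)

lemma finite_positive_lower_bound:
  assumes "finite S" "\<forall>x\<in>S. 0 < (f x :: real)"
  shows "\<exists>\<eta>>0. \<forall>x\<in>S. \<eta> \<le> f x"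
  by (rule exI[of _ "Min (insert 1 (f ` S))"]) (use assms in auto)

text \<open>
  The iterated residue in the coordinates \<open>gs\<close>, which are triangular with respect to the coordinates
  \<open>cs\<close>, equals up to the product of the diagonal entries an integral over a torus that refers to
  \<open>cs\<close> only and has equal radii. The constant \<open>M\<close> is chosen so large that the wedge for \<open>gs\<close> lies in
  the punctured polydisc for \<open>cs\<close> and that its tori are dominated.
\<close>

lemma vec_residue_eq_symmetric_torus_mean:
  fixes f :: "complex ^ 'v \<Rightarrow> complex"
  assumes es: "coordinates L es cs" and bs: "coordinates L bs gs"
    and tri: "triangular (rev bs) (rev cs)" and \<rho>: "0 < \<rho>" "\<rho> < s"
    and cont: "continuous_on (punctured_polydisc L cs s) f"
    and sep: "separately_holomorphic (set es \<union> set bs) (punctured_polydisc L cs s) f"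
    and growth: "\<And>u. u \<in> punctured_polydisc L cs s \<Longrightarrow> norm (f u) * prod_list (norms cs u) ^ K \<le> C"
  shows "vec_residue bs f 0 * prod_list (map2 (\<lambda>c b. c b) cs bs) =
    torus_mean (zip es (replicate (length es) \<rho>)) f 0"
proof -
  define Y where "Y = punctured_polydisc L cs s"
  define n where "n = length cs"
  have dual: "dual_lists es cs" and st: "stable_under (set es) L" 
    and span: "\<And>u. u \<in> L \<Longrightarrow> u = combine (map (\<lambda>c. c u) cs) es" using es by (auto simp: coordinates_def)
  have dualb: "dual_lists bs gs" and stb: "stable_under (set bs) L"
    and spanb: "\<And>u. u \<in> L \<Longrightarrow> u = combine (map (\<lambda>c. c u) gs) bs" using bs by (auto simp: coordinates_def)
  have fcs: "\<forall>c\<in>set cs. functional c" using dual_lists_functional[OF dual] by blast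
  have len: "length es = n" "length bs = n" "length gs = n"
    using dual_lists_length[OF dual] dual_lists_length[OF dualb] tri by (auto simp: n_def triangular_iff)
  define A where "A = (\<Sum>c\<in>set cs. \<Sum>b\<leftarrow>bs. norm (c b))"
  have nn: "(\<Sum>b\<leftarrow>bs. norm (c b)) \<ge> 0" for c :: "complex ^ 'v \<Rightarrow> complex" by (induction bs) auto
  have A: "(\<Sum>b\<leftarrow>bs. norm (c b)) \<le> A" if "c \<in> set cs" for c
    unfolding A_def using that nn by (intro member_le_sum) auto
  have "A \<ge> 0" unfolding A_def by (intro sum_nonneg) (use nn in auto)
  have "\<exists>\<eta>>0. \<forall>p\<in>set (zip (rev bs) (rev cs)). \<eta> \<le> norm (snd p (fst p))"
  proof (rule finite_positive_lower_bound)
    show "\<forall>p\<in>set (zip (rev bs) (rev cs)). 0 < norm (snd p (fst p))"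
      using tri by (auto simp: triangular_iff set_zip)
  qed simp
  then obtain \<eta>' where \<eta>': "\<eta>' > 0" "\<And>p. p \<in> set (zip (rev bs) (rev cs)) \<Longrightarrow> \<eta>' \<le> norm (snd p (fst p))"
    by blast
  \<comment> \<open>half of the smallest diagonal entry: one half pays for the off-diagonal terms\<close>
  define \<eta> where "\<eta> = \<eta>' / 2"
  have "\<eta> > 0" using \<eta>' by (simp add: \<eta>_def)
  have \<eta>: "2 * \<eta> \<le> norm (c b)" if "(b, c) \<in> set (zip (rev bs) (rev cs))" for b c
    using \<eta>'(2)[OF that] by (simp add: \<eta>_def)
  have "s > 0" using \<rho> by linarith
  \<comment> \<open>the three summands ensure \<open>M \<ge> 1\<close>, \<open>A < M \<eta>\<close> and \<open>A < M s\<close>\<close>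
  define M where "M = 1 + A / \<eta> + A / s"
  have "M \<ge> 1" using \<open>A \<ge> 0\<close> \<open>\<eta> > 0\<close> \<open>s > 0\<close> by (simp add: M_def)
  have "M * \<eta> = \<eta> + A + A / s * \<eta>" using \<open>\<eta> > 0\<close> by (simp add: M_def field_simps)
  moreover have "A / s * \<eta> \<ge> 0" using \<open>A \<ge> 0\<close> \<open>\<eta> > 0\<close> \<open>s > 0\<close> by simp
  ultimately have M\<eta>: "A < M * \<eta>" using \<open>\<eta> > 0\<close> by linarith
  have "M * s = s + A / \<eta> * s + A" using \<open>s > 0\<close> by (simp add: M_def field_simps)
  moreover have "A / \<eta> * s \<ge> 0" using \<open>A \<ge> 0\<close> \<open>\<eta> > 0\<close> \<open>s > 0\<close> by simp
  ultimately have Ms: "A < M * s" using \<open>s > 0\<close> by linarith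
  define X where "X = wedge_domain L gs M"
  have bounds: "u \<in> Y \<and> \<eta> ^ n * prod_list (norms gs u) \<le> prod_list (norms cs u)" if u: "u \<in> X" for u
  proof -
    have uL: "u \<in> L" and w: "wedge M (norms gs u)" using u by (auto simp: X_def wedge_domain_def)
    have "(\<forall>c\<in>set (rev cs). norm (c u) \<le> A / M \<and> c u \<noteq> 0) \<and>
        \<eta> ^ length (rev bs) * prod_list (norms (rev gs) u) \<le> prod_list (norms (rev cs) u)"
    proof (rule wedge_coordinate_bounds[OF tri])
      show "wedge M (rev (norms (rev gs) u))" using w by (simp add: norms_def rev_map)
      show "\<forall>c\<in>set (rev cs). c u = (\<Sum>(b, g)\<leftarrow>zip (rev bs) (rev gs). g u * c b)"
      proof
        fix c assume "c \<in> set (rev cs)"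
        hence "functional c" using fcs by simp
        have "u = (\<Sum>p\<leftarrow>zip bs gs. snd p u *s fst p)"
          using spanb[OF uL] combine_zip[of bs gs u] len by simp
        hence "c u = c (\<Sum>p\<leftarrow>zip bs gs. snd p u *s fst p)" by simp
        also have "\<dots> = (\<Sum>(b, g)\<leftarrow>zip bs gs. g u * c b)"
          by (rule functional_sum_list) fact
        also have "\<dots> = (\<Sum>(b, g)\<leftarrow>rev (zip bs gs). g u * c b)"
          by (simp only: rev_map[symmetric] sum_list_rev)
        finally show "c u = (\<Sum>(b, g)\<leftarrow>zip (rev bs) (rev gs). g u * c b)"
          using len by (simp add: zip_rev)
      qed
      show "\<forall>c\<in>set (rev cs). (\<Sum>b\<leftarrow>rev bs. norm (c b)) \<le> A"
        using A by (simp add: rev_map[symmetric] sum_list_rev)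
      show "\<forall>(b, c)\<in>set (zip (rev bs) (rev cs)). A / M + \<eta> \<le> norm (c b)"
      proof clarify
        fix b c assume "(b, c) \<in> set (zip (rev bs) (rev cs))"
        moreover have "A / M \<le> \<eta>" using M\<eta> \<open>M \<ge> 1\<close> by (simp add: pos_divide_le_eq mult.commute)
        ultimately show "A / M + \<eta> \<le> norm (c b)" using \<eta>[of b c] by linarith
      qed
    qed (use len \<open>M \<ge> 1\<close> \<open>\<eta> > 0\<close> in auto)
    hence *: "\<forall>c\<in>set cs. norm (c u) \<le> A / M \<and> c u \<noteq> 0"
      and p: "\<eta> ^ n * prod_list (norms (rev gs) u) \<le> prod_list (norms (rev cs) u)"
      using len by auto
    have "A / M < s" using Ms \<open>M \<ge> 1\<close> by (simp add: pos_divide_less_eq mult.commute)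
    hence "c u \<in> ball 0 s - {0}" if "c \<in> set cs" for c using bspec[OF * that] by auto
    hence "u \<in> Y" using uL unfolding Y_def punctured_polydisc_def by blast
    moreover have "prod_list (norms (rev xs) u) = prod_list (norms xs u)" for xs :: "(complex ^ 'v \<Rightarrow> complex) list"
      unfolding norms_def by (induction xs) (simp_all add: mult.commute)
    ultimately show ?thesis using p by simp
  qed
  obtain rs where rs: "length rs = n" "wedge M rs" using ex_wedge[OF \<open>M \<ge> 1\<close>] by blast
  have "vec_residue bs f 0 = torus_mean (zip bs rs) f 0"
  proof (rule vec_residue_eq_torus_mean[OF dualb stb \<open>M \<ge> 1\<close>])
    show "continuous_on (wedge_domain L gs M) f"
      by (rule continuous_on_subset[OF cont]) (use bounds in \<open>auto simp: X_def Y_def\<close>)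
    show "separately_holomorphic (set bs) (wedge_domain L gs M) f"
      unfolding separately_holomorphic_def
    proof (intro ballI allI)
      fix b u assume "b \<in> set bs"
      hence "(\<lambda>z. f (u + z *s b)) holomorphic_on {z. u + z *s b \<in> Y}"
        using sep unfolding separately_holomorphic_def Y_def by blast
      thus "(\<lambda>z. f (u + z *s b)) holomorphic_on {z. u + z *s b \<in> wedge_domain L gs M}"
        by (rule holomorphic_on_subset) (use bounds in \<open>auto simp: X_def\<close>)
    qed
    fix u assume "u \<in> wedge_domain L gs M"
    hence u: "u \<in> X" by (simp add: X_def)
    have "prod_list (norms gs u) > 0"
      using u wedge_le_1(2)[OF _ \<open>M \<ge> 1\<close>, of "norms gs u"] prod_list_le_1[of "norms gs u"]
      by (auto simp: X_def wedge_domain_def)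
    hence "norm (f u) * (\<eta> ^ n * prod_list (norms gs u)) ^ K \<le> norm (f u) * prod_list (norms cs u) ^ K"
      using bounds[OF u] \<open>\<eta> > 0\<close> by (intro mult_left_mono power_mono) auto
    also have "\<dots> \<le> C" using growth[of u] bounds[OF u] by (simp add: Y_def)
    finally have "norm (f u) * prod_list (norms gs u) ^ K * (\<eta> ^ n) ^ K \<le> C"
      by (simp add: power_mult_distrib mult_ac)
    thus "norm (f u) * prod_list (norms gs u) ^ K \<le> C / (\<eta> ^ n) ^ K"
      using \<open>\<eta> > 0\<close> by (simp add: pos_le_divide_eq)
  qed (use rs len in auto)
  moreover have dom: "dominated s (rev bs) (rev rs) (rev cs)"
  proof (rule dominated_of_wedge[OF tri _ _ \<open>M \<ge> 1\<close> _ _ Ms])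
    show "\<forall>c\<in>set (rev cs). functional c \<and> (\<Sum>b\<leftarrow>rev bs. norm (c b)) \<le> A"
      using A fcs by (simp add: rev_map[symmetric] sum_list_rev)
    show "\<forall>(b, c)\<in>set (zip (rev bs) (rev cs)). A < M * norm (c b)"
    proof clarify
      fix b c assume "(b, c) \<in> set (zip (rev bs) (rev cs))"
      hence "\<eta> \<le> norm (c b)" using \<eta>[of b c] \<open>\<eta> > 0\<close> by simp
      hence "M * \<eta> \<le> M * norm (c b)" using \<open>M \<ge> 1\<close> by (intro mult_left_mono) auto
      thus "A < M * norm (c b)" using M\<eta> by linarith
    qed
  qed (use rs len in auto)
  have Yrev: "punctured_polydisc L (rev cs) s = Y" by (simp add: punctured_polydisc_def Y_def)
  have "torus (zip (rev bs) (rev rs)) 0 \<subseteq> Y"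
    using torus_in_punctured_polydisc[OF tri dom, of L] stb fcs by (auto simp: Yrev)
  hence "torus_mean (zip (rev bs) (rev rs)) f 0 = torus_mean (zip bs rs) f 0"
    using rs len cont
    by (intro conjunct1[OF torus_mean_perm] continuous_on_subset[OF cont]) (auto simp: zip_rev Y_def)
  moreover have "torus_mean (zip (rev bs) (rev rs)) f 0 * prod_list (map2 (\<lambda>c b. c b) (rev cs) (rev bs)) =
      torus_mean (zip (rev es) (replicate (length (rev es)) \<rho>)) f 0"
  proof (rule torus_mean_change_basis[OF dual_lists_rev[OF dual] tri dom _ _ _ _ _ \<rho>, of L])
    show "separately_holomorphic (set (rev es)) (punctured_polydisc L (rev cs) s) f"
      using sep unfolding Yrev separately_holomorphic_def Y_def by simp
    show "depends_on L (rev cs) f"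
      unfolding depends_on_def
    proof (intro ballI impI)
      fix u u' assume u: "u \<in> L" "u' \<in> L" "\<forall>c\<in>set (rev cs). c u = c u'"
      hence eq: "map (\<lambda>c. c u) cs = map (\<lambda>c. c u') cs" by simp
      have "u = combine (map (\<lambda>c. c u') cs) es" using span[OF u(1)] unfolding eq .
      also have "\<dots> = u'" using span[OF u(2)] by (rule sym)
      finally show "f u = f u'" by simp
    qed
  qed (use st stb cont in \<open>auto simp: Yrev Y_def\<close>)
  moreover have "prod_list (map2 (\<lambda>c b. c b) (rev cs) (rev bs)) = prod_list (map2 (\<lambda>c b. c b) cs bs)"
  proof -
    have "prod_list (rev xs) = prod_list xs" for xs :: "complex list"
      by (induction xs) (simp_all add: mult.commute)
    thus ?thesis using len by (simp add: zip_rev rev_map[symmetric] n_def)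
  qed
  moreover have "torus_mean (zip es (replicate (length es) \<rho>)) f 0 =
      torus_mean (zip (rev es) (replicate (length (rev es)) \<rho>)) f 0"
  proof (rule conjunct1[OF torus_mean_perm])
    have "zip (rev es) (replicate (length (rev es)) \<rho>) = rev (zip es (replicate (length es) \<rho>))"
      by (subst zip_rev[symmetric]) simp_all
    thus "mset (zip es (replicate (length es) \<rho>)) = mset (zip (rev es) (replicate (length (rev es)) \<rho>))"
      by simp
    have "torus (zip es (replicate (length es) \<rho>)) 0 \<subseteq> Y"
      unfolding Y_def
      using torus_in_punctured_polydisc[OF dual_triangular[OF dual] dual_dominated[OF dual \<rho>] st fcs] by blast
    thus "continuous_on (torus (zip es (replicate (length es) \<rho>)) 0) f"
      using continuous_on_subset[OF cont] by (simp add: Y_def)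
  qed
  ultimately show ?thesis by simp
qed

section \<open>Coordinates given by a basis of weights\<close>

lemma functional_pairing: "functional (pairing \<xi>)"
  unfolding functional_def
proof (intro conjI allI)
  show "pairing \<xi> (u + w) = pairing \<xi> u + pairing \<xi> w" for u w
    by (simp add: pairing_def sum.distrib distrib_left)
  show "pairing \<xi> (a *s u) = a * pairing \<xi> u" for a u
    by (simp add: pairing_def sum_distrib_left mult.left_commute)
  show "continuous_on UNIV (pairing \<xi>)"
    unfolding pairing_def by (intro continuous_on_sum continuous_on_mult_left continuous_on_component continuous_on_id)
qed

lemma pairing_add: "pairing (\<xi> + \<eta>) u = pairing \<xi> u + pairing \<eta> u"
  by (simp add: pairing_def sum.distrib distrib_right)

lemma pairing_scale: "pairing (r *\<^sub>R \<xi>) u = of_real r * pairing \<xi> u"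
  by (simp add: pairing_def sum_distrib_left mult.assoc)

lemma pairing_sum: "pairing (\<Sum>i\<in>I. \<xi> i) u = (\<Sum>i\<in>I. pairing (\<xi> i) u)"
  by (induction I rule: infinite_finite_induct) (simp_all add: pairing_add, simp_all add: pairing_def)

lemma subspace_dual_space: "subspace (dual_space v0)"
  by (auto simp: dual_space_def subspace_def)

lemma axis_in_dual_space: "v \<noteq> v0 \<Longrightarrow> axis v 1 \<in> dual_space v0"
  by (simp add: dual_space_def axis_def)

lemma dual_space_expansion:
  "\<xi> \<in> dual_space v0 \<Longrightarrow> \<xi> = (\<Sum>v\<in>UNIV - {v0}. (\<xi> $ v) *\<^sub>R axis v 1)"
  by (auto simp: vec_eq_iff dual_space_def axis_def if_distrib[of "\<lambda>x. _ * x"] cong: if_cong)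

lemma dim_dual_space: "dim (dual_space (v0 :: 'v::finite)) = CARD('v) - 1"
proof -
  let ?B = "(\<lambda>v. axis v (1::real)) ` (UNIV - {v0})"
  have "?B \<subseteq> (Basis :: (real ^ 'v) set)" by (auto simp: Basis_vec_def)
  hence "independent ?B" using independent_Basis independent_mono by blast
  moreover have "span ?B = dual_space v0"
  proof
    show "span ?B \<subseteq> dual_space v0"
      by (rule span_minimal[OF _ subspace_dual_space]) (auto intro: axis_in_dual_space)
    show "dual_space v0 \<subseteq> span ?B"
    proof
      fix \<xi> :: "real ^ 'v" assume "\<xi> \<in> dual_space v0"
      from dual_space_expansion[OF this] show "\<xi> \<in> span ?B"
        by (metis (no_types, lifting) image_eqI span_base span_scale span_sum)
    qed
  qed
  moreover have "card ?B = CARD('v) - 1"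
    by (subst card_image) (auto simp: inj_on_def axis_eq_axis)
  ultimately show ?thesis by (metis dim_span_eq_card_independent dim_span)
qed

lemma is_basis_length: "is_basis (v0 :: 'v::finite) bs \<Longrightarrow> length bs = CARD('v) - 1"
  unfolding is_basis_def
  by (metis dim_dual_space dim_span_eq_card_independent distinct_card)

lemma cspace_closed: "u \<in> cspace v0 \<Longrightarrow> w \<in> cspace v0 \<Longrightarrow> u + w \<in> cspace v0"
  "u \<in> cspace v0 \<Longrightarrow> z *s u \<in> cspace v0" "0 \<in> cspace v0"
  by (auto simp: cspace_def)

text \<open>
  The vector of the basis dual to \<open>A\<close> that belongs to \<open>b\<close>. It depends only on the set \<open>A\<close>, not on an
  ordering, which makes the torus integral manifestly symmetric.
\<close>

definition dual_vec :: "'v::finite \<Rightarrow> (real ^ 'v) set \<Rightarrow> real ^ 'v \<Rightarrow> complex ^ 'v" where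
  "dual_vec v0 A b = (\<chi> v. if v = v0 then 0 else of_real (representation A (axis v 1) b))"

lemma dual_vec_in_cspace: "dual_vec v0 A b \<in> cspace v0"
  by (simp add: dual_vec_def cspace_def)

lemma pairing_dual_vec:
  assumes "independent A" "span A = dual_space v0" "\<xi> \<in> dual_space v0"
  shows "pairing \<xi> (dual_vec v0 A b) = of_real (representation A \<xi> b)"
proof -
  have mem: "axis v 1 \<in> span A" if "v \<noteq> v0" for v
    unfolding assms(2) by (rule axis_in_dual_space[OF that])
  have "representation A \<xi> b = representation A (\<Sum>v\<in>UNIV - {v0}. (\<xi> $ v) *\<^sub>R axis v 1) b"
    by (rule arg_cong[where f = "\<lambda>x. representation A x b"]) (rule dual_space_expansion[OF assms(3)])
  also have "\<dots> = (\<Sum>v\<in>UNIV - {v0}. representation A ((\<xi> $ v) *\<^sub>R axis v 1) b)"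
  proof (subst representation_sum[OF assms(1)])
    show "(\<xi> $ v) *\<^sub>R axis v 1 \<in> span A" if "v \<in> UNIV - {v0}" for v
      using mem[of v] that by (intro span_scale) auto
  qed (rule refl)
  also have "\<dots> = (\<Sum>v\<in>UNIV - {v0}. \<xi> $ v * representation A (axis v 1) b)"
    using mem by (intro sum.cong refl) (simp add: representation_scale[OF assms(1)])
  finally have "of_real (representation A \<xi> b) =
      (\<Sum>v\<in>UNIV - {v0}. complex_of_real (\<xi> $ v) * of_real (representation A (axis v 1) b))" by simp
  also have "\<dots> = (\<Sum>v\<in>UNIV - {v0}. complex_of_real (\<xi> $ v) * dual_vec v0 A b $ v)"
    by (intro sum.cong refl) (auto simp: dual_vec_def)
  also have "\<dots> = pairing \<xi> (dual_vec v0 A b)"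
    unfolding pairing_def by (rule sum.mono_neutral_left) (auto simp: dual_vec_def)
  finally show ?thesis by simp
qed

lemma combine_component: "combine zs bs $ v = (\<Sum>i<length bs. zs ! i * bs ! i $ v)"
  by (simp add: combine_def)

lemma combine_in_cspace: "\<forall>b\<in>set bs. b \<in> cspace v0 \<Longrightarrow> combine zs bs \<in> cspace v0"
  by (simp add: cspace_def combine_component)

lemma coordinates_of_basis:
  assumes "is_basis v0 \<beta>"
  shows "coordinates (cspace v0) (map (dual_vec v0 (set \<beta>)) \<beta>) (map pairing \<beta>)"
  unfolding coordinates_def
proof (intro conjI ballI)
  have b: "distinct \<beta>" "independent (set \<beta>)" "span (set \<beta>) = dual_space v0"
    using assms by (auto simp: is_basis_def)
  have inV: "\<beta> ! i \<in> dual_space v0" if "i < length \<beta>" for i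
    using b(3) that by (metis nth_mem span_base)
  show "dual_lists (map (dual_vec v0 (set \<beta>)) \<beta>) (map pairing \<beta>)"
    unfolding dual_lists_iff
    using b inV by (auto simp: functional_pairing pairing_dual_vec representation_basis nth_eq_iff_index_eq)
  show "stable_under (set (map (dual_vec v0 (set \<beta>)) \<beta>)) (cspace v0)"
    by (auto simp: stable_under_def cspace_def dual_vec_def)
  fix u assume u: "u \<in> cspace v0"
  have "u $ v = combine (map (\<lambda>c. c u) (map pairing \<beta>)) (map (dual_vec v0 (set \<beta>)) \<beta>) $ v" for v
  proof (cases "v = v0")
    case True
    thus ?thesis using u by (simp add: combine_component cspace_def dual_vec_def)
  next
    case False
    have "axis v 1 \<in> span (set \<beta>)" using b(3) axis_in_dual_space[OF False] by simp
    hence "axis v 1 = (\<Sum>x\<in>set \<beta>. representation (set \<beta>) (axis v 1) x *\<^sub>R x)"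
      using sum_representation_eq[OF b(2), of "axis v 1" "set \<beta>"] by simp
    hence "pairing (axis v 1) u = (\<Sum>x\<in>set \<beta>. of_real (representation (set \<beta>) (axis v 1) x) * pairing x u)"
      by (metis (no_types, lifting) pairing_scale pairing_sum sum.cong)
    also have "\<dots> = (\<Sum>i<length \<beta>. of_real (representation (set \<beta>) (axis v 1) (\<beta> ! i)) * pairing (\<beta> ! i) u)"
      by (rule sum.reindex_bij_betw[OF bij_betw_nth[OF b(1) refl refl], symmetric])
    also have "\<dots> = combine (map (\<lambda>c. c u) (map pairing \<beta>)) (map (dual_vec v0 (set \<beta>)) \<beta>) $ v"
      using False by (simp add: combine_component dual_vec_def mult.commute)
    also have "pairing (axis v 1) u = u $ v"
      by (simp add: pairing_def axis_def if_distrib[of "\<lambda>x. complex_of_real x * _"] cong: if_cong)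
    finally show ?thesis .
  qed
  thus "u = combine (map (\<lambda>c. c u) (map pairing \<beta>)) (map (dual_vec v0 (set \<beta>)) \<beta>)"
    by (simp add: vec_eq_iff)
qed

lemma pairing_combine:
  assumes "is_basis v0 \<beta>" "i < length \<beta>"
  shows "pairing (\<beta> ! i) (combine zs (map (dual_vec v0 (set \<beta>)) \<beta>)) = zs ! i"
proof -
  have dual: "dual_lists (map (dual_vec v0 (set \<beta>)) \<beta>) (map pairing \<beta>)"
    using coordinates_of_basis[OF assms(1)] by (simp add: coordinates_def)
  have "pairing (\<beta> ! i) (\<Sum>j\<in>J. zs ! j *s b j) = (\<Sum>j\<in>J. zs ! j * pairing (\<beta> ! i) (b j))" for b J
    by (induction J rule: infinite_finite_induct)
      (simp_all add: functional_add[OF functional_pairing] functional_smult[OF functional_pairing]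
        functional_zero[OF functional_pairing])
  hence "pairing (\<beta> ! i) (combine zs (map (dual_vec v0 (set \<beta>)) \<beta>)) =
      (\<Sum>j<length \<beta>. zs ! j * pairing (\<beta> ! i) (dual_vec v0 (set \<beta>) (\<beta> ! j)))"
    by (simp add: combine_def)
  also have "\<dots> = (\<Sum>j<length \<beta>. if j = i then zs ! j else 0)"
    using dual assms(2) by (intro sum.cong refl) (auto simp: dual_lists_iff)
  finally show ?thesis using assms(2) by simp
qed

lemma eq_of_pairings:
  assumes "is_basis v0 \<beta>" "u \<in> cspace v0" "w \<in> cspace v0" "\<forall>x\<in>set \<beta>. pairing x u = pairing x w"
  shows "u = w"
proof -
  have s: "\<And>u. u \<in> cspace v0 \<Longrightarrow> u = combine (map (\<lambda>c. c u) (map pairing \<beta>)) (map (dual_vec v0 (set \<beta>)) \<beta>)"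
    using coordinates_of_basis[OF assms(1)] by (simp add: coordinates_def)
  have eq: "map (\<lambda>c. c u) (map pairing \<beta>) = map (\<lambda>c. c w) (map pairing \<beta>)" using assms(4) by simp
  have "u = combine (map (\<lambda>c. c w) (map pairing \<beta>)) (map (dual_vec v0 (set \<beta>)) \<beta>)"
    using s[OF assms(2)] unfolding eq .
  also have "\<dots> = w" using s[OF assms(3)] by (rule sym)
  finally show ?thesis .
qed

lemma iterated_residue_in_coords:
  assumes "is_basis v0 \<beta>"
  shows "iterated_residue (length \<beta>) (in_coords v0 \<beta> f) = vec_residue (map (dual_vec v0 (set \<beta>)) \<beta>) f 0"
proof -
  let ?es = "map (dual_vec v0 (set \<beta>)) \<beta>"
  have "in_coords v0 \<beta> f zs = f (0 + combine zs ?es)" if "length zs = length \<beta>" for zs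
  proof -
    have "(THE u. u \<in> cspace v0 \<and> (\<forall>i<length \<beta>. pairing (\<beta> ! i) u = zs ! i)) = combine zs ?es"
    proof (rule the_equality)
      show *: "combine zs ?es \<in> cspace v0 \<and> (\<forall>i<length \<beta>. pairing (\<beta> ! i) (combine zs ?es) = zs ! i)"
        using pairing_combine[OF assms] by (auto intro!: combine_in_cspace dual_vec_in_cspace)
      fix u assume "u \<in> cspace v0 \<and> (\<forall>i<length \<beta>. pairing (\<beta> ! i) u = zs ! i)"
      thus "u = combine zs ?es"
        using * by (intro eq_of_pairings[OF assms]) (auto simp: in_set_conv_nth)
    qed
    thus ?thesis by (simp add: in_coords_def)
  qed
  hence "iterated_residue (length \<beta>) (in_coords v0 \<beta> f) =
      iterated_residue (length \<beta>) (\<lambda>zs. f (0 + combine zs ?es))"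
    by (rule iterated_residue_cong)
  also have "\<dots> = vec_residue ?es f 0" using iterated_residue_combine[of ?es f 0] by simp
  finally show ?thesis .
qed

definition same_flag :: "(real ^ 'v::finite) list \<Rightarrow> (real ^ 'v) list \<Rightarrow> bool" where
  "same_flag \<beta> \<gamma> \<longleftrightarrow> (\<forall>m\<le>length \<beta>. span (set (take m \<gamma>)) = span (set (take m \<beta>)))"

lemma representation_same_flag_zero:
  assumes "is_basis v0 \<beta>" "is_basis v0 \<gamma>" "same_flag \<beta> \<gamma>" "i < j" "j < length \<beta>"
  shows "representation (set \<beta>) (\<gamma> ! i) (\<beta> ! j) = 0"
proof -
  have len: "length \<gamma> = length \<beta>" using is_basis_length[OF assms(1)] is_basis_length[OF assms(2)] by simp
  have "\<gamma> ! i \<in> set (take (Suc i) \<gamma>)" using assms(4,5) len by (simp add: take_Suc_conv_app_nth)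
  hence "\<gamma> ! i \<in> span (set (take (Suc i) \<beta>))"
    using assms(3-5) unfolding same_flag_def by (metis Suc_leI less_imp_le order.strict_trans span_base)
  hence "representation (set \<beta>) (\<gamma> ! i) = representation (set (take (Suc i) \<beta>)) (\<gamma> ! i)"
    using assms(1) by (intro representation_extend) (auto simp: is_basis_def set_take_subset)
  moreover have "\<beta> ! j \<notin> set (take (Suc i) \<beta>)"
    using assms(1,4,5) by (auto simp: is_basis_def in_set_conv_nth nth_eq_iff_index_eq)
  ultimately show ?thesis by (metis representation_ne_zero)
qed

text \<open>
  The two triangular matrices of change of basis are inverse to each other, hence so are their
  diagonal entries.
\<close>

lemma representation_same_flag_diag:
  assumes b: "is_basis v0 \<beta>" "is_basis v0 \<gamma>" "same_flag \<beta> \<gamma>" and i: "i < length \<beta>"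
  shows "representation (set \<beta>) (\<gamma> ! i) (\<beta> ! i) * representation (set \<gamma>) (\<beta> ! i) (\<gamma> ! i) = 1"
proof -
  have len: "length \<gamma> = length \<beta>" using is_basis_length[OF b(1)] is_basis_length[OF b(2)] by simp
  have f': "same_flag \<gamma> \<beta>" using b(3) len by (simp add: same_flag_def)
  have ind: "distinct \<beta>" "independent (set \<beta>)" "span (set \<beta>) = dual_space v0"
    "distinct \<gamma>" "independent (set \<gamma>)" "span (set \<gamma>) = dual_space v0" using b by (auto simp: is_basis_def)
  have g: "\<gamma> ! i \<in> span (set \<beta>)" using ind(3,6) i len by (metis nth_mem span_base)
  have inV: "x \<in> span (set \<gamma>)" if "x \<in> set \<beta>" for x using that ind(3,6) by (metis span_base)
  have "\<gamma> ! i = (\<Sum>x\<in>set \<beta>. representation (set \<beta>) (\<gamma> ! i) x *\<^sub>R x)"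
    using sum_representation_eq[OF ind(2) g] by simp
  hence "representation (set \<gamma>) (\<gamma> ! i) (\<gamma> ! i) =
      representation (set \<gamma>) (\<Sum>x\<in>set \<beta>. representation (set \<beta>) (\<gamma> ! i) x *\<^sub>R x) (\<gamma> ! i)"
    by (rule arg_cong[where f = "\<lambda>v. representation (set \<gamma>) v (\<gamma> ! i)"])
  also have "\<dots> = (\<Sum>x\<in>set \<beta>. representation (set \<beta>) (\<gamma> ! i) x * representation (set \<gamma>) x (\<gamma> ! i))"
  proof (subst representation_sum[OF ind(5)])
    show "representation (set \<beta>) (\<gamma> ! i) x *\<^sub>R x \<in> span (set \<gamma>)" if "x \<in> set \<beta>" for x
      by (rule span_scale[OF inV[OF that]])
  qed (intro sum.cong refl, simp add: representation_scale[OF ind(5) inV])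
  also have "\<dots> = (\<Sum>k<length \<beta>. representation (set \<beta>) (\<gamma> ! i) (\<beta> ! k) * representation (set \<gamma>) (\<beta> ! k) (\<gamma> ! i))"
    by (rule sum.reindex_bij_betw[OF bij_betw_nth[OF ind(1) refl refl], symmetric])
  also have "\<dots> = (\<Sum>k<length \<beta>. if k = i then representation (set \<beta>) (\<gamma> ! i) (\<beta> ! i) *
      representation (set \<gamma>) (\<beta> ! i) (\<gamma> ! i) else 0)"
  proof (intro sum.cong refl)
    fix k assume "k \<in> {..<length \<beta>}"
    hence k: "k < length \<beta>" "k < length \<gamma>" using len by auto
    have il: "i < length \<gamma>" using i len by simp
    have "k < i \<Longrightarrow> representation (set \<gamma>) (\<beta> ! k) (\<gamma> ! i) = 0"
      by (rule representation_same_flag_zero[OF b(2,1) f' _ il])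
    moreover have "i < k \<Longrightarrow> representation (set \<beta>) (\<gamma> ! i) (\<beta> ! k) = 0"
      by (rule representation_same_flag_zero[OF b _ k(1)])
    ultimately show "representation (set \<beta>) (\<gamma> ! i) (\<beta> ! k) * representation (set \<gamma>) (\<beta> ! k) (\<gamma> ! i) =
      (if k = i then representation (set \<beta>) (\<gamma> ! i) (\<beta> ! i) * representation (set \<gamma>) (\<beta> ! i) (\<gamma> ! i) else 0)"
      by (cases k i rule: linorder_cases) simp_all
  qed
  also have "\<dots> = representation (set \<beta>) (\<gamma> ! i) (\<beta> ! i) * representation (set \<gamma>) (\<beta> ! i) (\<gamma> ! i)"
    using i by simp
  also have "representation (set \<gamma>) (\<gamma> ! i) (\<gamma> ! i) = 1"
    using ind(5) i len by (simp add: representation_basis)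
  finally show ?thesis by simp
qed

text \<open>
  A punctured neighbourhood of \<open>0\<close>: a polydisc without the hyperplanes of \<open>A\<close>.
\<close>

definition hyperplane_complement :: "'v::finite \<Rightarrow> (real ^ 'v) set \<Rightarrow> real \<Rightarrow> (complex ^ 'v) set" where
  "hyperplane_complement v0 A s = {u \<in> cspace v0. \<forall>b\<in>A. pairing b u \<in> ball 0 s - {0}}"

text \<open>
  The germs whose poles lie on the hyperplanes of \<open>A\<close> and have finite order. The exponent \<open>K\<close> bounds
  the pole order along all hyperplanes at once.
\<close>

definition regular_germ :: "'v::finite \<Rightarrow> (real ^ 'v) set \<Rightarrow> (complex ^ 'v \<Rightarrow> complex) \<Rightarrow> bool" where
  "regular_germ v0 A f \<longleftrightarrow> (\<exists>s K C. 0 < s \<and> continuous_on (hyperplane_complement v0 A s) f \<and>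
     separately_holomorphic (cspace v0) (hyperplane_complement v0 A s) f \<and>
     (\<forall>u\<in>hyperplane_complement v0 A s. norm (f u) * (\<Prod>b\<in>A. norm (pairing b u)) ^ K \<le> C))"

lemma punctured_polydisc_eq_hyperplane_complement:
  "punctured_polydisc (cspace v0) (map pairing \<beta>) s = hyperplane_complement v0 (set \<beta>) s"
  by (simp add: punctured_polydisc_def hyperplane_complement_def)

lemma prod_norms_eq:
  "distinct \<beta> \<Longrightarrow> prod_list (norms (map pairing \<beta>) u) = (\<Prod>b\<in>set \<beta>. norm (pairing b u))"
  by (simp add: norms_def prod.distinct_set_conv_list comp_def)

text \<open>
  Both sides are the same torus integral: \<open>\<gamma>\<close> is triangular with respect to \<open>\<beta>\<close>, and \<open>\<beta>'\<close> is a
  permutation of \<open>\<beta>\<close>. In particular iterated residues depend neither on the order of the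
  coordinates nor on the choice of an adapted basis of a flag with given determinant.
\<close>

lemma iterated_residue_same_flag:
  assumes b: "is_basis v0 \<beta>" "is_basis v0 \<gamma>" "same_flag \<beta> \<gamma>" and b': "is_basis v0 \<beta>'" "set \<beta>' = set \<beta>"
    and f: "regular_germ v0 (set \<beta>) f"
  shows "iterated_residue (length \<gamma>) (in_coords v0 \<gamma> f) =
    of_real (\<Prod>i<length \<beta>. representation (set \<beta>) (\<gamma> ! i) (\<beta> ! i)) *
      iterated_residue (length \<beta>') (in_coords v0 \<beta>' f)"
proof -
  obtain s K C where s: "0 < s" and cont: "continuous_on (hyperplane_complement v0 (set \<beta>) s) f"
    and sep: "separately_holomorphic (cspace v0) (hyperplane_complement v0 (set \<beta>) s) f"
    and growth: "\<And>u. u \<in> hyperplane_complement v0 (set \<beta>) s \<Longrightarrow>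
      norm (f u) * (\<Prod>b\<in>set \<beta>. norm (pairing b u)) ^ K \<le> C"
    using f unfolding regular_germ_def by blast
  define A where "A = set \<beta>"
  define \<rho> where "\<rho> = s / 2"
  have \<rho>: "0 < \<rho>" "\<rho> < s" using s by (auto simp: \<rho>_def)
  define tm where "tm = (\<lambda>\<beta>. torus_mean (map (\<lambda>e. (e, \<rho>)) (map (dual_vec v0 (set \<beta>)) \<beta>)) f 0)"
  have zr: "zip xs (replicate (length xs) \<rho>) = map (\<lambda>e. (e, \<rho>)) xs" for xs :: "(complex ^ 'a) list"
    by (induction xs) auto
  have main: "iterated_residue (length \<gamma>) (in_coords v0 \<gamma> f) =
      of_real (\<Prod>i<length \<beta>. representation (set \<beta>) (\<gamma> ! i) (\<beta> ! i)) * tm \<beta>"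
    if b: "is_basis v0 \<beta>" "is_basis v0 \<gamma>" "same_flag \<beta> \<gamma>" and set: "set \<beta> = A"
    for \<beta> \<gamma>
  proof -
    let ?es = "map (dual_vec v0 (set \<beta>)) \<beta>" and ?bs = "map (dual_vec v0 (set \<gamma>)) \<gamma>"
    have len: "length \<gamma> = length \<beta>" using is_basis_length[OF b(1)] is_basis_length[OF b(2)] by simp
    have f': "same_flag \<gamma> \<beta>" using b(3) len by (simp add: same_flag_def)
    have ind: "independent (set \<gamma>)" "span (set \<gamma>) = dual_space v0" "span (set \<beta>) = dual_space v0"
      using b by (auto simp: is_basis_def)
    have Y: "punctured_polydisc (cspace v0) (map pairing \<beta>) s = hyperplane_complement v0 A s"
      unfolding punctured_polydisc_eq_hyperplane_complement set ..
    have val: "pairing (\<beta> ! i) (dual_vec v0 (set \<gamma>) (\<gamma> ! j)) = of_real (representation (set \<gamma>) (\<beta> ! i) (\<gamma> ! j))"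
      if "i < length \<beta>" for i j
      using that by (intro pairing_dual_vec ind) (metis ind(3) nth_mem span_base)
    have "vec_residue ?bs f 0 * prod_list (map2 (\<lambda>c b. c b) (map pairing \<beta>) ?bs) =
        torus_mean (zip ?es (replicate (length ?es) \<rho>)) f 0"
    proof (rule vec_residue_eq_symmetric_torus_mean[OF coordinates_of_basis[OF b(1)] coordinates_of_basis[OF b(2)]
          _ \<rho>, unfolded Y])
      show "triangular (rev ?bs) (rev (map pairing \<beta>))"
        unfolding triangular_iff
      proof (intro conjI allI impI)
        fix i assume i: "i < length (rev ?bs)"
        have "representation (set \<gamma>) (\<beta> ! (length \<beta> - Suc i)) (\<gamma> ! (length \<beta> - Suc i)) \<noteq> 0"
          using representation_same_flag_diag[OF b, of "length \<beta> - Suc i"] i len by fastforce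
        thus "(rev (map pairing \<beta>) ! i) (rev ?bs ! i) \<noteq> 0"
          using i len val[of "length \<beta> - Suc i" "length \<beta> - Suc i"] by (simp add: rev_nth)
        fix j assume j: "i < j \<and> j < length (rev ?bs)"
        have "representation (set \<gamma>) (\<beta> ! (length \<beta> - Suc j)) (\<gamma> ! (length \<beta> - Suc i)) = 0"
          by (rule representation_same_flag_zero[OF b(2,1) f']) (use i j len in auto)
        thus "(rev (map pairing \<beta>) ! j) (rev ?bs ! i) = 0"
        proof -
          have "length \<beta> - Suc j < length \<beta>" "length \<beta> - Suc i < length \<beta>" using i j len by auto
          thus ?thesis
            using i j len val[of "length \<beta> - Suc j" "length \<beta> - Suc i"]
              \<open>representation _ _ _ = 0\<close> by (simp add: rev_nth)
        qed
      qed (simp add: len)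
      have "set ?es \<union> set ?bs \<subseteq> cspace v0" using dual_vec_in_cspace by auto
      thus "separately_holomorphic (set ?es \<union> set ?bs)
          (hyperplane_complement v0 A s) f"
        using sep unfolding separately_holomorphic_def A_def by blast
      show "norm (f u) * prod_list (norms (map pairing \<beta>) u) ^ K \<le> C" if "u \<in> hyperplane_complement v0 A s" for u
        using growth[of u] that b(1) set prod_norms_eq[of \<beta> u] by (simp add: is_basis_def A_def)
    qed (use cont in \<open>simp add: A_def\<close>)
    also have "\<dots> = tm \<beta>" unfolding tm_def zr ..
    also have "prod_list (map2 (\<lambda>c b. c b) (map pairing \<beta>) ?bs) =
        (\<Prod>i<length \<beta>. of_real (representation (set \<gamma>) (\<beta> ! i) (\<gamma> ! i)))"
      unfolding prod.list_conv_set_nth by (rule prod.cong) (auto simp: len val)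
    finally have "vec_residue ?bs f 0 * of_real (\<Prod>i<length \<beta>. representation (set \<gamma>) (\<beta> ! i) (\<gamma> ! i)) = tm \<beta>"
      by simp
    hence "of_real (\<Prod>i<length \<beta>. representation (set \<beta>) (\<gamma> ! i) (\<beta> ! i)) * tm \<beta> =
        vec_residue ?bs f 0 * of_real (\<Prod>i<length \<beta>. representation (set \<beta>) (\<gamma> ! i) (\<beta> ! i) *
          representation (set \<gamma>) (\<beta> ! i) (\<gamma> ! i))"
      by (simp add: prod.distrib mult_ac)
    also have "(\<Prod>i<length \<beta>. representation (set \<beta>) (\<gamma> ! i) (\<beta> ! i) *
          representation (set \<gamma>) (\<beta> ! i) (\<gamma> ! i)) = 1"
      by (rule prod.neutral) (use representation_same_flag_diag[OF b] in auto)
    finally show ?thesis using iterated_residue_in_coords[OF b(2), of f] by simp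
  qed
  have 1: "iterated_residue (length \<gamma>) (in_coords v0 \<gamma> f) =
      of_real (\<Prod>i<length \<beta>. representation (set \<beta>) (\<gamma> ! i) (\<beta> ! i)) * tm \<beta>"
    by (rule main[OF b]) (simp add: A_def)
  have 2: "iterated_residue (length \<beta>') (in_coords v0 \<beta>' f) =
      of_real (\<Prod>i<length \<beta>'. representation (set \<beta>') (\<beta>' ! i) (\<beta>' ! i)) * tm \<beta>'"
    by (rule main[OF b'(1) b'(1)]) (simp_all add: same_flag_def A_def b'(2))
  have "(\<Prod>i<length \<beta>'. representation (set \<beta>') (\<beta>' ! i) (\<beta>' ! i)) = 1"
    by (rule prod.neutral) (use b'(1) in \<open>auto simp: is_basis_def representation_basis\<close>)
  moreover have "tm \<beta> = tm \<beta>'"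
    unfolding tm_def
  proof (rule conjunct1[OF torus_mean_perm])
    have "mset \<beta> = mset \<beta>'" using b b' by (simp add: is_basis_def set_eq_iff_mset_eq_distinct)
    thus "mset (map (\<lambda>e. (e, \<rho>)) (map (dual_vec v0 (set \<beta>)) \<beta>)) =
        mset (map (\<lambda>e. (e, \<rho>)) (map (dual_vec v0 (set \<beta>')) \<beta>'))" by (simp add: b'(2))
    have co: "coordinates (cspace v0) (map (dual_vec v0 (set \<beta>)) \<beta>) (map pairing \<beta>)"
      by (rule coordinates_of_basis[OF b(1)])
    hence dual: "dual_lists (map (dual_vec v0 (set \<beta>)) \<beta>) (map pairing \<beta>)"
      and st: "stable_under (set (map (dual_vec v0 (set \<beta>)) \<beta>)) (cspace v0)" by (auto simp: coordinates_def)
    from torus_in_punctured_polydisc[OF dual_triangular[OF dual] dual_dominated[OF dual \<rho>] st]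
    have "torus (map (\<lambda>e. (e, \<rho>)) (map (dual_vec v0 (set \<beta>)) \<beta>)) 0 \<subseteq> hyperplane_complement v0 (set \<beta>) s"
      unfolding zr punctured_polydisc_eq_hyperplane_complement by (auto simp: functional_pairing)
    thus "continuous_on (torus (map (\<lambda>e. (e, \<rho>)) (map (dual_vec v0 (set \<beta>)) \<beta>)) 0) f"
      using continuous_on_subset[OF cont] by blast
  qed
  ultimately show ?thesis using 1 2 by simp
qed

section \<open>Germs of meromorphic functions\<close>

lemma holomorphic_several_imp_continuous:
  assumes "holomorphic_several v0 f X" "X \<subseteq> cspace v0"
  shows "continuous_on X f"
  unfolding continuous_on_eq_continuous_within
proof
  fix x assume "x \<in> X"
  then obtain D where "(f has_derivative D) (at x within cspace v0)"
    using assms(1) unfolding holomorphic_several_def by blast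
  hence "continuous (at x within cspace v0) f" by (rule has_derivative_continuous)
  thus "continuous (at x within X) f" by (rule continuous_within_subset[OF _ assms(2)])
qed

lemma bounded_linear_smult_right: "bounded_linear (\<lambda>z. z *s (b :: complex ^ 'v::finite))"
  unfolding linear_conv_bounded_linear[symmetric]
  by (rule linearI) (simp_all add: vec_eq_iff distrib_right)

text \<open>
  Restricting the complex-linear derivative to a line gives a complex derivative in one variable.
\<close>

lemma holomorphic_several_imp_separately:
  fixes f :: "complex ^ 'v::finite \<Rightarrow> complex"
  assumes hol: "holomorphic_several v0 f X" and X: "X \<subseteq> cspace v0"
  shows "separately_holomorphic (cspace v0) X f"
  unfolding separately_holomorphic_def
proof (intro ballI allI)
  fix b u :: "complex ^ 'v" assume b: "b \<in> cspace v0"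
  show "(\<lambda>z. f (u + z *s b)) holomorphic_on {z. u + z *s b \<in> X}"
    unfolding holomorphic_on_def
  proof
    fix z assume z: "z \<in> {z. u + z *s b \<in> X}"
    then obtain D where D: "(f has_derivative D) (at (u + z *s b) within cspace v0)"
      and lin: "\<And>c h. h \<in> cspace v0 \<Longrightarrow> D (c *s h) = c * D h"
      using hol unfolding holomorphic_several_def by blast
    have zX: "u + z *s b \<in> cspace v0" using z X by auto
    have u: "u \<in> cspace v0" using zX b by (simp add: cspace_def)
    have "((\<lambda>z. u + z *s b) has_derivative (\<lambda>h. h *s b)) (at z)"
      by (rule derivative_eq_intros bounded_linear.has_derivative[OF bounded_linear_smult_right]
          has_derivative_ident refl)+ simp
    moreover have "(f has_derivative D) (at (u + z *s b) within (\<lambda>z. u + z *s b) ` UNIV)"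
      by (rule has_derivative_subset[OF D]) (use u b in \<open>auto simp: cspace_def\<close>)
    ultimately have "((\<lambda>z. f (u + z *s b)) has_derivative (\<lambda>h. D (h *s b))) (at z)"
      by (rule has_derivative_in_compose)
    moreover have "(\<lambda>h. D (h *s b)) = (*) (D b)" using lin[OF b] by (simp add: fun_eq_iff mult.commute)
    ultimately have "((\<lambda>z. f (u + z *s b)) has_field_derivative D b) (at z)"
      by (simp add: has_field_derivative_def)
    thus "(\<lambda>z. f (u + z *s b)) field_differentiable at z within {z. u + z *s b \<in> X}"
      using field_differentiable_at_within field_differentiable_def by blast
  qed
qed

lemma separately_holomorphic_translate:
  assumes "separately_holomorphic B X f" "\<And>u. u \<in> Y \<Longrightarrow> u + x \<in> X"
  shows "separately_holomorphic B Y (\<lambda>u. f (u + x))"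
  unfolding separately_holomorphic_def
proof (intro ballI allI)
  fix b u assume "b \<in> B"
  hence "(\<lambda>z. f (u + x + z *s b)) holomorphic_on {z. u + x + z *s b \<in> X}"
    using assms(1) unfolding separately_holomorphic_def by blast
  moreover have eq: "u + x + z *s b = u + z *s b + x" for z by (simp add: algebra_simps)
  ultimately have "(\<lambda>z. f (u + z *s b + x)) holomorphic_on {z. u + z *s b + x \<in> X}"
    by (simp only: eq)
  thus "(\<lambda>z. f (u + z *s b + x)) holomorphic_on {z. u + z *s b \<in> Y}"
    by (rule holomorphic_on_subset) (use assms(2) in auto)
qed

lemma continuous_on_translate:
  fixes x :: "'a::topological_monoid_add"
  assumes "continuous_on X f" "\<And>u. u \<in> Y \<Longrightarrow> u + x \<in> X"
  shows "continuous_on Y (\<lambda>u. f (u + x))"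
  by (rule continuous_on_compose2[OF assms(1)]) (use assms(2) in \<open>auto intro!: continuous_intros\<close>)

text \<open>
  In a small polydisc around \<open>x\<close> the function is a quotient of holomorphic functions, and by assumption
  its poles lie on the hyperplanes through \<open>x\<close>; finiteness of the pole order is \<open>moderate_growth\<close>.
\<close>

lemma regular_germ_of_meromorphic:
  fixes f :: "complex ^ 'v::finite \<Rightarrow> complex"
  assumes \<beta>: "is_basis v0 \<beta>" and x: "x \<in> cspace v0" and "r > 0"
    and hol: "holomorphic_several v0 f
      ((ball x r \<inter> cspace v0) - (\<Union>g\<in>set \<beta>. {u. pairing g (u - x) = 0}))"
    and mero: "meromorphic_several v0 f"
  shows "regular_germ v0 (set \<beta>) (\<lambda>u. f (u + x))"
proof -
  define X where "X = (ball x r \<inter> cspace v0) - (\<Union>g\<in>set \<beta>. {u. pairing g (u - x) = 0})"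
  from bspec[OF mero[unfolded meromorphic_several_def] x] obtain U g h where
    *: "open U \<and> x \<in> U \<and> holomorphic_several v0 g (U \<inter> cspace v0) \<and>
      holomorphic_several v0 h (U \<inter> cspace v0) \<and>
      (\<forall>X. open X \<and> X \<subseteq> U \<and> X \<inter> cspace v0 \<noteq> {} \<longrightarrow> (\<exists>y\<in>X \<inter> cspace v0. h y \<noteq> 0)) \<and>
      (\<forall>y\<in>U \<inter> cspace v0. h y \<noteq> 0 \<longrightarrow> f y = g y / h y)"
    by (elim exE) (rule that)
  have U: "open U" "x \<in> U" using * by simp_all
  have g: "holomorphic_several v0 g (U \<inter> cspace v0)" using * by simp
  have h: "holomorphic_several v0 h (U \<inter> cspace v0)" using * by simp
  have nz: "\<exists>y\<in>X \<inter> cspace v0. h y \<noteq> 0" if "open X" "X \<subseteq> U" "X \<inter> cspace v0 \<noteq> {}" for X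
    using * that by simp
  have quot: "f y = g y / h y" if "y \<in> U \<inter> cspace v0" "h y \<noteq> 0" for y using * that by simp
  from U obtain r1 where r1: "r1 > 0" "ball x r1 \<subseteq> U" using open_contains_ball by blast
  define r2 where "r2 = min r r1"
  have r2: "r2 > 0" "ball x r2 \<subseteq> U" "ball x r2 \<subseteq> ball x r" using r1 \<open>r > 0\<close> by (auto simp: r2_def)
  let ?es = "map (dual_vec v0 (set \<beta>)) \<beta>" and ?cs = "map pairing \<beta>"
  have co: "coordinates (cspace v0) ?es ?cs" by (rule coordinates_of_basis[OF \<beta>])
  hence dual: "dual_lists ?es ?cs" and span: "\<And>u. u \<in> cspace v0 \<Longrightarrow> u = combine (map (\<lambda>c. c u) ?cs) ?es"
    by (auto simp: coordinates_def)
  define N where "N = (\<Sum>e\<leftarrow>?es. norm e)"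
  have "N \<ge> 0" unfolding N_def by (intro sum_list_nonneg) auto
  \<comment> \<open>small enough for the polydisc to lie in the ball of radius \<open>r2\<close>\<close>
  define s where "s = r2 / (1 + N)"
  have s: "s > 0" "s * N < r2" using r2(1) \<open>N \<ge> 0\<close> by (auto simp: s_def field_simps)
  define P where "P = polydisc (cspace v0) ?cs s"
  define Y where "Y = punctured_polydisc (cspace v0) ?cs s"
  have small: "u + x \<in> ball x r2 \<inter> cspace v0" if u: "u \<in> P" for u
  proof -
    have uc: "u \<in> cspace v0" using u by (simp add: P_def polydisc_def)
    have "\<forall>z\<in>set (map (\<lambda>c. c u) ?cs). norm z \<le> s" using u by (auto simp: P_def polydisc_def)
    hence "norm (combine (map (\<lambda>c. c u) ?cs) ?es) \<le> s * N"
      unfolding N_def by (intro norm_combine_le) auto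
    hence "norm u < r2" using span[OF uc] s(2) by simp
    thus ?thesis using uc x cspace_closed(1) by (auto simp: dist_norm)
  qed
  have YP: "Y \<subseteq> P" by (simp add: Y_def P_def punctured_subset_polydisc)
  have inX: "u + x \<in> X" if u: "u \<in> Y" for u
    proof -
    have "u + x \<in> ball x r \<inter> cspace v0" using small[of u] YP r2(3) u by blast
    moreover have "pairing g u \<noteq> 0" if "g \<in> set \<beta>" for g
      using u that by (auto simp: Y_def punctured_polydisc_def)
    ultimately show ?thesis by (simp add: X_def)
  qed
  have Xc: "X \<subseteq> cspace v0" by (auto simp: X_def)
  \<comment> \<open>a point off all hyperplanes: it makes the open set below, where the denominator is sought, nonempty\<close>
  define y0 where "y0 = combine (replicate (length \<beta>) (of_real (s / 2))) ?es"
  have y0: "y0 \<in> cspace v0" unfolding y0_def by (rule combine_in_cspace) (use dual_vec_in_cspace in auto)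
  have py0: "pairing b y0 = of_real (s / 2)" if b: "b \<in> set \<beta>" for b
  proof -
    obtain i where "i < length \<beta>" "b = \<beta> ! i" using b by (metis in_set_conv_nth)
    thus ?thesis using pairing_combine[OF \<beta>, of i] by (simp add: y0_def)
  qed
  define O' where "O' = ball x r2 \<inter> (\<Inter>b\<in>set \<beta>. (\<lambda>p. pairing b (p - x)) -` (ball 0 s - {0}))"
  have py0': "pairing b y0 \<in> ball 0 s - {0}" if "b \<in> set \<beta>" for b
    unfolding py0[OF that] using s(1) by simp
  have "y0 \<in> Y" unfolding Y_def punctured_polydisc_def using y0 py0' by simp
  have "open O'" unfolding O'_def
    by (intro open_Int open_ball open_INT ballI open_vimage functional_cont_comp functional_pairing
        continuous_intros open_Diff closed_singleton) auto
  moreover have "O' \<subseteq> U" using r2 by (auto simp: O'_def)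
  moreover have "y0 + x \<in> O' \<inter> cspace v0"
    using small[of y0] \<open>y0 \<in> Y\<close> YP py0' by (auto simp: O'_def)
  ultimately obtain y where y: "y \<in> O' \<inter> cspace v0" "h y \<noteq> 0" using nz[of O'] by blast
  have yY: "y - x \<in> Y"
    using y x by (auto simp: O'_def Y_def punctured_polydisc_def cspace_def)
  have inU: "u + x \<in> U \<inter> cspace v0" if "u \<in> P" for u using small[OF that] r2 by blast
  have sepf: "separately_holomorphic (cspace v0) Y (\<lambda>u. f (u + x))"
    by (rule separately_holomorphic_translate[OF holomorphic_several_imp_separately[OF hol[folded X_def] Xc] inX])
  have contf: "continuous_on Y (\<lambda>u. f (u + x))"
    by (rule continuous_on_translate[OF holomorphic_several_imp_continuous[OF hol[folded X_def] Xc] inX])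
  have sepP: "separately_holomorphic (cspace v0) P (\<lambda>u. F (u + x))"
    if "holomorphic_several v0 F (U \<inter> cspace v0)" for F
    by (rule separately_holomorphic_translate[OF holomorphic_several_imp_separately[OF that] inU]) auto
  have conth: "continuous_on P (\<lambda>u. h (u + x))"
    by (rule continuous_on_translate[OF holomorphic_several_imp_continuous[OF h] inU]) auto
  have sub: "set ?es \<subseteq> cspace v0" using dual_vec_in_cspace by auto
  have mono: "separately_holomorphic (set ?es) Z F" if "separately_holomorphic (cspace v0) Z F" for Z F
    using that sub unfolding separately_holomorphic_def by blast
  have "\<exists>K C s'. 0 < s' \<and> s' < s \<and> (\<forall>u\<in>punctured_polydisc (cspace v0) ?cs s'.
      norm (f (u + x)) * prod_list (norms ?cs u) ^ K \<le> C)"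
  proof (rule moderate_growth[OF co s(1), folded Y_def P_def])
    show "y - x \<in> Y" by (rule yY)
    show "h (y - x + x) \<noteq> 0" using y by simp
    show "f (u + x) = g (u + x) / h (u + x)" if "u \<in> Y" "h (u + x) \<noteq> 0" for u
      using quot[OF inU that(2)] that(1) YP by blast
  qed (use mono sepf contf sepP[OF g] sepP[OF h] conth in auto)
  then obtain K C s' where s': "0 < s'" "s' < s" and growth: "\<And>u. u \<in> hyperplane_complement v0 (set \<beta>) s' \<Longrightarrow>
      norm (f (u + x)) * prod_list (norms ?cs u) ^ K \<le> C"
    unfolding punctured_polydisc_eq_hyperplane_complement by blast
  have sub': "hyperplane_complement v0 (set \<beta>) s' \<subseteq> Y"
    unfolding Y_def punctured_polydisc_eq_hyperplane_complement using s' by (auto simp: hyperplane_complement_def)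
  have "separately_holomorphic (cspace v0) (hyperplane_complement v0 (set \<beta>) s') (\<lambda>u. f (u + x))"
    unfolding separately_holomorphic_def
  proof (intro ballI allI)
    fix b u :: "complex ^ 'v" assume "b \<in> cspace v0"
    hence "(\<lambda>z. f (u + z *s b + x)) holomorphic_on {z. u + z *s b \<in> Y}"
      using sepf unfolding separately_holomorphic_def by blast
    thus "(\<lambda>z. f (u + z *s b + x)) holomorphic_on {z. u + z *s b \<in> hyperplane_complement v0 (set \<beta>) s'}"
      by (rule holomorphic_on_subset) (use sub' in blast)
  qed
  moreover note continuous_on_subset[OF contf sub']
  moreover have "distinct \<beta>" using \<beta> by (simp add: is_basis_def)
  ultimately show ?thesis unfolding regular_germ_def
    using s'(1) growth prod_norms_eq[of \<beta>] by metis
qed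

section \<open>Flags of a basis and the Jeffrey--Kirwan residue\<close>

lemma is_basis_of_spanning:
  fixes v0 :: "'v::finite"
  assumes len: "length g = CARD('v) - 1" and sub: "set g \<subseteq> dual_space v0" and sp: "dual_space v0 \<subseteq> span (set g)"
  shows "is_basis v0 g"
proof -
  have "card (set g) \<le> dim (dual_space v0)" unfolding dim_dual_space len[symmetric] by (rule card_length)
  hence ind: "independent (set g)"
    by (rule card_le_dim_spanning[OF sub sp finite_set])
  have span: "span (set g) = dual_space v0"
    using sp span_minimal[OF sub subspace_dual_space] by blast
  hence "card (set g) = length g"
    using dim_span_eq_card_independent[OF ind] len by (simp add: dim_dual_space)
  hence "distinct g" by (rule card_distinct)
  thus ?thesis using ind span by (simp add: is_basis_def)
qed

text \<open>
  In the expansion of the determinant of a triangular matrix only one permutation survives, namely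
  the one that transforms \<open>d\<close> into \<open>\<beta>\<close>; its sign is \<open>\<epsilon>\<close>.
\<close>

lemma wedge_ratio_triangular:
  fixes \<beta> d :: "(real ^ 'v::finite) list"
  assumes "distinct \<beta>" "distinct d" "set d = set \<beta>"
  shows "\<exists>\<epsilon>\<in>{1, -1 :: real}. \<forall>g.
     (\<forall>j<length \<beta>. \<forall>i<j. representation (set \<beta>) (g ! i) (\<beta> ! j) = 0) \<longrightarrow>
     wedge_ratio d g = \<epsilon> * (\<Prod>i<length \<beta>. representation (set \<beta>) (g ! i) (\<beta> ! i))"
proof -
  have "mset \<beta> = mset d" using assms by (simp add: set_eq_iff_mset_eq_distinct)
  then obtain \<sigma> where \<sigma>: "\<sigma> permutes {..<length d}" "permute_list \<sigma> d = \<beta>"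
    by (rule mset_eq_permutation)
  have len: "length \<beta> = length d" using \<sigma>(2) by auto
  have nth: "\<beta> ! i = d ! \<sigma> i" if "i < length d" for i
    using that \<sigma> permute_list_nth by blast
  show ?thesis
  proof (intro bexI[of _ "of_int (sign \<sigma>)"] allI impI)
    show "real_of_int (sign \<sigma>) \<in> {1, -1}" by (simp add: sign_def)
    fix g assume tri: "\<forall>j<length \<beta>. \<forall>i<j. representation (set \<beta>) (g ! i) (\<beta> ! j) = 0"
    let ?t = "\<lambda>p. of_int (sign p) * (\<Prod>i<length d. representation (set d) (g ! i) (d ! p i))"
    have zero: "?t p = 0" if p: "p permutes {..<length d}" "p \<noteq> \<sigma>" for p
    proof -
      define q where "q = inv \<sigma> \<circ> p"
      have q: "q permutes {..<length d}" unfolding q_def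
        by (rule permutes_compose[OF p(1) permutes_inv[OF \<sigma>(1)]])
      have "q \<noteq> id"
      proof
        assume "q = id"
        hence "\<sigma> \<circ> q = \<sigma>" by simp
        moreover have "\<sigma> \<circ> q = p" unfolding q_def
          using permutes_inv_o(1)[OF \<sigma>(1)] by (simp add: o_assoc)
        ultimately show False using p(2) by simp
      qed
      then obtain i where i: "i < length d" "i < q i"
        using permutes_natset_le[OF q] by (meson lessThan_iff not_le)
      have qi: "q i < length d" using permutes_in_image[OF q, of i] i by simp
      have "\<sigma> (q i) = p i" using permutes_inverses(1)[OF \<sigma>(1)] by (simp add: q_def)
      hence "\<beta> ! q i = d ! p i" using nth[OF qi] by simp
      hence "representation (set d) (g ! i) (d ! p i) = 0"
        using tri i qi len assms(3) by metis
      hence "(\<Prod>i<length d. representation (set d) (g ! i) (d ! p i)) = 0"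
        using i by (intro prod_zero) auto
      thus ?thesis by simp
    qed
    have "wedge_ratio d g = (\<Sum>p\<in>{\<sigma>}. ?t p)"
      unfolding wedge_ratio_def
      by (rule sum.mono_neutral_right) (use \<sigma>(1) zero in \<open>auto simp: finite_permutations\<close>)
    also have "\<dots> = of_int (sign \<sigma>) * (\<Prod>i<length \<beta>. representation (set \<beta>) (g ! i) (\<beta> ! i))"
      using len nth assms(3) by simp
    finally show "wedge_ratio d g = of_int (sign \<sigma>) * (\<Prod>i<length \<beta>. representation (set \<beta>) (g ! i) (\<beta> ! i))" .
  qed
qed

lemma representation_sum_subset:
  fixes A :: "(real ^ 'v::finite) set"
  assumes "independent A" "B \<subseteq> A"
  shows "representation A (\<Sum>B) b = of_bool (b \<in> B)"
proof -
  have fin: "finite B" using assms finiteI_independent finite_subset by blast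
  have "representation A (\<Sum>B) b = (\<Sum>x\<in>B. representation A x b)"
    by (subst representation_sum[OF assms(1)]) (use assms(2) span_base in auto)
  also have "\<dots> = (\<Sum>x\<in>B. if b = x then 1 else 0)"
    using assms by (intro sum.cong refl) (auto simp: representation_basis)
  finally show ?thesis using fin by simp
qed

lemma representation_combination:
  fixes A :: "(real ^ 'v::finite) set"
  assumes "independent A" "\<And>j. j \<in> J \<Longrightarrow> x j \<in> span A"
  shows "representation A (\<Sum>j\<in>J. c j *\<^sub>R x j) b = (\<Sum>j\<in>J. c j * representation A (x j) b)"
  using assms by (subst representation_sum[OF assms(1)]) (auto intro!: span_scale sum.cong simp: representation_scale)

text \<open>
  By independence, a subspace spanned by some elements of \<open>A\<close> contains no other elements of \<open>A\<close>.
\<close>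

lemma flag_step:
  fixes A :: "(real ^ 'v::finite) set"
  assumes ind: "independent A" and F: "F \<in> flags v0 A" and j: "j \<le> CARD('v) - 1"
  shows "F ! j = span (A \<inter> F ! j)" "card (A \<inter> F ! j) = j"
proof -
  obtain B where B: "B \<subseteq> A" "F ! j = span B" and d: "dim (F ! j) = j"
    using F j unfolding flags_def by blast
  have "A \<inter> span B \<subseteq> B"
  proof
    fix x assume x: "x \<in> A \<inter> span B"
    show "x \<in> B"
    proof (rule ccontr)
      assume "x \<notin> B"
      hence "x \<in> span (A - {x})" using x B(1) span_mono[of B "A - {x}"] by blast
      thus False using ind x unfolding dependent_def by blast
    qed
  qed
  hence AB: "A \<inter> F ! j = B" using B span_superset by blast
  show "F ! j = span (A \<inter> F ! j)" using AB B(2) by simp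
  have "independent B" using ind B(1) by (rule independent_mono)
  thus "card (A \<inter> F ! j) = j" using AB B(2) d dim_span_eq_card_independent by metis
qed

definition flag_of :: "(real ^ 'v::finite) list \<Rightarrow> (real ^ 'v) set list" where
  "flag_of \<beta> = map (\<lambda>j. span (set (take j \<beta>))) [0..<CARD('v)]"

lemma flag_of_nth: "j < CARD('v) \<Longrightarrow> flag_of (\<beta> :: (real ^ 'v::finite) list) ! j = span (set (take j \<beta>))"
  by (simp add: flag_of_def del: upt_Suc)

lemma flag_of_inter:
  fixes \<beta> :: "(real ^ 'v::finite) list"
  assumes "is_basis v0 \<beta>" "j < CARD('v)"
  shows "set \<beta> \<inter> flag_of \<beta> ! j = set (take j \<beta>)"
proof -
  have ind: "independent (set \<beta>)" using assms(1) by (simp add: is_basis_def)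
  have sub: "set (take j \<beta>) \<subseteq> set \<beta>" by (rule set_take_subset)
  have "x \<in> set (take j \<beta>)" if x: "x \<in> set \<beta>" "x \<in> span (set (take j \<beta>))" for x
  proof (rule ccontr)
    assume "x \<notin> set (take j \<beta>)"
    hence "x \<in> span (set \<beta> - {x})" using x sub span_mono[of "set (take j \<beta>)" "set \<beta> - {x}"] by blast
    thus False using ind x unfolding dependent_def by blast
  qed
  thus ?thesis unfolding flag_of_nth[OF assms(2)] using sub span_superset by blast
qed

lemma flag_of_in_flags:
  fixes \<beta> :: "(real ^ 'v::finite) list"
  assumes b: "is_basis v0 \<beta>"
  shows "flag_of \<beta> \<in> flags v0 (set \<beta>)"
proof -
  have len: "length \<beta> = CARD('v) - 1" by (rule is_basis_length[OF b])
  have pos: "CARD('v) > 0" by simp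
  have "dim (span (set (take j \<beta>))) = j" if "j \<le> CARD('v) - 1" for j
  proof -
    have "independent (set (take j \<beta>))"
      using b set_take_subset[of j \<beta>] independent_mono by (auto simp: is_basis_def)
    moreover have "card (set (take j \<beta>)) = j"
      using b that len by (simp add: distinct_card is_basis_def)
    ultimately show ?thesis by (metis dim_span_eq_card_independent)
  qed
  moreover have "flag_of \<beta> ! (CARD('v) - 1) = dual_space v0"
    using b len by (simp add: flag_of_nth is_basis_def)
  moreover have "span (set (take j \<beta>)) \<subseteq> span (set (take (Suc j) \<beta>))" for j
    by (intro span_mono set_take_subset_set_take) simp
  moreover have "\<exists>B\<subseteq>set \<beta>. span (set (take j \<beta>)) = span B" for j
    using set_take_subset[of j \<beta>] by blast
  moreover have "length (flag_of \<beta>) = CARD('v)" by (simp add: flag_of_def del: upt_Suc)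
  moreover have "flag_of \<beta> ! j = span (set (take j \<beta>))" if "j \<le> CARD('v) - 1" for j
    using that pos by (intro flag_of_nth) linarith
  ultimately show ?thesis unfolding flags_def by simp
qed

text \<open>
  The coordinate of \<open>\<Sum> c\<^sub>j \<kappa>\<^sub>j\<close> at \<open>b\<close> is the sum of those \<open>c\<^sub>j\<close> for which \<open>b\<close> lies in the \<open>j\<close>-th step of
  the flag. It is therefore positive, and larger for elements that enter the flag earlier.
\<close>

lemma flag_cone_decreasing:
  fixes A :: "(real ^ 'v::finite) set"
  assumes ind: "independent A" and spA: "span A = dual_space v0"
    and F: "F \<in> flags v0 A" and \<zeta>: "\<zeta> \<in> flag_cone A F"
  shows "b \<in> A \<Longrightarrow> representation A \<zeta> b > 0"
    and "j \<le> CARD('v) - 1 \<Longrightarrow> b \<in> A \<Longrightarrow> b \<in> F ! j \<Longrightarrow> b' \<in> A \<Longrightarrow> b' \<notin> F ! j \<Longrightarrow>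
      representation A \<zeta> b' < representation A \<zeta> b"
proof -
  define n where "n = CARD('v) - 1"
  obtain c where c: "\<And>j. j \<in> {1..n} \<Longrightarrow> c j > 0" "\<zeta> = (\<Sum>j = 1..n. c j *\<^sub>R kappa A F j)"
    using \<zeta> unfolding flag_cone_def n_def by blast
  have rep: "representation A \<zeta> b = (\<Sum>j = 1..n. c j * of_bool (b \<in> F ! j))" if "b \<in> A" for b
  proof -
    have "kappa A F j \<in> span A" for j unfolding kappa_def by (intro span_sum) (auto intro: span_base)
    hence "representation A \<zeta> b = (\<Sum>j = 1..n. c j * representation A (kappa A F j) b)"
      unfolding c(2) by (intro representation_combination[OF ind])
    also have "\<dots> = (\<Sum>j = 1..n. c j * of_bool (b \<in> F ! j))"
      unfolding kappa_def by (intro sum.cong refl) (use that in \<open>simp add: representation_sum_subset[OF ind]\<close>)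
    finally show ?thesis .
  qed
  have mono: "F ! i \<subseteq> F ! j" if "i \<le> j" "j \<le> n" for i j
    using that
  proof (induction j rule: dec_induct)
    case (step k)
    have "F ! k \<subseteq> F ! Suc k" using F step.hyps(2) step.prems unfolding flags_def n_def by auto
    thus ?case using step by auto
  qed simp
  have FnV: "F ! n = dual_space v0" and F0: "F ! 0 = {0}" using F by (auto simp: flags_def n_def)
  have A0: "0 \<notin> A" using ind dependent_zero by blast
  show "representation A \<zeta> b > 0" if b: "b \<in> A"
  proof -
    have bn: "b \<in> F ! n" using b spA FnV span_base by blast
    hence "n \<noteq> 0" using F0 A0 b by (metis singletonD)
    hence "0 < c n * of_bool (b \<in> F ! n)" using c(1)[of n] bn by simp
    also have "\<dots> \<le> (\<Sum>j = 1..n. c j * of_bool (b \<in> F ! j))"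
      using \<open>n \<noteq> 0\<close> c(1) by (intro member_le_sum) (auto simp: less_imp_le)
    finally show ?thesis using rep[OF b] by simp
  qed
  show "representation A \<zeta> b' < representation A \<zeta> b"
    if j: "j \<le> CARD('v) - 1" and b: "b \<in> A" "b \<in> F ! j" "b' \<in> A" "b' \<notin> F ! j"
    unfolding rep[OF b(1)] rep[OF b(3)]
  proof (rule sum_strict_mono_ex1)
    have "j \<noteq> 0" using b(1,2) F0 A0 by (metis singletonD)
    thus "\<exists>a\<in>{1..n}. c a * of_bool (b' \<in> F ! a) < c a * of_bool (b \<in> F ! a)"
      using b j c(1)[of j] by (intro bexI[of _ j]) (auto simp: n_def)
    show "\<forall>k\<in>{1..n}. c k * of_bool (b' \<in> F ! k) \<le> c k * of_bool (b \<in> F ! k)"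
    proof
      fix k assume k: "k \<in> {1..n}"
      have "b \<in> F ! k" if "b' \<in> F ! k"
      proof (cases "j \<le> k")
        case True
        thus ?thesis using mono[of j k] k b(2) by auto
      next
        case False
        thus ?thesis using mono[of k j] j b(4) that by (auto simp: n_def)
      qed
      thus "c k * of_bool (b' \<in> F ! k) \<le> c k * of_bool (b \<in> F ! k)"
        using c(1)[OF k] by auto
    qed
  qed simp
qed

text \<open>
  Each step of the flag meets the basis in a set of prescribed size that is closed under passing to
  larger coordinates of \<open>\<zeta>\<close>; there is only one such set.
\<close>

lemma flag_of_unique:
  fixes \<beta> :: "(real ^ 'v::finite) list"
  assumes b: "is_basis v0 \<beta>" and F: "F \<in> flags v0 (set \<beta>)" and \<zeta>: "\<zeta> \<in> flag_cone (set \<beta>) F"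
    and dec: "\<And>i j. i < j \<Longrightarrow> j < length \<beta> \<Longrightarrow>
      representation (set \<beta>) \<zeta> (\<beta> ! j) < representation (set \<beta>) \<zeta> (\<beta> ! i)"
  shows "F = flag_of \<beta>"
proof (rule nth_equalityI)
  have ind: "independent (set \<beta>)" "span (set \<beta>) = dual_space v0" using b by (auto simp: is_basis_def)
  have len: "length \<beta> = CARD('v) - 1" by (rule is_basis_length[OF b])
  show "length F = length (flag_of \<beta>)" using F by (simp add: flags_def flag_of_def del: upt_Suc)
  fix j assume "j < length F"
  hence j: "j < CARD('v)" "j \<le> CARD('v) - 1" using F by (auto simp: flags_def)
  let ?B = "set \<beta> \<inter> F ! j"
  have cB: "card ?B = j" by (rule flag_step(2)[OF ind(1) F j(2)])
  have cT: "card (set (take j \<beta>)) = j" using b len j by (simp add: distinct_card is_basis_def)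
  have "?B = set (take j \<beta>)"
  proof (rule ccontr)
    assume ne: "?B \<noteq> set (take j \<beta>)"
    have "\<not> ?B \<subseteq> set (take j \<beta>)"
      using ne cB cT card_subset_eq[of "set (take j \<beta>)" ?B] by auto
    moreover have "\<not> set (take j \<beta>) \<subseteq> ?B"
      using ne cB cT card_subset_eq[of ?B "set (take j \<beta>)"] by auto
    ultimately obtain x y where x: "x \<in> ?B" "x \<notin> set (take j \<beta>)" and y: "y \<in> set (take j \<beta>)" "y \<notin> ?B"
      by blast
    have ys: "y \<in> set \<beta>" using y(1) by (rule in_set_takeD)
    have "representation (set \<beta>) \<zeta> y < representation (set \<beta>) \<zeta> x"
      using flag_cone_decreasing(2)[OF ind F \<zeta> j(2), of x y] x y ys by blast
    moreover obtain k where k: "k < length \<beta>" "x = \<beta> ! k" using x(1) by (auto simp: in_set_conv_nth)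
    moreover obtain l where l: "l < j" "l < length \<beta>" "y = \<beta> ! l" using y(1) by (auto simp: in_set_conv_nth)
    have "\<not> k < j" using k x(2) by (auto simp: in_set_conv_nth)
    hence "representation (set \<beta>) \<zeta> (\<beta> ! k) < representation (set \<beta>) \<zeta> (\<beta> ! l)"
      using l k(1) by (intro dec) auto
    ultimately show False using l k by simp
  qed
  thus "F ! j = flag_of \<beta> ! j"
    using flag_step(1)[OF ind(1) F j(2)] flag_of_nth[OF j(1)] by metis
qed

text \<open>
  Summation by parts: the coefficient of \<open>\<kappa>\<^sub>j\<close> is the difference of two consecutive coordinates of \<open>\<zeta>\<close>,
  with \<open>0\<close> following the last coordinate.
\<close>

lemma in_flag_cone_of:
  fixes \<beta> :: "(real ^ 'v::finite) list"
  assumes b: "is_basis v0 \<beta>" and \<zeta>: "\<zeta> \<in> dual_space v0"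
    and dec: "\<And>i j. i < j \<Longrightarrow> j < length \<beta> \<Longrightarrow>
      representation (set \<beta>) \<zeta> (\<beta> ! j) < representation (set \<beta>) \<zeta> (\<beta> ! i)"
    and pos: "\<And>x. x \<in> set \<beta> \<Longrightarrow> representation (set \<beta>) \<zeta> x > 0"
  shows "\<zeta> \<in> flag_cone (set \<beta>) (flag_of \<beta>)"
proof -
  define n where "n = CARD('v) - 1"
  have ind: "distinct \<beta>" "independent (set \<beta>)" "span (set \<beta>) = dual_space v0" using b by (auto simp: is_basis_def)
  have len: "length \<beta> = n" unfolding n_def by (rule is_basis_length[OF b])
  \<comment> \<open>the value \<open>0\<close> at \<open>n\<close> makes the last difference equal to the last coordinate\<close>
  define a where "a = (\<lambda>k. if k < n then representation (set \<beta>) \<zeta> (\<beta> ! k) else 0)"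
  define S where "S = (\<lambda>m. \<Sum>i<m. \<beta> ! i)"
  have kap: "kappa (set \<beta>) (flag_of \<beta>) j = S j" if "j \<le> n" for j
  proof -
    have "j < CARD('v)" using that zero_less_card_finite[where 'a = 'v] unfolding n_def by linarith
    hence "kappa (set \<beta>) (flag_of \<beta>) j = \<Sum>(set (take j \<beta>))"
      unfolding kappa_def using flag_of_inter[OF b] by simp
    also have "\<dots> = (\<Sum>i<length (take j \<beta>). take j \<beta> ! i)"
      by (rule sum.reindex_bij_betw[OF bij_betw_nth[OF _ refl refl], symmetric]) (simp add: ind(1))
    also have "\<dots> = S j" unfolding S_def using that len by (intro sum.cong) auto
    finally show ?thesis .
  qed
  have abel: "(\<Sum>j = 1..m. (a (j - 1) - a j) *\<^sub>R S j) = (\<Sum>i<m. a i *\<^sub>R \<beta> ! i) - a m *\<^sub>R S m" for m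
  proof (induction m)
    case (Suc m)
    have "S (Suc m) = S m + \<beta> ! m" by (simp add: S_def)
    thus ?case using Suc by (simp add: algebra_simps)
  qed (simp add: S_def)
  have "\<zeta> = (\<Sum>x\<in>set \<beta>. representation (set \<beta>) \<zeta> x *\<^sub>R x)"
    using sum_representation_eq[OF ind(2), of \<zeta> "set \<beta>"] \<zeta> ind(3) by simp
  also have "\<dots> = (\<Sum>i<length \<beta>. representation (set \<beta>) \<zeta> (\<beta> ! i) *\<^sub>R \<beta> ! i)"
    by (rule sum.reindex_bij_betw[OF bij_betw_nth[OF ind(1) refl refl], symmetric])
  also have "\<dots> = (\<Sum>i<n. a i *\<^sub>R \<beta> ! i) - a n *\<^sub>R S n" using len by (simp add: a_def)
  also have "\<dots> = (\<Sum>j = 1..n. (a (j - 1) - a j) *\<^sub>R kappa (set \<beta>) (flag_of \<beta>) j)"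
    unfolding abel[symmetric] by (intro sum.cong refl) (simp add: kap)
  finally have "\<zeta> = (\<Sum>j = 1..n. (a (j - 1) - a j) *\<^sub>R kappa (set \<beta>) (flag_of \<beta>) j)" .
  moreover have "a (j - 1) - a j > 0" if "j \<in> {1..n}" for j
    using that len dec[of "j - 1" j] pos[of "\<beta> ! (j - 1)"] by (auto simp: a_def)
  ultimately show ?thesis unfolding flag_cone_def n_def
    by (intro CollectI exI[of _ "\<lambda>j. a (j - 1) - a j"]) blast
qed

text \<open>
  The vectors \<open>\<kappa>\<^sub>j\<close> are the partial sums of \<open>\<beta>\<close>, so they are unitriangular with respect to \<open>\<beta>\<close>.
\<close>

lemma kappa_flag_basis:
  fixes \<beta> :: "(real ^ 'v::finite) list"
  assumes b: "is_basis v0 \<beta>"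
  defines "\<kappa> \<equiv> map (kappa (set \<beta>) (flag_of \<beta>)) [1..<CARD('v)]"
  shows "is_basis v0 \<kappa>"
    and "i < length \<beta> \<Longrightarrow> j < length \<beta> \<Longrightarrow> representation (set \<beta>) (\<kappa> ! i) (\<beta> ! j) = of_bool (j \<le> i)"
proof -
  have ind: "distinct \<beta>" "independent (set \<beta>)" "span (set \<beta>) = dual_space v0" using b by (auto simp: is_basis_def)
  have len: "length \<beta> = CARD('v) - 1" by (rule is_basis_length[OF b])
  have lk: "length \<kappa> = CARD('v) - 1" by (simp add: \<kappa>_def)
  have k: "\<kappa> ! i = \<Sum>(set (take (Suc i) \<beta>))" if "i < length \<beta>" for i
  proof -
    have "Suc i < CARD('v)" using that len by linarith
    thus ?thesis unfolding \<kappa>_def using flag_of_inter[OF b] by (simp add: kappa_def)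
  qed
  have tk: "\<beta> ! j \<in> set (take (Suc i) \<beta>) \<longleftrightarrow> j \<le> i" if "i < length \<beta>" "j < length \<beta>" for i j
    using that ind(1) by (auto simp: in_set_conv_nth nth_eq_iff_index_eq less_Suc_eq_le)
  show "representation (set \<beta>) (\<kappa> ! i) (\<beta> ! j) = of_bool (j \<le> i)"
    if "i < length \<beta>" "j < length \<beta>" for i j
    using k[OF that(1)] tk[OF that] representation_sum_subset[OF ind(2) set_take_subset] by simp
  show "is_basis v0 \<kappa>"
  proof (rule is_basis_of_spanning[OF lk])
    show "set \<kappa> \<subseteq> dual_space v0"
    proof
      fix x assume "x \<in> set \<kappa>"
      then obtain i where "i < length \<beta>" "x = \<kappa> ! i" using lk len by (metis in_set_conv_nth)
      hence "x = \<Sum>(set (take (Suc i) \<beta>))" using k by simp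
      also have "\<dots> \<in> span (set \<beta>)"
        by (intro span_sum span_base) (rule in_set_takeD)
      finally show "x \<in> dual_space v0" using ind(3) by simp
    qed
    have "\<beta> ! i \<in> span (set \<kappa>)" if i: "i < length \<beta>" for i
    proof -
      have mem: "\<kappa> ! j \<in> span (set \<kappa>)" if "j < length \<beta>" for j
        using that lk len by (intro span_base) simp
      have ins: "set (take (Suc i) \<beta>) = insert (\<beta> ! i) (set (take i \<beta>))"
        using i by (simp add: take_Suc_conv_app_nth)
      have "\<beta> ! i \<notin> set (take i \<beta>)"
        using i ind(1) by (auto simp: in_set_conv_nth nth_eq_iff_index_eq)
      hence e: "\<kappa> ! i = \<beta> ! i + \<Sum>(set (take i \<beta>))" using k[OF i] ins by simp
      show ?thesis
      proof (cases i)
        case 0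
        thus ?thesis using e mem[OF i] by simp
      next
        case (Suc m)
        hence "\<beta> ! i = \<kappa> ! i - \<kappa> ! m" using e k[of m] i by simp
        thus ?thesis using mem[OF i] mem[of m] i Suc by (simp add: span_diff)
      qed
    qed
    hence "set \<beta> \<subseteq> span (set \<kappa>)" by (auto simp: in_set_conv_nth)
    thus "dual_space v0 \<subseteq> span (set \<kappa>)"
      unfolding ind(3)[symmetric] by (rule span_minimal) (rule subspace_span)
  qed
qed

lemma span_insert_scale:
  fixes x :: "'a::real_vector"
  assumes "\<epsilon> \<noteq> 0"
  shows "span (insert (\<epsilon> *\<^sub>R x) S) = span (insert x S)"
proof -
  have "(1 / \<epsilon>) *\<^sub>R \<epsilon> *\<^sub>R x \<in> span (insert (\<epsilon> *\<^sub>R x) S)"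
    by (intro span_scale span_base) simp
  hence "x \<in> span (insert (\<epsilon> *\<^sub>R x) S)" using assms by simp
  moreover have "\<epsilon> *\<^sub>R x \<in> span (insert x S)" by (simp add: span_base span_scale)
  ultimately show ?thesis
    by (intro antisym span_minimal subspace_span) (auto intro: span_base)
qed

text \<open>
  Multiplying the first vector of \<open>\<beta>\<close> by the sign \<open>\<epsilon>\<close> makes the determinant equal to \<open>1\<close>. For the empty
  basis the determinant is \<open>1\<close> already.
\<close>

lemma ex_adapted_basis:
  fixes \<beta> :: "(real ^ 'v::finite) list"
  assumes b: "is_basis v0 \<beta>" and d: "distinct d" "set d = set \<beta>"
  shows "\<exists>\<gamma>. adapted_basis v0 d (flag_of \<beta>) \<gamma>"
proof -
  have ind: "distinct \<beta>" "independent (set \<beta>)" "span (set \<beta>) = dual_space v0" using b by (auto simp: is_basis_def)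
  have len: "length \<beta> = CARD('v) - 1" by (rule is_basis_length[OF b])
  have pos: "CARD('v) > 0" by simp
  obtain \<epsilon> :: real where \<epsilon>: "\<epsilon> \<in> {1, -1}" and w: "\<And>g.
     (\<forall>j<length \<beta>. \<forall>i<j. representation (set \<beta>) (g ! i) (\<beta> ! j) = 0) \<Longrightarrow>
     wedge_ratio d g = \<epsilon> * (\<Prod>i<length \<beta>. representation (set \<beta>) (g ! i) (\<beta> ! i))"
    using wedge_ratio_triangular[OF ind(1) d] by blast
  have \<epsilon>0: "\<epsilon> \<noteq> 0" "\<epsilon> * \<epsilon> = 1" using \<epsilon> by auto
  define \<gamma> where "\<gamma> = (case \<beta> of [] \<Rightarrow> [] | x # xs \<Rightarrow> (\<epsilon> *\<^sub>R x) # xs)"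
  have span: "span (set (take m \<gamma>)) = span (set (take m \<beta>))" for m
    using span_insert_scale[OF \<epsilon>0(1)] by (cases \<beta>; cases m) (auto simp: \<gamma>_def)
  have lg: "length \<gamma> = length \<beta>" by (cases \<beta>) (auto simp: \<gamma>_def)
  have sp: "span (set \<gamma>) = dual_space v0" using span[of "length \<beta>"] lg ind(3) by simp
  have "is_basis v0 \<gamma>"
    by (rule is_basis_of_spanning) (use lg len sp span_superset in auto)
  moreover have "\<forall>m\<le>CARD('v) - 1. span (set (take m \<gamma>)) = flag_of \<beta> ! m"
  proof (intro allI impI)
    fix m assume "m \<le> CARD('v) - 1"
    hence "m < CARD('v)" using pos by linarith
    thus "span (set (take m \<gamma>)) = flag_of \<beta> ! m" using span by (simp add: flag_of_nth)
  qed
  moreover have "wedge_ratio d \<gamma> = 1"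
  proof -
    have mem: "\<beta> ! i \<in> span (set \<beta>)" if "i < length \<beta>" for i using that by (simp add: span_base)
    have g: "\<gamma> ! i = (if i = 0 then \<epsilon> else 1) *\<^sub>R \<beta> ! i" if "i < length \<beta>" for i
      using that by (cases \<beta>; cases i) (auto simp: \<gamma>_def)
    have rep: "representation (set \<beta>) (\<gamma> ! i) (\<beta> ! j) = (if i = j then if i = 0 then \<epsilon> else 1 else 0)"
      if "i < length \<beta>" "j < length \<beta>" for i j
      using that ind(1,2) g[OF that(1)] mem[OF that(1)]
      by (simp add: representation_scale representation_basis nth_eq_iff_index_eq)
    have "wedge_ratio d \<gamma> = \<epsilon> * (\<Prod>i<length \<beta>. representation (set \<beta>) (\<gamma> ! i) (\<beta> ! i))"
      by (rule w) (use rep in auto)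
    also have "(\<Prod>i<length \<beta>. representation (set \<beta>) (\<gamma> ! i) (\<beta> ! i)) = (\<Prod>i<length \<beta>. if i = 0 then \<epsilon> else 1)"
      using rep by (intro prod.cong) auto
    also have "\<dots> = (if \<beta> = [] then 1 else \<epsilon>)" by (simp add: prod.delta)
    finally have *: "wedge_ratio d \<gamma> = \<epsilon> * (if \<beta> = [] then 1 else \<epsilon>)" .
    show ?thesis
    proof (cases "\<beta> = []")
      case True
      thus ?thesis using d by (simp add: wedge_ratio_def \<gamma>_def)
    next
      case False
      thus ?thesis using * \<epsilon>0(2) by simp
    qed
  qed
  ultimately show ?thesis unfolding adapted_basis_def by blast
qed

lemma ex_decreasing_list:
  fixes a :: "'b \<Rightarrow> real"
  assumes "finite A" "inj_on a A"
  shows "\<exists>\<beta>. distinct \<beta> \<and> set \<beta> = A \<and> (\<forall>i j. i < j \<longrightarrow> j < length \<beta> \<longrightarrow> a (\<beta> ! j) < a (\<beta> ! i))"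
proof -
  obtain xs where xs: "distinct xs" "set xs = A" using finite_distinct_list[OF assms(1)] by blast
  define \<beta> where "\<beta> = sort_key (\<lambda>b. - a b) xs"
  have d: "distinct \<beta>" "set \<beta> = A" using xs by (auto simp: \<beta>_def)
  have "sorted (map (\<lambda>b. - a b) \<beta>)" unfolding \<beta>_def by (rule sorted_sort_key)
  hence le: "a (\<beta> ! j) \<le> a (\<beta> ! i)" if "i < j" "j < length \<beta>" for i j
    using that sorted_nth_mono[of "map (\<lambda>b. - a b) \<beta>" i j] by simp
  have "a (\<beta> ! j) < a (\<beta> ! i)" if "i < j" "j < length \<beta>" for i j
  proof -
    have "\<beta> ! i \<noteq> \<beta> ! j" using that d(1) by (simp add: nth_eq_iff_index_eq)
    hence "a (\<beta> ! i) \<noteq> a (\<beta> ! j)"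
      using assms(2) d(2) that by (metis inj_onD nth_mem order.strict_trans)
    thus ?thesis using le[OF that] by simp
  qed
  thus ?thesis using d by blast
qed

text \<open>
  The only flag that can contribute belongs to the ordering \<open>\<beta>\<close> of the basis by decreasing
  coordinates of \<open>\<zeta>\<close>. Its sign is \<open>\<epsilon>\<close>, the sign of the ordering. An adapted basis \<open>\<gamma>\<close> has determinant
  \<open>\<epsilon>\<close> with respect to \<open>\<beta>\<close>, so that its iterated residue is \<open>\<epsilon>\<close> times the one in the coordinates of
  the basis, and the signs cancel.
\<close>

lemma JK_residue_simplicial:
  fixes \<beta>0 d :: "(real ^ 'v::finite) list"
  assumes b0: "is_basis v0 \<beta>0" and d: "is_basis v0 d" "set d = set \<beta>0"
    and \<zeta>: "\<zeta> \<in> dual_space v0" and inj: "inj_on (representation (set \<beta>0) \<zeta>) (set \<beta>0)"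
    and f: "regular_germ v0 (set \<beta>0) f"
  shows "JK_residue v0 d (set \<beta>0) \<zeta> f =
    (if \<forall>x\<in>set \<beta>0. representation (set \<beta>0) \<zeta> x > 0
     then iterated_residue (CARD('v) - 1) (in_coords v0 \<beta>0 f) else 0)"
proof -
  obtain \<beta> where \<beta>: "distinct \<beta>" "set \<beta> = set \<beta>0" and
    dec: "\<And>i j. i < j \<Longrightarrow> j < length \<beta> \<Longrightarrow>
      representation (set \<beta>) \<zeta> (\<beta> ! j) < representation (set \<beta>) \<zeta> (\<beta> ! i)"
    using ex_decreasing_list[OF finite_set inj] by metis
  have b: "is_basis v0 \<beta>" using b0 \<beta> by (simp add: is_basis_def)
  have ind: "independent (set \<beta>)" "span (set \<beta>) = dual_space v0" using b by (auto simp: is_basis_def)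
  let ?Fs = "{F. F \<in> flags v0 (set \<beta>) \<and> \<zeta> \<in> flag_cone (set \<beta>) F}"
  have JK: "JK_residue v0 d (set \<beta>0) \<zeta> f = (\<Sum>F\<in>?Fs.
      complex_of_real (flag_sign v0 d (set \<beta>) F) * flag_residue v0 d F f)"
    by (simp add: JK_residue_def \<beta>(2))
  show ?thesis
  proof (cases "\<forall>x\<in>set \<beta>0. representation (set \<beta>0) \<zeta> x > 0")
    case False
    hence "?Fs = {}" using flag_cone_decreasing(1)[OF ind] \<beta>(2) by auto
    hence "JK_residue v0 d (set \<beta>0) \<zeta> f = 0" unfolding JK by (simp only: sum.empty)
    thus ?thesis using False by (simp only: if_False)
  next
    case True
    hence pos: "representation (set \<beta>) \<zeta> x > 0" if "x \<in> set \<beta>" for x using that \<beta>(2) by auto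
    have Fs: "?Fs = {flag_of \<beta>}"
    proof (intro equalityI subsetI)
      fix F assume "F \<in> ?Fs"
      hence F: "F \<in> flags v0 (set \<beta>)" "\<zeta> \<in> flag_cone (set \<beta>) F" by simp_all
      have "F = flag_of \<beta>" by (rule flag_of_unique[OF b F dec])
      thus "F \<in> {flag_of \<beta>}" by simp
    next
      fix F assume "F \<in> {flag_of \<beta>}"
      thus "F \<in> ?Fs" using flag_of_in_flags[OF b] in_flag_cone_of[OF b \<zeta> dec pos] by simp
    qed
    have dd: "distinct d" "set d = set \<beta>" using d \<beta>(2) by (auto simp: is_basis_def)
    obtain \<epsilon> :: real where \<epsilon>: "\<epsilon> \<in> {1, -1}" and w: "\<And>g.
       (\<forall>j<length \<beta>. \<forall>i<j. representation (set \<beta>) (g ! i) (\<beta> ! j) = 0) \<Longrightarrow>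
       wedge_ratio d g = \<epsilon> * (\<Prod>i<length \<beta>. representation (set \<beta>) (g ! i) (\<beta> ! i))"
      using wedge_ratio_triangular[OF \<beta>(1) dd] by blast
    have sgn: "flag_sign v0 d (set \<beta>) (flag_of \<beta>) = \<epsilon>"
    proof -
      define \<kappa> where "\<kappa> = map (kappa (set \<beta>) (flag_of \<beta>)) [1..<CARD('v)]"
      note k = kappa_flag_basis[OF b, folded \<kappa>_def]
      have "wedge_ratio d \<kappa> = \<epsilon> * (\<Prod>i<length \<beta>. representation (set \<beta>) (\<kappa> ! i) (\<beta> ! i))"
        by (rule w) (use k(2) in auto)
      also have "\<dots> = \<epsilon>" using k(2) by simp
      finally have "sgn (wedge_ratio d \<kappa>) = \<epsilon>" using \<epsilon> by auto
      thus ?thesis unfolding flag_sign_def \<kappa>_def[symmetric] Let_def using k(1) by simp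
    qed
    define \<gamma> where "\<gamma> = (SOME \<gamma>. adapted_basis v0 d (flag_of \<beta>) \<gamma>)"
    have \<gamma>: "adapted_basis v0 d (flag_of \<beta>) \<gamma>" unfolding \<gamma>_def
      by (rule someI_ex, rule ex_adapted_basis[OF b]) (use d \<beta>(2) in \<open>auto simp: is_basis_def\<close>)
    have g: "is_basis v0 \<gamma>" and wg: "wedge_ratio d \<gamma> = 1" using \<gamma> by (auto simp: adapted_basis_def)
    have len: "length \<beta> = CARD('v) - 1" "length \<gamma> = CARD('v) - 1" "length \<beta>0 = CARD('v) - 1"
      using is_basis_length b g b0 by blast+
    have sf: "same_flag \<beta> \<gamma>" unfolding same_flag_def
    proof (intro allI impI)
      fix m assume m: "m \<le> length \<beta>"
      hence "m < CARD('v)" using len zero_less_card_finite[where 'a = 'v] by linarith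
      thus "span (set (take m \<gamma>)) = span (set (take m \<beta>))"
        using \<gamma> m len(1) unfolding adapted_basis_def by (simp add: flag_of_nth)
    qed
    have "wedge_ratio d \<gamma> = \<epsilon> * (\<Prod>i<length \<beta>. representation (set \<beta>) (\<gamma> ! i) (\<beta> ! i))"
      by (rule w) (use representation_same_flag_zero[OF b g sf] in blast)
    hence prod: "\<epsilon> * (\<Prod>i<length \<beta>. representation (set \<beta>) (\<gamma> ! i) (\<beta> ! i)) = 1" using wg by simp
    have "flag_residue v0 d (flag_of \<beta>) f = iterated_residue (length \<gamma>) (in_coords v0 \<gamma> f)"
      by (simp add: flag_residue_def \<gamma>_def[symmetric] len)
    also have "\<dots> = of_real (\<Prod>i<length \<beta>. representation (set \<beta>) (\<gamma> ! i) (\<beta> ! i)) *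
        iterated_residue (length \<beta>0) (in_coords v0 \<beta>0 f)"
      by (rule iterated_residue_same_flag[OF b g sf b0]) (use f \<beta>(2) in auto)
    finally have "complex_of_real \<epsilon> * flag_residue v0 d (flag_of \<beta>) f =
        of_real (\<epsilon> * (\<Prod>i<length \<beta>. representation (set \<beta>) (\<gamma> ! i) (\<beta> ! i))) *
        iterated_residue (length \<beta>0) (in_coords v0 \<beta>0 f)" by (simp add: mult.assoc)
    thus ?thesis unfolding JK Fs prod using True by (simp add: sgn len(3))
  qed
qed

section \<open>Spanning trees, bases of weights and stability\<close>

text \<open>
  The set of vertices reachable from a vertex is not separated from its complement, so this
  characterises connectedness by cuts. Cuts are what pairs well with weights: the indicator function
  of such a set is orthogonal to the weights of all arrows.
\<close>

lemma connected_iff_no_separation: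
  fixes T :: "('v, 'b) pre_digraph"
  assumes "verts T = UNIV"
  shows "Digraph_Component.connected T \<longleftrightarrow>
    (\<forall>Z. (\<forall>a\<in>arcs T. tail T a \<in> Z \<longleftrightarrow> head T a \<in> Z) \<longrightarrow> Z = {} \<or> Z = UNIV)"
proof
  assume c: "Digraph_Component.connected T"
  show "\<forall>Z. (\<forall>a\<in>arcs T. tail T a \<in> Z \<longleftrightarrow> head T a \<in> Z) \<longrightarrow> Z = {} \<or> Z = UNIV"
  proof (intro allI impI)
    fix Z assume Z: "\<forall>a\<in>arcs T. tail T a \<in> Z \<longleftrightarrow> head T a \<in> Z"
    have "v \<in> Z" if u: "u \<in> Z" for u v
    proof -
      have "(u, v) \<in> rtrancl_on UNIV ((arcs_ends T)\<^sup>s)"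
        using c assms unfolding connected_conv by simp
      thus ?thesis
        by (induction rule: rtrancl_on_induct)
          (use u Z in \<open>auto simp: symcl_def arcs_ends_def arc_to_ends_def\<close>)
    qed
    thus "Z = {} \<or> Z = UNIV" by blast
  qed
next
  assume sep: "\<forall>Z. (\<forall>a\<in>arcs T. tail T a \<in> Z \<longleftrightarrow> head T a \<in> Z) \<longrightarrow> Z = {} \<or> Z = UNIV"
  have "(u, v) \<in> rtrancl_on UNIV ((arcs_ends T)\<^sup>s)" for u v
  proof -
    let ?Z = "{v. (u, v) \<in> rtrancl_on UNIV ((arcs_ends T)\<^sup>s)}"
    have "\<forall>a\<in>arcs T. tail T a \<in> ?Z \<longleftrightarrow> head T a \<in> ?Z"
    proof
      fix a assume "a \<in> arcs T"
      hence "(tail T a, head T a) \<in> (arcs_ends T)\<^sup>s" "(head T a, tail T a) \<in> (arcs_ends T)\<^sup>s"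
        by (auto simp: symcl_def arcs_ends_def arc_to_ends_def)
      thus "tail T a \<in> ?Z \<longleftrightarrow> head T a \<in> ?Z"
        using rtrancl_on_into_rtrancl_on[of u _ UNIV "(arcs_ends T)\<^sup>s"] by blast
    qed
    moreover have "u \<in> ?Z" by simp
    ultimately have "?Z = UNIV" using sep by blast
    thus ?thesis by blast
  qed
  thus "Digraph_Component.connected T" using assms unfolding connected_conv by auto
qed

lemma weight_in_dual_space: "weight v0 G a \<in> dual_space v0"
  by (simp add: weight_def dual_space_def)

lemma weight_inner:
  fixes u :: "real ^ 'v::finite"
  assumes "u $ v0 = 0"
  shows "weight v0 G a \<bullet> u = u $ head G a - u $ tail G a"
proof -
  have "weight v0 G a \<bullet> u = (\<Sum>v\<in>UNIV. of_bool (v = head G a) * u $ v - of_bool (v = tail G a) * u $ v)"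
    unfolding inner_vec_def weight_def using assms by (intro sum.cong) (auto simp: algebra_simps)
  thus ?thesis by (simp add: sum_subtractf)
qed

lemma weight_pairing:
  fixes u :: "complex ^ 'v::finite"
  assumes "u \<in> cspace v0"
  shows "pairing (weight v0 G a) u = u $ head G a - u $ tail G a"
proof -
  have "pairing (weight v0 G a) u = (\<Sum>v\<in>UNIV. of_bool (v = head G a) * u $ v - of_bool (v = tail G a) * u $ v)"
    unfolding pairing_def weight_def using assms by (intro sum.cong) (auto simp: algebra_simps cspace_def)
  thus ?thesis by (simp add: sum_subtractf)
qed

text \<open>
  The situation of a reduced quiver without loops, where arrows are pairs of vertices.
\<close>

locale loopfree_pairs =
  fixes G :: "('v::finite, 'v \<times> 'v) pre_digraph" and v0 :: 'v
  assumes verts_G: "verts G = UNIV" and tail_G: "tail G = fst" and head_G: "head G = snd"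
    and no_loop: "a \<in> arcs G \<Longrightarrow> fst a \<noteq> snd a"
begin

lemma wf_G: "wf_digraph G" by unfold_locales (simp_all add: verts_G)

text \<open>
  An arrow can be read off from its weight: a missing entry \<open>1\<close> or \<open>-1\<close> means that the head or the
  tail is \<open>v0\<close>, and since there are no loops at most one of them is missing.
\<close>

lemma inj_weight: "inj_on (weight v0 G) (arcs G)"
proof (rule inj_onI)
  fix a b assume ab: "a \<in> arcs G" "b \<in> arcs G" and eq: "weight v0 G a = weight v0 G b"
  have comp: "(of_bool (v = snd a) - of_bool (v = fst a) :: real) = of_bool (v = snd b) - of_bool (v = fst b)"
    if "v \<noteq> v0" for v
    using arg_cong[OF eq, of "\<lambda>x. x $ v"] that by (simp add: weight_def tail_G head_G)
  have la: "fst a \<noteq> snd a" "fst b \<noteq> snd b" using ab no_loop by auto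
  have h: "snd a = snd b"
  proof (rule ccontr)
    assume ne: "snd a \<noteq> snd b"
    have "snd a = v0"
    proof (rule ccontr)
      assume "snd a \<noteq> v0"
      from comp[OF this] show False using ne la by (cases "snd a = fst b") auto
    qed
    moreover have "snd b = v0"
    proof (rule ccontr)
      assume "snd b \<noteq> v0"
      from comp[OF this] show False using ne la by (cases "snd b = fst a") auto
    qed
    ultimately show False using ne by simp
  qed
  have "fst a = fst b"
  proof (rule ccontr)
    assume ne: "fst a \<noteq> fst b"
    have "fst a = v0"
    proof (rule ccontr)
      assume "fst a \<noteq> v0"
      from comp[OF this] show False using ne la h by (cases "fst a = snd b") auto
    qed
    moreover have "fst b = v0"
    proof (rule ccontr)
      assume "fst b \<noteq> v0"
      from comp[OF this] show False using ne la h by (cases "fst b = snd a") auto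
    qed
    ultimately show False using ne by simp
  qed
  thus "a = b" using h by (simp add: prod_eq_iff)
qed

lemma spanning_tree_facts:
  assumes "T \<in> spanning_trees G"
  shows "verts T = UNIV" "tail T = fst" "head T = snd" "arcs T \<subseteq> arcs G"
    "Digraph_Component.connected T" "card (arcs T) = CARD('v) - 1" "weight v0 T = weight v0 G"
  using assms by (auto simp: spanning_trees_def spanning_def subgraph_def compatible_def
      verts_G tail_G head_G weight_def fun_eq_iff)

lemma spanning_tree_eqI:
  assumes "T \<in> spanning_trees G" "T' \<in> spanning_trees G" "arcs T = arcs T'"
  shows "T = T'"
  using spanning_tree_facts[OF assms(1)] spanning_tree_facts[OF assms(2)] assms(3)
  by (intro pre_digraph.equality) auto

lemma finite_spanning_trees: "finite (spanning_trees G)"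
proof (rule finite_imageD)
  show "inj_on arcs (spanning_trees G)" by (intro inj_onI spanning_tree_eqI)
qed (rule finite)

text \<open>
  A vector orthogonal to all weights of the tree is a function constant along its arrows that
  vanishes at \<open>v0\<close>, so it is zero by connectedness. Thus the \<open>n\<close> weights span the space.
\<close>

lemma weights_of_tree_basis:
  assumes T: "T \<in> spanning_trees G"
  shows "independent (weight v0 T ` arcs T)" "span (weight v0 T ` arcs T) = dual_space v0"
proof -
  note f = spanning_tree_facts[OF T]
  let ?S = "weight v0 T ` arcs T"
  have sub: "?S \<subseteq> dual_space v0" using weight_in_dual_space by auto
  have "span ?S \<subseteq> dual_space v0" by (rule span_minimal[OF sub subspace_dual_space])
  moreover have "\<not> span ?S \<subset> dual_space v0"
  proof
    assume "span ?S \<subset> dual_space v0"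
    moreover have spV: "span (dual_space v0) = dual_space v0" using subspace_dual_space span_eq_iff by blast
    ultimately have "span ?S \<subset> span (dual_space v0)" by (simp only: spV)
    then obtain u where u: "u \<noteq> 0" "u \<in> span (dual_space v0)" "\<And>y. y \<in> span ?S \<Longrightarrow> orthogonal u y"
      using orthogonal_to_subspace_exists_gen by blast
    have u0: "u $ v0 = 0" using u(2) unfolding spV by (simp add: dual_space_def)
    have "u $ head T a = u $ tail T a" if "a \<in> arcs T" for a
    proof -
      have "weight v0 T a \<bullet> u = 0"
        using u(3)[OF span_base, of "weight v0 T a"] that by (simp add: orthogonal_def inner_commute)
      thus ?thesis using weight_inner[OF u0, of T a] by simp
    qed
    hence "\<forall>a\<in>arcs T. tail T a \<in> {v. u $ v = 0} \<longleftrightarrow> head T a \<in> {v. u $ v = 0}" by simp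
    hence "{v. u $ v = 0} = {} \<or> {v. u $ v = 0} = UNIV"
      using f(5) unfolding connected_iff_no_separation[OF f(1)] by blast
    hence "{v. u $ v = 0} = UNIV" using u0 by blast
    thus False using u(1) by (auto simp: vec_eq_iff)
  qed
  ultimately show span: "span ?S = dual_space v0" by blast
  have "card ?S \<le> card (arcs T)" by (rule card_image_le) simp
  thus "independent ?S"
    using f(6) span by (intro card_le_dim_spanning[OF sub]) (auto simp: dim_dual_space)
qed

text \<open>
  If the arrows did not connect all vertices, the indicator function of a part not containing \<open>v0\<close>
  would be a nonzero vector orthogonal to the basis.
\<close>

lemma tree_of_basis:
  assumes B: "B \<subseteq> weight v0 G ` arcs G" "independent B" "span B = dual_space v0"
  shows "\<exists>T\<in>spanning_trees G. weight v0 T ` arcs T = B"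
proof -
  define E where "E = {a \<in> arcs G. weight v0 G a \<in> B}"
  define T where "T = \<lparr>verts = UNIV, arcs = E, tail = fst, head = snd\<rparr>"
  have w: "weight v0 T = weight v0 G" by (simp add: fun_eq_iff weight_def T_def tail_G head_G)
  have im: "weight v0 G ` E = B" using B(1) by (auto simp: E_def)
  have "card E = card B"
    using card_image[OF inj_on_subset[OF inj_weight, of E]] im by (auto simp: E_def)
  also have "\<dots> = CARD('v) - 1"
    using dim_span_eq_card_independent[OF B(2)] B(3) by (simp add: dim_dual_space)
  finally have card: "card E + 1 = CARD('v)" using zero_less_card_finite[where 'a = 'v] by linarith
  have "Digraph_Component.connected T"
    unfolding connected_iff_no_separation[of T, unfolded T_def, simplified, folded T_def]
  proof (intro allI impI)
    fix Z :: "'v set" assume Z: "\<forall>a\<in>E. (fst a \<in> Z) = (snd a \<in> Z)"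
    \<comment> \<open>the indicator function must vanish at \<open>v0\<close>\<close>
    define Z' where "Z' = (if v0 \<in> Z then - Z else Z)"
    define u :: "real ^ 'v" where "u = (\<chi> v. of_bool (v \<in> Z'))"
    have u0: "u $ v0 = 0" by (auto simp: u_def Z'_def)
    have "orthogonal u b" if b: "b \<in> B" for b
    proof -
      obtain a where a: "a \<in> E" "b = weight v0 G a" using b im by blast
      have "u $ snd a = u $ fst a" using bspec[OF Z a(1)] by (auto simp: u_def Z'_def)
      thus ?thesis using weight_inner[OF u0, of G a] by (simp add: orthogonal_def inner_commute a(2) tail_G head_G)
    qed
    moreover have "u \<in> span B" using u0 B(3) by (simp add: dual_space_def)
    ultimately have "orthogonal u u" using orthogonal_to_span by blast
    hence "u = 0" by (simp add: orthogonal_self)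
    hence "Z' = {}" by (auto simp: u_def vec_eq_iff)
    thus "Z = {} \<or> Z = UNIV" by (auto simp: Z'_def split: if_splits)
  qed
  moreover have "wf_digraph T" by unfold_locales (simp_all add: T_def)
  ultimately have "T \<in> spanning_trees G"
    using card wf_G by (auto simp: spanning_trees_def spanning_def subgraph_def compatible_def T_def
        verts_G tail_G head_G E_def)
  moreover have "weight v0 T ` arcs T = B" using im w by (simp add: T_def)
  ultimately show ?thesis by blast
qed

text \<open>
  Pair \<open>-\<theta>\<close> with the indicator function of \<open>Z\<close>, shifted by a constant to vanish at \<open>v0\<close>; the shift is
  harmless because the entries of \<open>\<theta>\<close> add up to zero.
\<close>

lemma theta_of_vertex_set:
  fixes \<theta> :: "real ^ 'v"
  assumes T: "T \<in> spanning_trees G" and \<theta>: "(\<Sum>v\<in>UNIV. \<theta> $ v) = 0"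
  shows "- (\<Sum>v\<in>Z. \<theta> $ v) = (\<Sum>a\<in>arcs T.
    representation (weight v0 T ` arcs T) (- theta_tilde v0 \<theta>) (weight v0 T a) *
      (of_bool (snd a \<in> Z) - of_bool (fst a \<in> Z)))"
proof -
  note f = spanning_tree_facts[OF T]
  let ?S = "weight v0 T ` arcs T" and ?r = "representation (weight v0 T ` arcs T) (- theta_tilde v0 \<theta>)"
  define k :: real where "k = of_bool (v0 \<in> Z)"
  define u :: "real ^ 'v" where "u = (\<chi> v. of_bool (v \<in> Z) - k)"
  have u0: "u $ v0 = 0" by (simp add: u_def k_def)
  have tt: "theta_tilde v0 \<theta> \<in> dual_space v0" by (simp add: theta_tilde_def dual_space_def)
  have "theta_tilde v0 \<theta> \<bullet> u = (\<Sum>v\<in>UNIV. \<theta> $ v * (of_bool (v \<in> Z) - k))"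
    unfolding inner_vec_def using u0 by (intro sum.cong) (auto simp: theta_tilde_def u_def)
  also have "\<dots> = (\<Sum>v\<in>UNIV. \<theta> $ v * of_bool (v \<in> Z)) - (\<Sum>v\<in>UNIV. \<theta> $ v) * k"
    by (simp add: algebra_simps sum_subtractf sum_distrib_left)
  also have "\<dots> = (\<Sum>v\<in>Z. \<theta> $ v)" using \<theta> by (simp add: sum.If_cases of_bool_def if_distrib[of "\<lambda>x. _ * x"] cong: if_cong)
  finally have 1: "- (\<Sum>v\<in>Z. \<theta> $ v) = (- theta_tilde v0 \<theta>) \<bullet> u" by simp
  have "- theta_tilde v0 \<theta> \<in> span ?S"
    using tt weights_of_tree_basis(2)[OF T] subspace_dual_space subspace_neg by blast
  hence "- theta_tilde v0 \<theta> = (\<Sum>\<rho>\<in>?S. ?r \<rho> *\<^sub>R \<rho>)"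
    using sum_representation_eq[OF weights_of_tree_basis(1)[OF T], of "- theta_tilde v0 \<theta>" ?S] by simp
  hence "(- theta_tilde v0 \<theta>) \<bullet> u = (\<Sum>\<rho>\<in>?S. ?r \<rho> *\<^sub>R \<rho>) \<bullet> u" by (rule arg_cong)
  also have "\<dots> = (\<Sum>\<rho>\<in>?S. ?r \<rho> * (\<rho> \<bullet> u))" by (simp add: inner_sum_left)
  also have "\<dots> = (\<Sum>a\<in>arcs T. ?r (weight v0 T a) * (weight v0 T a \<bullet> u))"
    by (rule sum.reindex_cong[where l = "weight v0 T"])
      (use inj_on_subset[OF inj_weight f(4)] f(7) in auto)
  also have "\<dots> = (\<Sum>a\<in>arcs T. ?r (weight v0 T a) * (of_bool (snd a \<in> Z) - of_bool (fst a \<in> Z)))"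
    by (intro sum.cong refl) (simp add: weight_inner[OF u0] f(2,3), simp add: u_def)
  finally show ?thesis using 1 by simp
qed

lemma subspace_complex_line:
  assumes "module.subspace ((*) :: complex \<Rightarrow> complex \<Rightarrow> complex) S"
  shows "S = {0} \<or> S = UNIV"
proof (cases "\<exists>z\<in>S. z \<noteq> 0")
  case True
  then obtain z where z: "z \<in> S" "z \<noteq> 0" by blast
  have "w \<in> S" for w
  proof -
    have "(w / z) * z \<in> S" using assms z(1) unfolding vector_space_over_itself.subspace_def by blast
    thus ?thesis using z(2) by simp
  qed
  thus ?thesis by blast
next
  case False
  moreover have "0 \<in> S" using assms unfolding vector_space_over_itself.subspace_def by blast
  ultimately show ?thesis by blast
qed

lemma dim_complex_line:
  "vector_space.dim ((*) :: complex \<Rightarrow> complex \<Rightarrow> complex) UNIV = 1"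
  "vector_space.dim ((*) :: complex \<Rightarrow> complex \<Rightarrow> complex) {0} = 0"
  by (simp_all add: vector_space_over_itself.dim_UNIV)

text \<open>
  If \<open>T\<close> is stable, apply stability to the vertices that lie beyond an arrow \<open>a0\<close>: the vector dual to the
  weight of \<open>a0\<close> is constant on the two sides of \<open>a0\<close>, and its upper side supports a
  subrepresentation of every representation. By \<open>theta_of_vertex_set\<close> the value of \<open>-\<theta>\<close> on this side is
  the coordinate at \<open>a0\<close>. Conversely, for positive coordinates the representation with all maps equal
  to \<open>1\<close> is stable: the support \<open>Z\<close> of a subrepresentation is closed under arrows, so only
  nonnegative terms occur in \<open>theta_of_vertex_set\<close>, and some arrow enters \<open>Z\<close>
  because \<open>T\<close> is connected.
\<close>

lemma stable_tree_iff:
  fixes \<theta> :: "real ^ 'v"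
  assumes T: "T \<in> spanning_trees G" and \<theta>: "(\<Sum>v\<in>UNIV. \<theta> $ v) = 0"
  shows "stable_moduli \<theta> T \<noteq> {} \<longleftrightarrow>
    (\<forall>\<rho>\<in>weight v0 T ` arcs T. representation (weight v0 T ` arcs T) (- theta_tilde v0 \<theta>) \<rho> > 0)"
proof -
  note f = spanning_tree_facts[OF T]
  let ?S = "weight v0 T ` arcs T" and ?r = "representation (weight v0 T ` arcs T) (- theta_tilde v0 \<theta>)"
  note th = theta_of_vertex_set[OF T \<theta>]
  have inj: "inj_on (weight v0 T) (arcs T)" using inj_on_subset[OF inj_weight f(4)] f(7) by simp
  have "stable_moduli \<theta> T \<noteq> {} \<longleftrightarrow> stable_reps \<theta> T \<noteq> {}"
    by (auto simp: stable_moduli_def quotient_def)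
  also have "\<dots> \<longleftrightarrow> (\<forall>\<rho>\<in>?S. ?r \<rho> > 0)"
  proof
    assume "stable_reps \<theta> T \<noteq> {}"
    then obtain \<phi> where \<phi>: "\<And>S. is_subrep T \<phi> S \<Longrightarrow> (\<exists>v\<in>verts T. S v \<noteq> {0}) \<Longrightarrow> (\<exists>v\<in>verts T. S v \<noteq> UNIV) \<Longrightarrow>
        (\<Sum>v\<in>verts T. \<theta> $ v * real (vector_space.dim ((*) :: complex \<Rightarrow> complex \<Rightarrow> complex) (S v))) < 0"
      unfolding stable_reps_def by blast
    show "\<forall>\<rho>\<in>?S. ?r \<rho> > 0"
    proof
      fix \<rho> assume "\<rho> \<in> ?S"
      then obtain a0 where a0: "a0 \<in> arcs T" "\<rho> = weight v0 T a0" by blast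
      define u where "u = (\<lambda>v. Re (dual_vec v0 ?S \<rho> $ v))"
      have u: "u (snd a) - u (fst a) = of_bool (a = a0)" if a: "a \<in> arcs T" for a
      proof -
        have "pairing (weight v0 T a) (dual_vec v0 ?S \<rho>) = of_real (representation ?S (weight v0 T a) \<rho>)"
          by (rule pairing_dual_vec[OF weights_of_tree_basis[OF T] weight_in_dual_space])
        also have "representation ?S (weight v0 T a) \<rho> = of_bool (a = a0)"
          using a a0 inj by (auto simp: representation_basis[OF weights_of_tree_basis(1)[OF T]] inj_on_eq_iff)
        finally have "dual_vec v0 ?S \<rho> $ snd a - dual_vec v0 ?S \<rho> $ fst a = of_real (of_bool (a = a0))"
          unfolding weight_pairing[OF dual_vec_in_cspace] f(2,3) .
        thus ?thesis unfolding u_def by (metis Re_complex_of_real minus_complex.sel(1))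
      qed
      \<comment> \<open>\<open>u\<close> increases by one along \<open>a0\<close> and is constant along all other arrows\<close>
      define Z where "Z = {v. u v > u (fst a0)}"
      have Z0: "snd a0 \<in> Z" "fst a0 \<notin> Z" using u[OF a0(1)] by (auto simp: Z_def)
      have closed: "snd a \<in> Z" if "a \<in> arcs T" "fst a \<in> Z" for a
        using u[OF that(1)] that(2) by (auto simp: Z_def of_bool_def split: if_splits)
      define S :: "'v \<Rightarrow> complex set" where "S = (\<lambda>v. if v \<in> Z then UNIV else {0})"
      have "is_subrep T \<phi> S" unfolding is_subrep_def f(2,3)
      proof (intro conjI ballI)
        show "module.subspace ((*) :: complex \<Rightarrow> complex \<Rightarrow> complex) (S v)" for v
          by (simp add: S_def vector_space_over_itself.subspace_def)
        show "(\<lambda>z. \<phi> a * z) ` S (fst a) \<subseteq> S (snd a)" if "a \<in> arcs T" for a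
          using closed[OF that] by (auto simp: S_def)
      qed
      moreover have "S (snd a0) \<noteq> {0}" "S (fst a0) \<noteq> UNIV"
        using Z0 infinite_UNIV_char_0[where 'a = complex] by (auto simp: S_def)
      ultimately have "(\<Sum>v\<in>UNIV. \<theta> $ v * real (vector_space.dim ((*) :: complex \<Rightarrow> complex \<Rightarrow> complex) (S v))) < 0"
        using \<phi>[of S] unfolding f(1) by blast
      also have "(\<Sum>v\<in>UNIV. \<theta> $ v * real (vector_space.dim ((*) :: complex \<Rightarrow> complex \<Rightarrow> complex) (S v))) =
          (\<Sum>v\<in>UNIV. if v \<in> Z then \<theta> $ v else 0)"
        by (intro sum.cong refl) (simp add: S_def dim_complex_line)
      also have "\<dots> = (\<Sum>v\<in>Z. \<theta> $ v)" by (simp add: sum.If_cases)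
      finally have "0 < - (\<Sum>v\<in>Z. \<theta> $ v)" by simp
      also have "\<dots> = (\<Sum>a\<in>arcs T. if a = a0 then ?r \<rho> else 0)"
        unfolding th
      proof (intro sum.cong refl)
        fix a assume a: "a \<in> arcs T"
        show "?r (weight v0 T a) * (of_bool (snd a \<in> Z) - of_bool (fst a \<in> Z)) = (if a = a0 then ?r \<rho> else 0)"
        proof (cases "a = a0")
          case True
          thus ?thesis using Z0 a0(2) by simp
        next
          case False
          hence "u (snd a) = u (fst a)" using u[OF a] by simp
          thus ?thesis using False by (simp add: Z_def)
        qed
      qed
      also have "\<dots> = ?r \<rho>" using a0(1) by simp
      finally show "?r \<rho> > 0" .
    qed
  next
    assume pos: "\<forall>\<rho>\<in>?S. ?r \<rho> > 0"
    define \<phi> :: "'v \<times> 'v \<Rightarrow> complex" where "\<phi> = (\<lambda>a\<in>arcs T. 1)"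
    have "\<phi> \<in> stable_reps \<theta> T"
      unfolding stable_reps_def
    proof (intro CollectI conjI allI impI, goal_cases)
      case 1
      show ?case by (simp add: reps_def \<phi>_def)
    next
      case (2 S)
      hence sub: "\<And>v. module.subspace ((*) :: complex \<Rightarrow> complex \<Rightarrow> complex) (S v)"
        and arr: "\<And>a. a \<in> arcs T \<Longrightarrow> (\<lambda>z. \<phi> a * z) ` S (fst a) \<subseteq> S (snd a)"
        unfolding is_subrep_def f(1-3) by blast+
      define Z where "Z = {v. S v \<noteq> {0}}"
      have S: "S v = (if v \<in> Z then UNIV else {0})" for v
        using subspace_complex_line[OF sub[of v]] by (auto simp: Z_def)
      have "Z \<noteq> {}" using 2 by (auto simp: Z_def)
      have "Z \<noteq> UNIV"
      proof
        assume "Z = UNIV"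
        hence "S v = UNIV" for v using S by simp
        thus False using 2 by blast
      qed
      have closed: "snd a \<in> Z" if "a \<in> arcs T" "fst a \<in> Z" for a
      proof -
        have "(1 :: complex) \<in> (\<lambda>z. \<phi> a * z) ` S (fst a)" using that S by (simp add: \<phi>_def)
        hence "1 \<in> S (snd a)" using arr[OF that(1)] by blast
        thus ?thesis using S[of "snd a"] by (auto split: if_splits)
      qed
      obtain a1 where a1: "a1 \<in> arcs T" "\<not> (fst a1 \<in> Z \<longleftrightarrow> snd a1 \<in> Z)"
        using f(5) \<open>Z \<noteq> {}\<close> \<open>Z \<noteq> UNIV\<close> unfolding connected_iff_no_separation[OF f(1)] f(2,3) by blast
      have "0 < (\<Sum>a\<in>arcs T. ?r (weight v0 T a) * (of_bool (snd a \<in> Z) - of_bool (fst a \<in> Z)))"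
      proof (rule sum_pos2[OF _ a1(1)])
        show "0 < ?r (weight v0 T a1) * (of_bool (snd a1 \<in> Z) - of_bool (fst a1 \<in> Z))"
          using a1 closed[OF a1(1)] pos by auto
        show "0 \<le> ?r (weight v0 T a) * (of_bool (snd a \<in> Z) - of_bool (fst a \<in> Z))" if "a \<in> arcs T" for a
          using closed[OF that] pos that by (auto intro: less_imp_le)
      qed simp
      hence "(\<Sum>v\<in>Z. \<theta> $ v) < 0" unfolding th[symmetric] by simp
      also have "(\<Sum>v\<in>Z. \<theta> $ v) = (\<Sum>v\<in>UNIV. if v \<in> Z then \<theta> $ v else 0)" by (simp add: sum.If_cases)
      also have "\<dots> = (\<Sum>v\<in>UNIV. \<theta> $ v * real (vector_space.dim ((*) :: complex \<Rightarrow> complex \<Rightarrow> complex) (S v)))"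
        by (intro sum.cong refl) (simp add: S dim_complex_line)
      finally show ?case unfolding f(1) .
    qed
    thus "stable_reps \<theta> T \<noteq> {}" by blast
  qed
  finally show ?thesis .
qed

end

section \<open>Chambers and the residue formula\<close>

lemma representation_zero_in_span:
  fixes A :: "(real ^ 'v::finite) set"
  assumes A: "independent A" "\<xi> \<in> span A" and b: "b \<in> A" "representation A \<xi> b = 0"
  shows "\<xi> \<in> span (A - {b})"
proof -
  have fin: "finite A" using A(1) by (rule finiteI_independent)
  have "(\<Sum>x\<in>A. representation A \<xi> x *\<^sub>R x) = \<xi>"
    using sum_representation_eq[OF A fin order_refl] .
  moreover have "(\<Sum>x\<in>A. representation A \<xi> x *\<^sub>R x) = (\<Sum>x\<in>A - {b}. representation A \<xi> x *\<^sub>R x)"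
    using fin b by (intro sum.mono_neutral_right) auto
  moreover have "(\<Sum>x\<in>A - {b}. representation A \<xi> x *\<^sub>R x) \<in> span (A - {b})"
    by (intro span_sum span_scale span_base)
  ultimately show ?thesis by simp
qed

lemma regular_coordinate_nonzero:
  fixes B :: "(real ^ 'v::finite) set"
  assumes B: "independent B" "span B = dual_space v0" and sub: "B \<subseteq> S" and \<xi>: "\<xi> \<in> S_regular v0 S" and b: "b \<in> B"
  shows "representation B \<xi> b \<noteq> 0"
proof
  assume "representation B \<xi> b = 0"
  moreover have "\<xi> \<in> span B" using \<xi> B(2) by (simp add: S_regular_def)
  ultimately have "\<xi> \<in> span (B - {b})" by (intro representation_zero_in_span[OF B(1) _ b])
  moreover have fin: "finite B" using B(1) by (rule finiteI_independent)
  have "card B = CARD('v) - 1" using dim_span_eq_card_independent[OF B(1)] B(2) by (simp add: dim_dual_space)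
  hence "card (B - {b}) + 1 = CARD('v) - 1" using card_Suc_Diff1[OF fin b] by simp
  moreover have "finite (B - {b})" "B - {b} \<subseteq> S" using fin sub by auto
  ultimately show False using \<xi> unfolding S_regular_def by blast
qed

lemma subset_sums_superset: "S \<subseteq> subset_sums S"
proof
  fix x assume "x \<in> S"
  thus "x \<in> subset_sums S" unfolding subset_sums_def by (intro CollectI exI[of _ "{x}"]) simp
qed

text \<open>
  If the coordinates at \<open>b\<close> and \<open>b'\<close> agree, the vector lies in the hyperplane spanned by \<open>b + b'\<close> and the
  remaining elements of the basis.
\<close>

lemma regular_coordinates_distinct:
  fixes B :: "(real ^ 'v::finite) set"
  assumes B: "independent B" "span B = dual_space v0" and sub: "B \<subseteq> W"
    and \<xi>: "\<xi> \<in> S_regular v0 (subset_sums W)"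
  shows "inj_on (representation B \<xi>) B"
proof (rule inj_onI, rule ccontr)
  fix b b' assume b: "b \<in> B" "b' \<in> B" and eq: "representation B \<xi> b = representation B \<xi> b'" and ne: "b \<noteq> b'"
  have fin: "finite B" using B(1) by (rule finiteI_independent)
  have \<xi>B: "\<xi> \<in> span B" using \<xi> B(2) by (simp add: S_regular_def)
  define D where "D = B - {b, b'}"
  have BD: "B = insert b (insert b' D)" "b \<notin> insert b' D" "b' \<notin> D" "finite D"
    using b ne fin by (auto simp: D_def)
  define g where "g = (\<lambda>x. representation B \<xi> x *\<^sub>R x)"
  have "\<xi> = sum g B"
    unfolding g_def by (rule sum_representation_eq[OF B(1) \<xi>B fin order_refl, symmetric])
  also have "\<dots> = sum g (insert b (insert b' D))" by (rule arg_cong[OF BD(1)])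
  also have "\<dots> = representation B \<xi> b *\<^sub>R b + (representation B \<xi> b' *\<^sub>R b' + (\<Sum>x\<in>D. representation B \<xi> x *\<^sub>R x))"
    using BD(2-4) by (simp add: g_def)
  also have "\<dots> = representation B \<xi> b *\<^sub>R (b + b') + (\<Sum>x\<in>D. representation B \<xi> x *\<^sub>R x)"
    by (simp add: eq scaleR_add_right)
  also have "\<dots> \<in> span (insert (b + b') D)"
    by (intro span_add span_scale span_sum span_base) auto
  finally have "\<xi> \<in> span (insert (b + b') D)" .
  moreover have "b + b' \<notin> D"
  proof
    assume bb: "b + b' \<in> D"
    have "b = (b + b') - b'" by simp
    also have "\<dots> \<in> span (B - {b})"
      using bb b ne by (intro span_diff span_base) (auto simp: D_def)
    finally show False using B(1) b(1) unfolding dependent_def by blast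
  qed
  hence "card (insert (b + b') D) = Suc (card D)" using BD(4) by simp
  moreover have "card B = Suc (Suc (card D))" using arg_cong[OF BD(1), of card] BD(2-4) by simp
  moreover have "card B = CARD('v) - 1" using dim_span_eq_card_independent[OF B(1)] B(2) by (simp add: dim_dual_space)
  ultimately have "\<xi> \<in> span (insert (b + b') D)" "card (insert (b + b') D) + 1 = CARD('v) - 1" by auto
  moreover have "finite (insert (b + b') D)" using BD(4) by simp
  moreover have "insert (b + b') D \<subseteq> subset_sums W"
  proof -
    have "b + b' = \<Sum>{b, b'}" using ne by simp
    moreover have "{b, b'} \<subseteq> W" using b sub by blast
    ultimately have "b + b' \<in> subset_sums W" unfolding subset_sums_def by blast
    moreover have "D \<subseteq> subset_sums W" using sub subset_sums_superset[of W] by (auto simp: D_def)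
    ultimately show ?thesis by blast
  qed
  ultimately show False using \<xi> unfolding S_regular_def by blast
qed

text \<open>
  A coordinate is a continuous function without zeros on the connected chamber.
\<close>

lemma chamber_coordinate_sign:
  fixes B :: "(real ^ 'v::finite) set"
  assumes B: "independent B" "span B = dual_space v0" and sub: "B \<subseteq> W" and b: "b \<in> B"
    and C: "C \<in> chambers v0 W" and \<xi>: "\<xi> \<in> C" and \<eta>: "\<eta> \<in> C" and pos: "representation B \<xi> b > 0"
  shows "representation B \<eta> b > 0"
proof (rule ccontr)
  assume "\<not> representation B \<eta> b > 0"
  have CS: "C \<subseteq> S_regular v0 W" and conn: "Topological_Spaces.connected C"
    using C in_components_subset in_components_connected unfolding chambers_def by blast+
  define coord where "coord = (\<lambda>\<xi>. Re (pairing \<xi> (dual_vec v0 B b)))"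
  have coord: "coord \<xi> = representation B \<xi> b" if "\<xi> \<in> C" for \<xi>
    using pairing_dual_vec[OF B, of \<xi> b] that CS by (auto simp: coord_def S_regular_def)
  have "continuous_on C coord" unfolding coord_def pairing_def
    by (intro continuous_intros continuous_on_component)
  hence "Topological_Spaces.connected (coord ` C)" using conn by (rule connected_continuous_image)
  moreover have "coord \<eta> \<in> coord ` C" "coord \<xi> \<in> coord ` C" using \<xi> \<eta> by auto
  moreover have "coord \<eta> \<le> 0" "0 \<le> coord \<xi>" using coord \<xi> \<eta> pos \<open>\<not> representation B \<eta> b > 0\<close> by auto
  ultimately have "0 \<in> coord ` C" using connected_contains_Icc[of "coord ` C" "coord \<eta>" "coord \<xi>"] by auto
  then obtain \<mu> where "\<mu> \<in> C" "representation B \<mu> b = 0" using coord by force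
  thus False using regular_coordinate_nonzero[OF B sub _ b] CS by blast
qed

theorem corollary6p7:
  fixes Q :: "('v::finite, 'a) pre_digraph"
    and v0 :: 'v
    and \<theta> \<zeta> :: "real ^ 'v"
    and W :: "(real ^ 'v) set"
    and P :: "(real ^ 'v \<Rightarrow> real) set"
    and R :: "real ^ 'v \<Rightarrow> real"
    and f :: "complex ^ 'v \<Rightarrow> complex"
    and d :: "complex ^ 'v \<Rightarrow> (real ^ 'v) list"
    and e :: "('v, 'v \<times> 'v) pre_digraph \<Rightarrow> ('v \<times> 'v) list"
  assumes "fin_digraph Q" and "verts Q = UNIV"
    and "Digraph_Component.connected Q"
    and "loopfree_digraph Q" and "\<nexists>p. pre_digraph.cycle Q p"
    and "(\<Sum>v\<in>UNIV. \<theta> $ v) = 0"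
    and "W = weights v0 Q"
    and "theta_tilde v0 \<theta> \<in> S_regular v0 W"
    and "\<zeta> \<in> S_regular v0 (subset_sums W)"
    and "\<exists>C\<in>chambers v0 W. \<zeta> \<in> C \<and> - theta_tilde v0 \<theta> \<in> C"
    and "generic_cone v0 W P" and "R \<in> P"
    and "meromorphic_several v0 f"
    and "\<forall>x\<in>M_sing v0 W R. \<exists>r>0. holomorphic_several v0 f
           ((ball x r \<inter> cspace v0) - (\<Union>g\<in>active_weights v0 W R x. {u. pairing g (u - x) = 0}))"
    and "\<forall>x\<in>M_sing v0 W R. is_basis v0 (d x) \<and> set (d x) \<subseteq> active_weights v0 W R x"
    and "\<forall>T\<in>spanning_trees (reduced_quiver Q). distinct (e T) \<and> set (e T) = arcs T"
  shows "JK v0 W R d f \<zeta> =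
    (\<Sum>T\<in>stable_spanning_trees \<theta> (reduced_quiver Q).
       iterated_residue (CARD('v) - 1) (tree_germ v0 R T (e T) f))"
proof -
  define G where "G = reduced_quiver Q"
  define M where "M = M_sing v0 W R"
  interpret loopfree_pairs G v0
  proof
    show "verts G = UNIV" "tail G = fst" "head G = snd"
      using assms(2) by (simp_all add: G_def reduced_quiver_def)
    show "fst a \<noteq> snd a" if "a \<in> arcs G" for a
      using that loopfree_digraph.no_loops[OF assms(4)]
      by (auto simp: G_def reduced_quiver_def arc_to_ends_def)
  qed
  have W: "W = weight v0 G ` arcs G" using assms(7) by (simp add: weights_def G_def)
  have finW: "finite W" unfolding W by simp
  have WV: "W \<subseteq> dual_space v0" unfolding W using weight_in_dual_space by auto
  have few: "\<not> (B \<subseteq> W \<and> card B = CARD('v) \<and> x \<in> M \<and> (\<forall>\<rho>\<in>B. x \<in> hyperplane v0 R \<rho>))" for B x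
    using assms(11,12) unfolding generic_cone_def M_def by blast
  \<comment> \<open>by genericity, one further active weight would be too many\<close>
  have active: "B = active_weights v0 W R x"
    if x: "x \<in> M" and B: "B \<subseteq> W" "card B \<ge> CARD('v) - 1" "\<forall>\<rho>\<in>B. x \<in> hyperplane v0 R \<rho>" for x B
  proof -
    let ?A = "active_weights v0 W R x"
    have finA: "finite ?A" using finW by (simp add: active_weights_def)
    have BA: "B \<subseteq> ?A" using B by (auto simp: active_weights_def)
    have "\<not> CARD('v) \<le> card ?A"
    proof
      assume "CARD('v) \<le> card ?A"
      then obtain B' where B': "B' \<subseteq> ?A" "card B' = CARD('v)" by (rule obtain_subset_with_card_n)
      thus False using few[of B' x] x by (auto simp: active_weights_def)
    qed
    hence "card ?A \<le> card B" using B(2) by linarith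
    thus ?thesis using card_seteq[OF finA BA] by simp
  qed
  have active_basis: "independent (active_weights v0 W R x)" "span (active_weights v0 W R x) = dual_space v0"
    "active_weights v0 W R x \<subseteq> W" if x: "x \<in> M" for x
  proof -
    obtain B where B: "B \<subseteq> W" "independent B" "card B \<ge> CARD('v) - 1" "\<forall>\<rho>\<in>B. x \<in> hyperplane v0 R \<rho>"
      using x unfolding M_def M_sing_def by blast
    have A: "active_weights v0 W R x = B" using active[OF x B(1,3,4)] by simp
    show "independent (active_weights v0 W R x)" "active_weights v0 W R x \<subseteq> W" using A B by auto
    have BV: "B \<subseteq> dual_space v0" using B(1) WV by blast
    have "dual_space v0 \<subseteq> span B"
      by (rule card_ge_dim_independent[OF BV B(2)]) (use B(3) in \<open>simp add: dim_dual_space\<close>)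
    thus "span (active_weights v0 W R x) = dual_space v0"
      using span_minimal[OF BV subspace_dual_space] A by blast
  qed
  define \<beta> where "\<beta> = (\<lambda>T. map (weight v0 T) (e T))"
  have e: "distinct (e T)" "set (e T) = arcs T" if "T \<in> spanning_trees G" for T
    using assms(16) that by (auto simp: G_def)
  have \<beta>: "is_basis v0 (\<beta> T)" "set (\<beta> T) = weight v0 T ` arcs T" "set (\<beta> T) \<subseteq> W" if T: "T \<in> spanning_trees G" for T
  proof -
    note ft = spanning_tree_facts[OF T]
    show s: "set (\<beta> T) = weight v0 T ` arcs T" using e(2)[OF T] by (simp add: \<beta>_def)
    show "set (\<beta> T) \<subseteq> W" unfolding s W using ft(4,7) by auto
    have "distinct (\<beta> T)"
      using e[OF T] inj_on_subset[OF inj_weight ft(4)] ft(7) by (simp add: \<beta>_def distinct_map)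
    thus "is_basis v0 (\<beta> T)" using weights_of_tree_basis[OF T] s by (simp add: is_basis_def)
  qed
  have tree_point: "tree_point v0 R T \<in> cspace v0 \<and> (\<forall>\<rho>\<in>set (\<beta> T). tree_point v0 R T \<in> hyperplane v0 R \<rho>)"
    and tree_point_unique: "\<And>x. x \<in> cspace v0 \<Longrightarrow> \<forall>\<rho>\<in>set (\<beta> T). x \<in> hyperplane v0 R \<rho> \<Longrightarrow> x = tree_point v0 R T"
    if T: "T \<in> spanning_trees G" for T
  proof -
    define x where "x = combine (map (\<lambda>b. - of_real (R b)) (\<beta> T)) (map (dual_vec v0 (set (\<beta> T))) (\<beta> T))"
    have xc: "x \<in> cspace v0" unfolding x_def by (rule combine_in_cspace) (use dual_vec_in_cspace in auto)
    have px: "pairing b x = - of_real (R b)" if b: "b \<in> set (\<beta> T)" for b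
    proof -
      obtain i where "i < length (\<beta> T)" "b = \<beta> T ! i" using b by (metis in_set_conv_nth)
      thus ?thesis using pairing_combine[OF \<beta>(1)[OF T], of i] by (simp add: x_def)
    qed
    have uniq: "y = x" if y: "y \<in> cspace v0" "\<forall>\<rho>\<in>set (\<beta> T). y \<in> hyperplane v0 R \<rho>" for y
    proof (rule eq_of_pairings[OF \<beta>(1)[OF T] y(1) xc], rule ballI)
      fix b assume b: "b \<in> set (\<beta> T)"
      have "pairing b y + of_real (R b) = 0" using y(2) b by (simp add: hyperplane_def)
      hence "pairing b y = - of_real (R b)" by (simp only: eq_neg_iff_add_eq_0)
      thus "pairing b y = pairing b x" unfolding px[OF b] .
    qed
    have ex: "x \<in> cspace v0 \<and> (\<forall>\<rho>\<in>set (\<beta> T). x \<in> hyperplane v0 R \<rho>)"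
      using xc px by (simp add: hyperplane_def)
    have "tree_point v0 R T = (THE x. x \<in> cspace v0 \<and> (\<forall>\<rho>\<in>set (\<beta> T). x \<in> hyperplane v0 R \<rho>))"
      by (simp add: tree_point_def \<beta>(2)[OF T])
    also have "\<dots> = x" by (rule the_equality, rule ex) (use uniq in blast)
    finally have tx: "tree_point v0 R T = x" .
    show "tree_point v0 R T \<in> cspace v0 \<and> (\<forall>\<rho>\<in>set (\<beta> T). tree_point v0 R T \<in> hyperplane v0 R \<rho>)"
      unfolding tx by (rule ex)
    show "y = tree_point v0 R T" if "y \<in> cspace v0" "\<forall>\<rho>\<in>set (\<beta> T). y \<in> hyperplane v0 R \<rho>" for y
      unfolding tx by (rule uniq[OF that])
  qed
  have card\<beta>: "card (set (\<beta> T)) = CARD('v) - 1" if "T \<in> spanning_trees G" for T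
    using is_basis_length[OF \<beta>(1)[OF that]] \<beta>(1)[OF that] by (simp add: is_basis_def distinct_card)
  have point_M: "tree_point v0 R T \<in> M" if T: "T \<in> spanning_trees G" for T
    unfolding M_def M_sing_def
  proof (intro CollectI conjI exI[of _ "set (\<beta> T)"])
    show "independent (set (\<beta> T))" using \<beta>(1)[OF T] by (simp add: is_basis_def)
  qed (use tree_point[OF T] \<beta>(3)[OF T] card\<beta>[OF T] in auto)
  have active_tree: "active_weights v0 W R (tree_point v0 R T) = set (\<beta> T)" if T: "T \<in> spanning_trees G" for T
    using active[OF point_M[OF T] \<beta>(3)[OF T]] card\<beta>[OF T] tree_point[OF T] by simp
  have bij: "bij_betw (tree_point v0 R) (spanning_trees G) M"
  proof (rule bij_betw_imageI)
    show "inj_on (tree_point v0 R) (spanning_trees G)"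
    proof (rule inj_onI)
      fix T T' assume T: "T \<in> spanning_trees G" "T' \<in> spanning_trees G" and eq: "tree_point v0 R T = tree_point v0 R T'"
      have "weight v0 G ` arcs T = weight v0 G ` arcs T'"
        using active_tree[OF T(1)] active_tree[OF T(2)] eq \<beta>(2)[OF T(1)] \<beta>(2)[OF T(2)]
          spanning_tree_facts(7)[OF T(1)] spanning_tree_facts(7)[OF T(2)] by simp
      hence "arcs T = arcs T'"
        using inj_on_image_eq_iff[OF inj_weight] spanning_tree_facts(4) T by blast
      thus "T = T'" by (rule spanning_tree_eqI[OF T])
    qed
    show "tree_point v0 R ` spanning_trees G = M"
    proof
      show "tree_point v0 R ` spanning_trees G \<subseteq> M" using point_M by blast
      show "M \<subseteq> tree_point v0 R ` spanning_trees G"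
      proof
        fix x assume x: "x \<in> M"
        obtain T where T: "T \<in> spanning_trees G" "weight v0 T ` arcs T = active_weights v0 W R x"
          using tree_of_basis[of "active_weights v0 W R x"] active_basis[OF x] W by blast
        have "x \<in> cspace v0" using x by (simp add: M_def M_sing_def)
        moreover have "\<forall>\<rho>\<in>set (\<beta> T). x \<in> hyperplane v0 R \<rho>"
          unfolding \<beta>(2)[OF T(1)] T(2) by (simp add: active_weights_def)
        ultimately have "x = tree_point v0 R T" by (rule tree_point_unique[OF T(1)])
        thus "x \<in> tree_point v0 R ` spanning_trees G" using T(1) by blast
      qed
    qed
  qed
  obtain C where C: "C \<in> chambers v0 W" "\<zeta> \<in> C" "- theta_tilde v0 \<theta> \<in> C" using assms(10) by blast
  have \<zeta>: "\<zeta> \<in> dual_space v0" using assms(9) by (simp add: S_regular_def)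
  have local_term: "JK_residue v0 (d x) (active_weights v0 W R x) \<zeta> (\<lambda>u. f (u + x)) =
      (if stable_moduli \<theta> T \<noteq> {} then iterated_residue (CARD('v) - 1) (tree_germ v0 R T (e T) f) else 0)"
    if T: "T \<in> spanning_trees G" and x: "x = tree_point v0 R T" for T x
  proof -
    have A: "active_weights v0 W R x = set (\<beta> T)" unfolding x by (rule active_tree[OF T])
    have xM: "x \<in> M" unfolding x by (rule point_M[OF T])
    have xc: "x \<in> cspace v0" using xM by (simp add: M_def M_sing_def)
    have b: "is_basis v0 (\<beta> T)" by (rule \<beta>(1)[OF T])
    have ind: "independent (set (\<beta> T))" "span (set (\<beta> T)) = dual_space v0" using b by (auto simp: is_basis_def)
    have d: "is_basis v0 (d x)" "set (d x) \<subseteq> set (\<beta> T)" using assms(15) xM A by (auto simp: M_def)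
    have "card (set (d x)) = card (set (\<beta> T))"
      using is_basis_length[OF d(1)] d(1) card\<beta>[OF T] by (simp add: is_basis_def distinct_card)
    hence dset: "set (d x) = set (\<beta> T)" by (intro card_subset_eq d(2)) auto
    obtain r where "r > 0" and hol: "holomorphic_several v0 f
           ((ball x r \<inter> cspace v0) - (\<Union>g\<in>set (\<beta> T). {u. pairing g (u - x) = 0}))"
      using assms(14) xM A by (auto simp: M_def)
    have germ: "regular_germ v0 (set (\<beta> T)) (\<lambda>u. f (u + x))"
      by (rule regular_germ_of_meromorphic[OF b xc \<open>r > 0\<close> hol assms(13)])
    have "JK_residue v0 (d x) (set (\<beta> T)) \<zeta> (\<lambda>u. f (u + x)) =
      (if \<forall>\<rho>\<in>set (\<beta> T). representation (set (\<beta> T)) \<zeta> \<rho> > 0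
       then iterated_residue (CARD('v) - 1) (in_coords v0 (\<beta> T) (\<lambda>u. f (u + x))) else 0)"
      by (rule JK_residue_simplicial[OF b d(1) dset \<zeta> regular_coordinates_distinct[OF ind \<beta>(3)[OF T] assms(9)] germ])
    moreover have "(\<forall>\<rho>\<in>set (\<beta> T). representation (set (\<beta> T)) \<zeta> \<rho> > 0) \<longleftrightarrow> stable_moduli \<theta> T \<noteq> {}"
      unfolding stable_tree_iff[OF T assms(6)] \<beta>(2)[OF T, symmetric]
      using chamber_coordinate_sign[OF ind \<beta>(3)[OF T] _ C(1) C(2,3)]
        chamber_coordinate_sign[OF ind \<beta>(3)[OF T] _ C(1) C(3,2)] by blast
    moreover have "tree_germ v0 R T (e T) f = in_coords v0 (\<beta> T) (\<lambda>u. f (u + x))"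
      by (simp add: tree_germ_def \<beta>_def x)
    ultimately show ?thesis by (simp only: A)
  qed
  have "JK v0 W R d f \<zeta> = (\<Sum>x\<in>M. JK_residue v0 (d x) (active_weights v0 W R x) \<zeta> (\<lambda>u. f (u + x)))"
    by (simp add: JK_def M_def)
  also have "\<dots> = (\<Sum>T\<in>spanning_trees G. JK_residue v0 (d (tree_point v0 R T))
      (active_weights v0 W R (tree_point v0 R T)) \<zeta> (\<lambda>u. f (u + tree_point v0 R T)))"
    by (rule sum.reindex_bij_betw[OF bij, symmetric])
  also have "\<dots> = (\<Sum>T\<in>spanning_trees G. if stable_moduli \<theta> T \<noteq> {}
      then iterated_residue (CARD('v) - 1) (tree_germ v0 R T (e T) f) else 0)"
    by (intro sum.cong refl local_term)
  also have "\<dots> = (\<Sum>T\<in>{T \<in> spanning_trees G. stable_moduli \<theta> T \<noteq> {}}.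
      iterated_residue (CARD('v) - 1) (tree_germ v0 R T (e T) f))"
    by (rule sum.inter_filter[symmetric]) (rule finite_spanning_trees)
  finally show ?thesis by (simp add: stable_spanning_trees_def G_def)
qed

end
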